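(* (Construction.) Let $(M_0,g_0)$ be a Lorentzian manifold with a $\nabla^{g_0}$-parallel isotropic vector field $p_0$ and a $\nabla^{g_0}$-parallel form $\tau_0=p_0^\flat\wedge\omega$, where $\omega$ is a $\nabla^{g_0}$-parallel 2-form on the screen bundle $p_0^\perp/\langle p_0\rangle$. Suppose that there exists a function $\varphi$ on $M_0$ such that $p_0^\flat=d e^{\varphi}$. Let $\xi=e^{-\varphi}p_0$ and $S=e^{-\varphi}\tau_0$. Then the connection $\nabla$ on $M_0$ given by $$\nabla_X=\nabla^{g_0}_X+X\wedge\xi+\tfrac12S(X)$$ has parallel twistor-free torsion with isotropic vectorial component $\xi$ and skew-symmetric component $S$. (Converse.) Each simply connected Lorentzian manifold admitting a metric connection with parallel twistor-free torsion having isotropic vectorial component and degenerate skew-symmetric component is globally equivalent (by an isometry identifying the connections) to one obtained by this construction.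
   Context: Lorentzian manifolds have signature $(-,+,\dots,+)$, dimension $\ge2$. $\nabla^g$ denotes the Levi-Civita connection. A connection $\nabla$ on $(M,g)$ is metric if $\nabla g=0$. Bivectors act by $(X\wedge Y)Z=g(X,Z)Y-g(Y,Z)X$. For a 3-form $S$ write $g(S(X)Y,Z)=g(S(X,Y),Z)=S(X,Y,Z)$. Vectors and covectors are identified by $g$; $p^\flat=g(p,\cdot)$. A metric connection with twistor-free torsion (i.e. torsion with zero twistorial component) is a connection of the form $$\nabla_X=\nabla^g_X+X\wedge\xi+\tfrac12 S(X),$$ where $\xi\in\Gamma(TM)$ is the vectorial component and $S\in\Omega^3(M)$ is the skew-symmetric component of the torsion; its torsion is $T(X,Y)=(X\wedge Y)\xi+S(X,Y)$. The torsion is parallel if $\nabla T=0$, which is equivalent to $\nabla\xi=0$ and $\nabla S=0$. A vector field $\xi$ is isotropic if it is nowhere zero and $g(\xi,\xi)=0$. $S$ is called degenerate if its $g$-norm $\|S\|_g$ is zero. If $p$ is a $\nabla^g$-parallel isotropic vector field, the screen bundle $p^\perp/\langle p\rangle$ carries the connection induced by $\nabla^g$ (for $X\in\Gamma(TM)$ and a section $Y$ of $p^\perp/\langle p\rangle$ with lift $\tilde Y\in\Gamma(p^\perp)$, the derivative of $Y$ along $X$ is the projection of $\nabla^g_X\tilde Y$). A 2-form $\omega$ on the screen bundle is identified, using the induced positive definite metric, with a section of $\wedge^2(p^\perp/\langle p\rangle)$; the trivector $p\wedge\omega$, computed with any lift of $\omega$ to $\wedge^2p^\perp$, does not depend on the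 lift, and it is identified with the 3-form $p^\flat\wedge\omega$. *)

theory Defs
  imports "HOL-Analysis.Analysis"
begin

primrec Ck_on :: "nat \<Rightarrow> 'a::euclidean_space set \<Rightarrow> ('a \<Rightarrow> 'b::real_normed_vector) \<Rightarrow> bool" where
  "Ck_on 0 S f \<longleftrightarrow> continuous_on S f"
| "Ck_on (Suc k) S f \<longleftrightarrow> (\<forall>x\<in>S. f differentiable (at x)) \<and>
     (\<forall>v. Ck_on k S (\<lambda>x. frechet_derivative f (at x) v))"

text \<open>Used for open sets only.\<close>

definition smooth_on :: "'a::euclidean_space set \<Rightarrow> ('a \<Rightarrow> 'b::real_normed_vector) \<Rightarrow> bool" where
  "smooth_on S f \<longleftrightarrow> (\<forall>k. Ck_on k S f)"

text \<open>
  The points of a manifold are the elements of a Hausdorff, second countable type \<open>'m\<close>, with the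
  topology of that type; the charts take values in \<open>'e\<close>, so the dimension is \<open>DIM('e)\<close>.
  Besides its atlas a manifold carries, for each point \<open>x\<close>, a preferred chart \<open>chart_at M x\<close>
  around \<open>x\<close>. The preferred chart serves to write down tangent vectors: the tangent space at \<open>x\<close>
  is a copy of \<open>'e\<close>, and \<open>v :: 'e\<close> stands for the tangent vector at \<open>x\<close> with components \<open>v\<close> in
  \<open>chart_at M x\<close>. Its components in any other chart are obtained by the
  Jacobian of the change of charts (\<open>chart_diff\<close>). Preferred charts at different points are
  unrelated, so smoothness of a tensor field is never smoothness of the bare map \<open>'m \<Rightarrow> \<dots>\<close>.
\<close>

record ('m, 'e) chart =
  cdomain :: "'m set"
  cmap :: "'m \<Rightarrow> 'e"

definition cinv :: "('m, 'e) chart \<Rightarrow> 'e \<Rightarrow> 'm" where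
  "cinv c = inv_into (cdomain c) (cmap c)"

definition is_chart :: "('m::topological_space, 'e::euclidean_space) chart \<Rightarrow> bool" where
  "is_chart c \<longleftrightarrow> open (cdomain c) \<and> open (cmap c ` cdomain c) \<and>
     homeomorphism (cdomain c) (cmap c ` cdomain c) (cmap c) (cinv c)"

record ('m, 'e) manifold =
  atlas :: "('m, 'e) chart set"
  chart_at :: "'m \<Rightarrow> ('m, 'e) chart"

definition smooth_manifold ::
  "('m::{t2_space,second_countable_topology}, 'e::euclidean_space) manifold \<Rightarrow> bool" where
  "smooth_manifold M \<longleftrightarrow>
     (\<forall>c\<in>atlas M. is_chart c) \<and>
     (\<forall>c\<in>atlas M. \<forall>c'\<in>atlas M.
        smooth_on (cmap c ` (cdomain c \<inter> cdomain c')) (cmap c' \<circ> cinv c)) \<and>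
     (\<forall>x. chart_at M x \<in> atlas M \<and> x \<in> cdomain (chart_at M x))"

definition chart_diff ::
  "('m, 'e::euclidean_space) manifold \<Rightarrow> ('m, 'e) chart \<Rightarrow> 'm \<Rightarrow> 'e \<Rightarrow> 'e" where
  "chart_diff M c x =
     frechet_derivative (cmap c \<circ> cinv (chart_at M x)) (at (cmap (chart_at M x) x))"

definition smooth_fun ::
  "('m, 'e::euclidean_space) manifold \<Rightarrow> 'm set \<Rightarrow> ('m \<Rightarrow> real) \<Rightarrow> bool" where
  "smooth_fun M U f \<longleftrightarrow>
     (\<forall>c\<in>atlas M. smooth_on (cmap c ` (cdomain c \<inter> U)) (f \<circ> cinv c))"

definition dfun ::
  "('m, 'e::euclidean_space) manifold \<Rightarrow> ('m \<Rightarrow> real) \<Rightarrow> 'm \<Rightarrow> 'e \<Rightarrow> real" where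
  "dfun M f x = frechet_derivative (f \<circ> cinv (chart_at M x)) (at (cmap (chart_at M x) x))"

definition vf_in_chart ::
  "('m, 'e::euclidean_space) manifold \<Rightarrow> ('m, 'e) chart \<Rightarrow> ('m \<Rightarrow> 'e) \<Rightarrow> 'e \<Rightarrow> 'e" where
  "vf_in_chart M c X = (\<lambda>y. chart_diff M c (cinv c y) (X (cinv c y)))"

text \<open>Smooth vector fields on an open set \<open>U\<close>; the values outside \<open>U\<close> are irrelevant.\<close>

definition smooth_vf ::
  "('m, 'e::euclidean_space) manifold \<Rightarrow> 'm set \<Rightarrow> ('m \<Rightarrow> 'e) \<Rightarrow> bool" where
  "smooth_vf M U X \<longleftrightarrow>
     (\<forall>c\<in>atlas M. smooth_on (cmap c ` (cdomain c \<inter> U)) (vf_in_chart M c X))"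

text \<open>
  The coordinate formula \<open>[X,Y]\<^sup>i = X\<^sup>j \<partial>\<^sub>j Y\<^sup>i - Y\<^sup>j \<partial>\<^sub>j X\<^sup>i\<close>, evaluated at \<open>x\<close> in
  \<open>chart_at M x\<close>.
\<close>

definition lie_bracket ::
  "('m, 'e::euclidean_space) manifold \<Rightarrow> ('m \<Rightarrow> 'e) \<Rightarrow> ('m \<Rightarrow> 'e) \<Rightarrow> 'm \<Rightarrow> 'e" where
  "lie_bracket M X Y x =
     (let c = chart_at M x in
        frechet_derivative (vf_in_chart M c Y) (at (cmap c x)) (X x)
      - frechet_derivative (vf_in_chart M c X) (at (cmap c x)) (Y x))"

definition smooth_map ::
  "('m::topological_space, 'e::euclidean_space) manifold \<Rightarrow>
   ('n::topological_space, 'e) manifold \<Rightarrow> ('m \<Rightarrow> 'n) \<Rightarrow> bool" where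
  "smooth_map M N F \<longleftrightarrow> continuous_on UNIV F \<and>
     (\<forall>c\<in>atlas M. \<forall>c'\<in>atlas N.
        smooth_on (cmap c ` (cdomain c \<inter> F -` cdomain c')) (cmap c' \<circ> F \<circ> cinv c))"

definition diffeomorphism ::
  "('m::topological_space, 'e::euclidean_space) manifold \<Rightarrow>
   ('n::topological_space, 'e) manifold \<Rightarrow> ('m \<Rightarrow> 'n) \<Rightarrow> bool" where
  "diffeomorphism M N F \<longleftrightarrow> bij F \<and> smooth_map M N F \<and> smooth_map N M (inv F)"

definition dmap ::
  "('m, 'e::euclidean_space) manifold \<Rightarrow> ('n, 'e) manifold \<Rightarrow> ('m \<Rightarrow> 'n) \<Rightarrow> 'm \<Rightarrow> 'e \<Rightarrow> 'e" where
  "dmap M N F x =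
     frechet_derivative (cmap (chart_at N (F x)) \<circ> F \<circ> cinv (chart_at M x))
       (at (cmap (chart_at M x) x))"

definition push_vf ::
  "('m, 'e::euclidean_space) manifold \<Rightarrow> ('n, 'e) manifold \<Rightarrow> ('m \<Rightarrow> 'n) \<Rightarrow>
   ('m \<Rightarrow> 'e) \<Rightarrow> 'n \<Rightarrow> 'e" where
  "push_vf M N F X = (\<lambda>y. dmap M N F (inv F y) (X (inv F y)))"

text \<open>
  An orthonormal basis \<open>e 0, \<dots>, e (n-1)\<close>, \<open>n = DIM('e)\<close>, for the signature \<open>(-,+,\<dots>,+)\<close>;
  \<open>n\<close> pairwise orthogonal non-null vectors are automatically a basis.
\<close>

definition lorentz_frame :: "('e::euclidean_space \<Rightarrow> 'e \<Rightarrow> real) \<Rightarrow> (nat \<Rightarrow> 'e) \<Rightarrow> bool" where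
  "lorentz_frame h e \<longleftrightarrow> (\<forall>i<DIM('e). \<forall>j<DIM('e).
     h (e i) (e j) = (if i = j then (if i = 0 then -1 else 1) else 0))"

definition lorentz_form :: "('e::euclidean_space \<Rightarrow> 'e \<Rightarrow> real) \<Rightarrow> bool" where
  "lorentz_form h \<longleftrightarrow> bilinear h \<and> (\<forall>u v. h u v = h v u) \<and> (\<exists>e. lorentz_frame h e)"

definition bivector :: "('e::euclidean_space \<Rightarrow> 'e \<Rightarrow> real) \<Rightarrow> 'e \<Rightarrow> 'e \<Rightarrow> 'e \<Rightarrow> 'e" where
  "bivector h u v w = h u w *\<^sub>R v - h v w *\<^sub>R u"

definition alternating2 :: "('e::euclidean_space \<Rightarrow> 'e \<Rightarrow> real) \<Rightarrow> bool" where
  "alternating2 b \<longleftrightarrow> bilinear b \<and> (\<forall>u v. b u v = - b v u)"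

definition alternating3 :: "('e::euclidean_space \<Rightarrow> 'e \<Rightarrow> 'e \<Rightarrow> real) \<Rightarrow> bool" where
  "alternating3 s \<longleftrightarrow> (\<forall>v w. linear (\<lambda>u. s u v w)) \<and>
     (\<forall>u v w. s u v w = - s v u w) \<and> (\<forall>u v w. s u v w = - s u w v)"

text \<open>The vector \<open>s(u)v\<close> with \<open>h(s(u)v, w) = s(u,v,w)\<close>.\<close>

definition form3_op ::
  "('e::euclidean_space \<Rightarrow> 'e \<Rightarrow> real) \<Rightarrow> ('e \<Rightarrow> 'e \<Rightarrow> 'e \<Rightarrow> real) \<Rightarrow> 'e \<Rightarrow> 'e \<Rightarrow> 'e" where
  "form3_op h s u v = (THE z. \<forall>w. h z w = s u v w)"

text \<open>
  The (indefinite) square \<open>s\<^sub>i\<^sub>j\<^sub>k s\<^sup>i\<^sup>j\<^sup>k\<close> of the norm of a 3-form; it does not depend on the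
  chosen frame.
\<close>

definition form3_norm_sq ::
  "('e::euclidean_space \<Rightarrow> 'e \<Rightarrow> real) \<Rightarrow> ('e \<Rightarrow> 'e \<Rightarrow> 'e \<Rightarrow> real) \<Rightarrow> real" where
  "form3_norm_sq h s =
     (let e = (SOME e. lorentz_frame h e) in
        \<Sum>i<DIM('e). \<Sum>j<DIM('e). \<Sum>k<DIM('e).
          h (e i) (e i) * h (e j) (e j) * h (e k) (e k) * (s (e i) (e j) (e k))\<^sup>2)"

definition wedge12 ::
  "('e \<Rightarrow> real) \<Rightarrow> ('e \<Rightarrow> 'e \<Rightarrow> real) \<Rightarrow> 'e \<Rightarrow> 'e \<Rightarrow> 'e \<Rightarrow> real" where
  "wedge12 a b u v w = a u * b v w + a v * b w u + a w * b u v"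

definition lorentzian_manifold ::
  "('m::{t2_space,second_countable_topology}, 'e::euclidean_space) manifold \<Rightarrow>
   ('m \<Rightarrow> 'e \<Rightarrow> 'e \<Rightarrow> real) \<Rightarrow> bool" where
  "lorentzian_manifold M g \<longleftrightarrow> DIM('e) \<ge> 2 \<and> smooth_manifold M \<and> (\<forall>x. lorentz_form (g x)) \<and>
     (\<forall>U X Y. open U \<and> smooth_vf M U X \<and> smooth_vf M U Y \<longrightarrow>
        smooth_fun M U (\<lambda>x. g x (X x) (Y x)))"

definition form3 ::
  "('m::topological_space, 'e::euclidean_space) manifold \<Rightarrow>
   ('m \<Rightarrow> 'e \<Rightarrow> 'e \<Rightarrow> 'e \<Rightarrow> real) \<Rightarrow> bool" where
  "form3 M S \<longleftrightarrow> (\<forall>x. alternating3 (S x)) \<and>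
     (\<forall>U X Y Z. open U \<and> smooth_vf M U X \<and> smooth_vf M U Y \<and> smooth_vf M U Z \<longrightarrow>
        smooth_fun M U (\<lambda>x. S x (X x) (Y x) (Z x)))"

text \<open>
  A connection \<open>D\<close> assigns to a point \<open>x\<close>, a tangent vector \<open>v\<close> at \<open>x\<close> and a vector field \<open>Y\<close>
  defined and smooth near \<open>x\<close> the covariant derivative \<open>D x v Y\<close>, a tangent vector at \<open>x\<close>.
  The values on fields that are not smooth near \<open>x\<close> are meaningless.
\<close>

type_synonym ('m, 'e) conn = "'m \<Rightarrow> 'e \<Rightarrow> ('m \<Rightarrow> 'e) \<Rightarrow> 'e"

definition connection ::
  "('m::topological_space, 'e::euclidean_space) manifold \<Rightarrow> ('m, 'e) conn \<Rightarrow> bool" where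
  "connection M D \<longleftrightarrow>
     (\<forall>U Y. open U \<and> smooth_vf M U Y \<longrightarrow>
        (\<forall>x\<in>U. linear (\<lambda>v. D x v Y)) \<and>
        (\<forall>x\<in>U. \<forall>v Z. smooth_vf M U Z \<longrightarrow> D x v (\<lambda>y. Y y + Z y) = D x v Y + D x v Z) \<and>
        (\<forall>x\<in>U. \<forall>v f. smooth_fun M U f \<longrightarrow>
           D x v (\<lambda>y. f y *\<^sub>R Y y) = dfun M f x v *\<^sub>R Y x + f x *\<^sub>R D x v Y) \<and>
        (\<forall>x\<in>U. \<forall>v Z. (\<forall>y\<in>U. Z y = Y y) \<longrightarrow> D x v Z = D x v Y) \<and>
        (\<forall>X. smooth_vf M U X \<longrightarrow> smooth_vf M U (\<lambda>x. D x (X x) Y)))"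

definition metric_conn ::
  "('m::topological_space, 'e::euclidean_space) manifold \<Rightarrow> ('m \<Rightarrow> 'e \<Rightarrow> 'e \<Rightarrow> real) \<Rightarrow>
   ('m, 'e) conn \<Rightarrow> bool" where
  "metric_conn M g D \<longleftrightarrow>
     (\<forall>U Y Z. open U \<and> smooth_vf M U Y \<and> smooth_vf M U Z \<longrightarrow>
        (\<forall>x\<in>U. \<forall>v. dfun M (\<lambda>y. g y (Y y) (Z y)) x v = g x (D x v Y) (Z x) + g x (Y x) (D x v Z)))"

definition torsion_tensor ::
  "('m::topological_space, 'e::euclidean_space) manifold \<Rightarrow> ('m, 'e) conn \<Rightarrow>
   ('m \<Rightarrow> 'e \<Rightarrow> 'e \<Rightarrow> 'e) \<Rightarrow> bool" where
  "torsion_tensor M D T \<longleftrightarrow>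
     (\<forall>U X Y. open U \<and> smooth_vf M U X \<and> smooth_vf M U Y \<longrightarrow>
        (\<forall>x\<in>U. T x (X x) (Y x) = D x (X x) Y - D x (Y x) X - lie_bracket M X Y x))"

definition levi_civita ::
  "('m::topological_space, 'e::euclidean_space) manifold \<Rightarrow> ('m \<Rightarrow> 'e \<Rightarrow> 'e \<Rightarrow> real) \<Rightarrow>
   ('m, 'e) conn \<Rightarrow> bool" where
  "levi_civita M g D \<longleftrightarrow>
     connection M D \<and> metric_conn M g D \<and> torsion_tensor M D (\<lambda>_ _ _. 0)"

definition parallel_vf ::
  "('m, 'e::euclidean_space) manifold \<Rightarrow> ('m, 'e) conn \<Rightarrow> ('m \<Rightarrow> 'e) \<Rightarrow> bool" where
  "parallel_vf M D X \<longleftrightarrow> smooth_vf M UNIV X \<and> (\<forall>x v. D x v X = 0)"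

definition parallel_form3 ::
  "('m::topological_space, 'e::euclidean_space) manifold \<Rightarrow> ('m, 'e) conn \<Rightarrow>
   ('m \<Rightarrow> 'e \<Rightarrow> 'e \<Rightarrow> 'e \<Rightarrow> real) \<Rightarrow> bool" where
  "parallel_form3 M D S \<longleftrightarrow> form3 M S \<and>
     (\<forall>U X Y Z. open U \<and> smooth_vf M U X \<and> smooth_vf M U Y \<and> smooth_vf M U Z \<longrightarrow>
        (\<forall>x\<in>U. \<forall>v. dfun M (\<lambda>y. S y (X y) (Y y) (Z y)) x v =
           S x (D x v X) (Y x) (Z x) + S x (X x) (D x v Y) (Z x) + S x (X x) (Y x) (D x v Z)))"

definition parallel_torsion ::
  "('m::topological_space, 'e::euclidean_space) manifold \<Rightarrow> ('m, 'e) conn \<Rightarrow> bool" where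
  "parallel_torsion M D \<longleftrightarrow> (\<exists>T. torsion_tensor M D T \<and>
     (\<forall>U X Y. open U \<and> smooth_vf M U X \<and> smooth_vf M U Y \<longrightarrow>
        (\<forall>x\<in>U. \<forall>v. D x v (\<lambda>y. T y (X y) (Y y)) =
           T x (D x v X) (Y x) + T x (X x) (D x v Y))))"

definition isotropic ::
  "('m \<Rightarrow> 'e::euclidean_space \<Rightarrow> 'e \<Rightarrow> real) \<Rightarrow> ('m \<Rightarrow> 'e) \<Rightarrow> bool" where
  "isotropic g X \<longleftrightarrow> (\<forall>x. X x \<noteq> 0 \<and> g x (X x) (X x) = 0)"

definition degenerate ::
  "('m \<Rightarrow> 'e::euclidean_space \<Rightarrow> 'e \<Rightarrow> real) \<Rightarrow> ('m \<Rightarrow> 'e \<Rightarrow> 'e \<Rightarrow> 'e \<Rightarrow> real) \<Rightarrow> bool" where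
  "degenerate g S \<longleftrightarrow> (\<forall>x. form3_norm_sq (g x) (S x) = 0)"

definition twistor_free_conn ::
  "('m \<Rightarrow> 'e::euclidean_space \<Rightarrow> 'e \<Rightarrow> real) \<Rightarrow> ('m, 'e) conn \<Rightarrow> ('m \<Rightarrow> 'e) \<Rightarrow>
   ('m \<Rightarrow> 'e \<Rightarrow> 'e \<Rightarrow> 'e \<Rightarrow> real) \<Rightarrow> ('m, 'e) conn" where
  "twistor_free_conn g D \<xi> S = (\<lambda>x v Y.
     D x v Y + bivector (g x) v (\<xi> x) (Y x) + (1/2) *\<^sub>R form3_op (g x) (S x) v (Y x))"

definition twistor_free_torsion ::
  "('m::topological_space, 'e::euclidean_space) manifold \<Rightarrow> ('m \<Rightarrow> 'e \<Rightarrow> 'e \<Rightarrow> real) \<Rightarrow>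
   ('m, 'e) conn \<Rightarrow> ('m \<Rightarrow> 'e) \<Rightarrow> ('m \<Rightarrow> 'e \<Rightarrow> 'e \<Rightarrow> 'e \<Rightarrow> real) \<Rightarrow> bool" where
  "twistor_free_torsion M g N \<xi> S \<longleftrightarrow>
     connection M N \<and> metric_conn M g N \<and> smooth_vf M UNIV \<xi> \<and> form3 M S \<and>
     (\<exists>D. levi_civita M g D \<and>
        (\<forall>U Y. open U \<and> smooth_vf M U Y \<longrightarrow>
           (\<forall>x\<in>U. \<forall>v. N x v Y = twistor_free_conn g D \<xi> S x v Y)))"

text \<open>
  The fibre of the screen bundle at a point is the set of classes of vectors orthogonal to \<open>p\<close>
  modulo multiples of \<open>p\<close>; here \<open>h\<close> and \<open>p\<close> are the values of the metric and of the isotropic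
  field at that point.
\<close>

definition perp :: "('e::euclidean_space \<Rightarrow> 'e \<Rightarrow> real) \<Rightarrow> 'e \<Rightarrow> 'e set" where
  "perp h p = {v. h p v = 0}"

definition screen_class :: "'e::real_vector \<Rightarrow> 'e \<Rightarrow> 'e set" where
  "screen_class p v = {v + t *\<^sub>R p | t. True}"

definition screen_alternating2 ::
  "('e::euclidean_space \<Rightarrow> 'e \<Rightarrow> real) \<Rightarrow> 'e \<Rightarrow> ('e set \<Rightarrow> 'e set \<Rightarrow> real) \<Rightarrow> bool" where
  "screen_alternating2 h p \<omega> \<longleftrightarrow>
     (\<forall>u\<in>perp h p. \<forall>v\<in>perp h p. \<forall>w\<in>perp h p. \<forall>a b.
        \<omega> (screen_class p (a *\<^sub>R u + b *\<^sub>R v)) (screen_class p w) =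
        a * \<omega> (screen_class p u) (screen_class p w) + b * \<omega> (screen_class p v) (screen_class p w)) \<and>
     (\<forall>u\<in>perp h p. \<forall>v\<in>perp h p.
        \<omega> (screen_class p u) (screen_class p v) = - \<omega> (screen_class p v) (screen_class p u))"

definition perp_vf ::
  "('m::topological_space, 'e::euclidean_space) manifold \<Rightarrow> ('m \<Rightarrow> 'e \<Rightarrow> 'e \<Rightarrow> real) \<Rightarrow>
   ('m \<Rightarrow> 'e) \<Rightarrow> 'm set \<Rightarrow> ('m \<Rightarrow> 'e) \<Rightarrow> bool" where
  "perp_vf M g p U Y \<longleftrightarrow> smooth_vf M U Y \<and> (\<forall>x\<in>U. Y x \<in> perp (g x) (p x))"

text \<open>
  Sections of the screen bundle are given by their lifts to \<open>p\<^sup>\<bottom>\<close>; the induced covariant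
  derivative of the section with lift \<open>Y\<close> is the class of \<open>D x v Y\<close>, which again lies in \<open>p\<^sup>\<bottom>\<close>
  when \<open>p\<close> is parallel.
\<close>

definition screen_form2 ::
  "('m::topological_space, 'e::euclidean_space) manifold \<Rightarrow> ('m \<Rightarrow> 'e \<Rightarrow> 'e \<Rightarrow> real) \<Rightarrow>
   ('m \<Rightarrow> 'e) \<Rightarrow> ('m \<Rightarrow> 'e set \<Rightarrow> 'e set \<Rightarrow> real) \<Rightarrow> bool" where
  "screen_form2 M g p \<omega> \<longleftrightarrow> (\<forall>x. screen_alternating2 (g x) (p x) (\<omega> x)) \<and>
     (\<forall>U Y Z. open U \<and> perp_vf M g p U Y \<and> perp_vf M g p U Z \<longrightarrow>
        smooth_fun M U (\<lambda>x. \<omega> x (screen_class (p x) (Y x)) (screen_class (p x) (Z x))))"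

definition parallel_screen_form2 ::
  "('m::topological_space, 'e::euclidean_space) manifold \<Rightarrow> ('m \<Rightarrow> 'e \<Rightarrow> 'e \<Rightarrow> real) \<Rightarrow>
   ('m, 'e) conn \<Rightarrow> ('m \<Rightarrow> 'e) \<Rightarrow> ('m \<Rightarrow> 'e set \<Rightarrow> 'e set \<Rightarrow> real) \<Rightarrow> bool" where
  "parallel_screen_form2 M g D p \<omega> \<longleftrightarrow> screen_form2 M g p \<omega> \<and>
     (\<forall>U Y Z. open U \<and> perp_vf M g p U Y \<and> perp_vf M g p U Z \<longrightarrow>
        (\<forall>x\<in>U. \<forall>v.
           dfun M (\<lambda>y. \<omega> y (screen_class (p y) (Y y)) (screen_class (p y) (Z y))) x v =
             \<omega> x (screen_class (p x) (D x v Y)) (screen_class (p x) (Z x)) +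
             \<omega> x (screen_class (p x) (Y x)) (screen_class (p x) (D x v Z))))"

text \<open>
  \<open>b\<close> is the 2-form identified by \<open>h\<close> with a lift to \<open>\<and>\<^sup>2 p\<^sup>\<bottom>\<close> of the bivector of \<open>\<omega>\<close>.
  A bivector lies in \<open>\<and>\<^sup>2 p\<^sup>\<bottom>\<close> iff its 2-form annihilates \<open>p\<close>, and it projects to the
  bivector of \<open>\<omega>\<close> iff its 2-form restricts on \<open>p\<^sup>\<bottom>\<close> to \<open>\<omega>\<close>.
\<close>

definition screen_lift ::
  "('e::euclidean_space \<Rightarrow> 'e \<Rightarrow> real) \<Rightarrow> 'e \<Rightarrow> ('e set \<Rightarrow> 'e set \<Rightarrow> real) \<Rightarrow>
   ('e \<Rightarrow> 'e \<Rightarrow> real) \<Rightarrow> bool" where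
  "screen_lift h p \<omega> b \<longleftrightarrow> alternating2 b \<and> (\<forall>v. b p v = 0) \<and>
     (\<forall>u\<in>perp h p. \<forall>v\<in>perp h p. b u v = \<omega> (screen_class p u) (screen_class p v))"

text \<open>\<open>\<tau> = p \<and> \<omega>\<close>; which lift is used is immaterial.\<close>

definition is_wedge_screen ::
  "('m \<Rightarrow> 'e::euclidean_space \<Rightarrow> 'e \<Rightarrow> real) \<Rightarrow> ('m \<Rightarrow> 'e) \<Rightarrow>
   ('m \<Rightarrow> 'e set \<Rightarrow> 'e set \<Rightarrow> real) \<Rightarrow> ('m \<Rightarrow> 'e \<Rightarrow> 'e \<Rightarrow> 'e \<Rightarrow> real) \<Rightarrow> bool" where
  "is_wedge_screen g p \<omega> \<tau> \<longleftrightarrow>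
     (\<forall>x. \<exists>b. screen_lift (g x) (p x) (\<omega> x) b \<and> \<tau> x = wedge12 (g x (p x)) b)"

definition construction_data ::
  "('m::{t2_space,second_countable_topology}, 'e::euclidean_space) manifold \<Rightarrow>
   ('m \<Rightarrow> 'e \<Rightarrow> 'e \<Rightarrow> real) \<Rightarrow> ('m, 'e) conn \<Rightarrow> ('m \<Rightarrow> 'e) \<Rightarrow>
   ('m \<Rightarrow> 'e set \<Rightarrow> 'e set \<Rightarrow> real) \<Rightarrow> ('m \<Rightarrow> 'e \<Rightarrow> 'e \<Rightarrow> 'e \<Rightarrow> real) \<Rightarrow> ('m \<Rightarrow> real) \<Rightarrow> bool" where
  "construction_data M g D p \<omega> \<tau> \<phi> \<longleftrightarrow>
     lorentzian_manifold M g \<and> levi_civita M g D \<and>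
     parallel_vf M D p \<and> isotropic g p \<and>
     parallel_screen_form2 M g D p \<omega> \<and> is_wedge_screen g p \<omega> \<tau> \<and> parallel_form3 M D \<tau> \<and>
     smooth_fun M UNIV \<phi> \<and> (\<forall>x v. g x (p x) v = dfun M (\<lambda>y. exp (\<phi> y)) x v)"

definition constructed_xi :: "('m \<Rightarrow> 'e::real_vector) \<Rightarrow> ('m \<Rightarrow> real) \<Rightarrow> 'm \<Rightarrow> 'e" where
  "constructed_xi p \<phi> = (\<lambda>x. exp (- \<phi> x) *\<^sub>R p x)"

definition constructed_S ::
  "('m \<Rightarrow> 'e \<Rightarrow> 'e \<Rightarrow> 'e \<Rightarrow> real) \<Rightarrow> ('m \<Rightarrow> real) \<Rightarrow> 'm \<Rightarrow> 'e \<Rightarrow> 'e \<Rightarrow> 'e \<Rightarrow> real" where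
  "constructed_S \<tau> \<phi> = (\<lambda>x u v w. exp (- \<phi> x) * \<tau> x u v w)"

definition constructed_conn ::
  "('m \<Rightarrow> 'e::euclidean_space \<Rightarrow> 'e \<Rightarrow> real) \<Rightarrow> ('m, 'e) conn \<Rightarrow> ('m \<Rightarrow> 'e) \<Rightarrow>
   ('m \<Rightarrow> 'e \<Rightarrow> 'e \<Rightarrow> 'e \<Rightarrow> real) \<Rightarrow> ('m \<Rightarrow> real) \<Rightarrow> ('m, 'e) conn" where
  "constructed_conn g D p \<tau> \<phi> =
     twistor_free_conn g D (constructed_xi p \<phi>) (constructed_S \<tau> \<phi>)"

definition isometry ::
  "('m::topological_space, 'e::euclidean_space) manifold \<Rightarrow> ('m \<Rightarrow> 'e \<Rightarrow> 'e \<Rightarrow> real) \<Rightarrow>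
   ('n::topological_space, 'e) manifold \<Rightarrow> ('n \<Rightarrow> 'e \<Rightarrow> 'e \<Rightarrow> real) \<Rightarrow> ('m \<Rightarrow> 'n) \<Rightarrow> bool" where
  "isometry M g M' g' F \<longleftrightarrow> diffeomorphism M M' F \<and>
     (\<forall>x u v. g' (F x) (dmap M M' F x u) (dmap M M' F x v) = g x u v)"

definition identifies_conns ::
  "('m::topological_space, 'e::euclidean_space) manifold \<Rightarrow> ('m, 'e) conn \<Rightarrow>
   ('n::topological_space, 'e) manifold \<Rightarrow> ('n, 'e) conn \<Rightarrow> ('m \<Rightarrow> 'n) \<Rightarrow> bool" where
  "identifies_conns M N M' N' F \<longleftrightarrow>
     (\<forall>U Y. open U \<and> smooth_vf M U Y \<longrightarrow>
        (\<forall>x\<in>U. \<forall>v. dmap M M' F x (N x v Y) = N' (F x) (dmap M M' F x v) (push_vf M M' F Y)))"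

end

theory Submission
  imports Defs
begin

text \<open>
  The torsion is the tensor \<open>T\<close> with
  \<open>g(T(X,Y),Z) = \<xi>(X) g(Y,Z) - \<xi>(Y) g(X,Z) + S(X,Y,Z)\<close>. Its covariant derivative has
  the same shape with \<open>\<nabla>\<xi>\<close>, \<open>\<nabla>S\<close> in place of \<open>\<xi>\<close>, \<open>S\<close>, and \<open>Z = Y\<close> eliminates \<open>\<nabla>S\<close>; so
  \<open>\<nabla>T = 0\<close> iff \<open>\<nabla>\<xi> = 0\<close> and \<open>\<nabla>S = 0\<close>. If \<open>S = \<xi> \<and> b\<close> with \<open>\<xi>\<close> isotropic and
  \<open>b(\<xi>,\<cdot>) = 0\<close>, then \<open>\<nabla>\<^sup>g\<close> and \<open>\<nabla>\<close> differ on \<open>\<xi>\<close> and on \<open>S\<close> by the factor \<open>\<xi>(X)\<close> only, and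
  rescaling by \<open>exp \<phi>\<close> with \<open>d\<phi> = \<xi>\<close> exchanges parallelism for \<open>\<nabla>\<close> and for \<open>\<nabla>\<^sup>g\<close>.

  For the converse one needs \<open>S = \<xi> \<and> b\<close>. The curvature \<open>R\<close> of \<open>\<nabla>\<close> annihilates \<open>\<xi>\<close> and \<open>S\<close>, and
  the first Bianchi identity expresses \<open>R(X,Y,Z,W) - R(Z,W,X,Y)\<close> through \<open>\<xi>\<close> and \<open>S\<close>. With \<open>Z = \<xi>\<close>
  this determines \<open>R(\<xi>,W)\<close>, and \<open>R(\<xi>,W)\<close> annihilating the 2-form \<open>\<alpha> = S(\<xi>,\<cdot>,\<cdot>)\<close> forces
  \<open>\<alpha> = \<xi> \<and> a\<close> with \<open>a\<close> orthogonal to \<open>\<xi>\<close>. If \<open>a\<close> is non-zero, \<open>R(Y,a)\<close> is determined in the same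
  way and its action on \<open>S\<close> gives \<open>g(a,a) g(Y,Y) = g(a,Y)\<^sup>2\<close> for all \<open>Y\<close> orthogonal to \<open>\<xi>\<close>, so the
  dimension is 3 and \<open>S\<close> is a multiple of the volume form, which is not degenerate. Hence
  \<open>\<alpha> = 0\<close>; then the square of the norm of \<open>S\<close> is that of its restriction to the positive definite screen
  space, so degeneracy means \<open>S = \<xi> \<and> b\<close>. Finally \<open>\<xi>\<close> is closed, and \<open>\<phi>\<close> exists because the
  manifold is simply connected.
\<close>

section \<open>Lorentzian linear algebra\<close>

text \<open>The pair-symmetry defect is computable because the torsion is parallel: the first
  Bianchi identity then has no derivative term, its right side is quadratic in the torsion, and the
  part quadratic in \<open>S\<close> is a 4-form, which drops out. With \<xi> in one slot, one of
  the two curvature terms vanishes since the curvature annihilates \<xi>; the other becomes an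
  explicit expression in \<xi> and \<open>S\<close>, and its action on \<open>S\<close> is an
  algebraic equation. The norm being indefinite, degeneracy alone does not give the wedge form; the
  curvature has to restrict \<alpha> first. Only curvature values at single points enter, so the
  locale \<open>torsion_algebra\<close> keeps just the identities between them. Tangent vectors at
  different points are written in unrelated charts; smoothness is therefore tested against smooth
  fields, and a vector at a point is extended by a coordinate field of the preferred chart there.
  The screen form is read off with a dual vector chosen separately at each point. In the converse
  the manifold obtained is the given one, with the identity as isometry.\<close>

lemma alternating3_add:
  assumes "alternating3 s"
  shows "s (u + u') v w = s u v w + s u' v w" "s u (v + v') w = s u v w + s u v' w"
    "s u v (w + w') = s u v w + s u v w'"
proof -
  have l: "s (u + u') v w = s u v w + s u' v w" for u u' v w
    by (fact linear_add[OF assms[unfolded alternating3_def, THEN conjunct1, rule_format]])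
  have a: "s u v w = - s v u w" "s u v w = - s u w v" for u v w
    by (fact assms[unfolded alternating3_def, THEN conjunct2, THEN conjunct1, rule_format]
      assms[unfolded alternating3_def, THEN conjunct2, THEN conjunct2, rule_format])+
  have m: "s u (v + v') w = s u v w + s u v' w" for u v v' w
    using a(1)[of u "v + v'" w] l[of v v' u w] a(1)[of u v w] a(1)[of u v' w] by linarith
  show "s (u + u') v w = s u v w + s u' v w" "s u (v + v') w = s u v w + s u v' w" by (fact l m)+
  show "s u v (w + w') = s u v w + s u v w'"
    using a(2)[of u v "w + w'"] m[of u w w' v] a(2)[of u v w] a(2)[of u v w'] by linarith
qed

lemma alternating3_scale:
  assumes "alternating3 s"
  shows "s (c *\<^sub>R u) v w = c * s u v w" "s u (c *\<^sub>R v) w = c * s u v w"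
    "s u v (c *\<^sub>R w) = c * s u v w"
proof -
  have l: "s (c *\<^sub>R u) v w = c * s u v w" for u v w
    using linear_scale[OF assms[unfolded alternating3_def, THEN conjunct1, rule_format], of c u v w] by simp
  have a: "s u v w = - s v u w" "s u v w = - s u w v" for u v w
    by (fact assms[unfolded alternating3_def, THEN conjunct2, THEN conjunct1, rule_format]
      assms[unfolded alternating3_def, THEN conjunct2, THEN conjunct2, rule_format])+
  have m: "s u (c *\<^sub>R v) w = c * s u v w" for u v w
    using a(1)[of u "c *\<^sub>R v" w] l[of v u w] a(1)[of u v w] by simp
  show "s (c *\<^sub>R u) v w = c * s u v w" "s u (c *\<^sub>R v) w = c * s u v w" by (fact l m)+
  show "s u v (c *\<^sub>R w) = c * s u v w"
    using a(2)[of u v "c *\<^sub>R w"] m[of u w v] a(2)[of u v w] by simp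
qed

lemma alternating3_minus:
  assumes "alternating3 s"
  shows "s (- u) v w = - s u v w" "s u (- v) w = - s u v w" "s u v (- w) = - s u v w"
  using alternating3_scale(1)[OF assms, where c="-1"] alternating3_scale(2)[OF assms, where c="-1"]
    alternating3_scale(3)[OF assms, where c="-1"] by simp_all

lemma alternating3_diff:
  assumes "alternating3 s"
  shows "s (u - u') v w = s u v w - s u' v w" "s u (v - v') w = s u v w - s u v' w"
    "s u v (w - w') = s u v w - s u v w'"
  using alternating3_add(1)[OF assms, of u "- u'"] alternating3_add(2)[OF assms, of u v "- v'"]
    alternating3_add(3)[OF assms, of u v w "- w'"] alternating3_minus[OF assms] by simp_all

lemma alternating3_zero:
  assumes "alternating3 s"
  shows "s 0 v w = 0" "s u 0 w = 0" "s u v 0 = 0"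
  using alternating3_scale(1)[OF assms, where c=0] alternating3_scale(2)[OF assms, where c=0]
    alternating3_scale(3)[OF assms, where c=0] by simp_all

lemma alternating3_skew:
  assumes "alternating3 s"
  shows "s u v w = - s v u w" "s u v w = - s u w v" "s u v w = - s w v u"
    "s u v w = s v w u" "s u v w = s w u v"
proof -
  have a: "s u v w = - s v u w" "s u v w = - s u w v" for u v w
    by (fact assms[unfolded alternating3_def, THEN conjunct2, THEN conjunct1, rule_format]
      assms[unfolded alternating3_def, THEN conjunct2, THEN conjunct2, rule_format])+
  show "s u v w = - s v u w" "s u v w = - s u w v" by (fact a)+
  show "s u v w = - s w v u" "s u v w = s v w u" "s u v w = s w u v"
    using a(1)[of u v w] a(2)[of u v w] a(1)[of u w v] a(2)[of v u w] a(1)[of v w u]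
      a(2)[of w u v] a(1)[of w u v] by linarith+
qed

lemma alternating3_same:
  assumes "alternating3 s"
  shows "s u u w = 0" "s u v v = 0" "s u v u = 0"
  using alternating3_skew(1)[OF assms, of u u w] alternating3_skew(2)[OF assms, of u v v]
    alternating3_skew(3)[OF assms, of u v u] by linarith+

lemmas alternating3_simps = alternating3_add alternating3_scale alternating3_minus
  alternating3_diff alternating3_zero alternating3_same

lemma alternating3_sum:
  assumes "alternating3 s"
  shows "s (\<Sum>i\<in>A. f i) v w = (\<Sum>i\<in>A. s (f i) v w)" "s u (\<Sum>i\<in>A. f i) w = (\<Sum>i\<in>A. s u (f i) w)"
    "s u v (\<Sum>i\<in>A. f i) = (\<Sum>i\<in>A. s u v (f i))"
  by (induction A rule: infinite_finite_induct; simp add: alternating3_simps[OF assms])+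

section \<open>Lorentzian scalar products: frames, null vectors, the norm of a 3-form\<close>

locale lorentz_space =
  fixes h :: "'e::euclidean_space \<Rightarrow> 'e \<Rightarrow> real"
  assumes lorentz: "lorentz_form h"
begin

lemma h_bilinear: "bilinear h" using lorentz unfolding lorentz_form_def by blast
lemma h_sym: "h u v = h v u" using lorentz unfolding lorentz_form_def by blast

lemmas h_simps [simp] = bilinear_ladd[OF h_bilinear] bilinear_radd[OF h_bilinear]
  bilinear_lmul[OF h_bilinear] bilinear_rmul[OF h_bilinear]
  bilinear_lneg[OF h_bilinear] bilinear_rneg[OF h_bilinear]
  bilinear_lsub[OF h_bilinear] bilinear_rsub[OF h_bilinear]
  bilinear_lzero[OF h_bilinear] bilinear_rzero[OF h_bilinear]

lemma h_sum_left: "h (\<Sum>i\<in>A. f i) v = (\<Sum>i\<in>A. h (f i) v)"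
  by (induction A rule: infinite_finite_induct) simp_all

text \<open>The products with the frame recover the coefficients, so the linear map from
  coefficients to combinations of the frame is injective; source and target have the same dimension,
  hence it is onto.\<close>

lemma frame_expansion:
  assumes e: "lorentz_frame h e"
  shows "v = (\<Sum>i<DIM('e). ((if i = 0 then -1 else 1) * h v (e i)) *\<^sub>R e i)"
proof -
  obtain b :: "nat \<Rightarrow> 'e" where b: "bij_betw b {..<DIM('e)} Basis"
    using ex_bij_betw_nat_finite[of "Basis :: 'e set"] by (auto simp: atLeast0LessThan)
  define f where "f x = (\<Sum>i<DIM('e). (x \<bullet> b i) *\<^sub>R e i)" for x
  have lf: "linear f" unfolding f_def
    by (rule linearI) (simp_all add: inner_left_distrib scaleR_left_distrib sum.distrib scaleR_sum_right)
  have hf: "h (f x) (e j) = (if j = 0 then -1 else 1) * (x \<bullet> b j)" if "j < DIM('e)" for x j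
  proof -
    have "h (f x) (e j) = (\<Sum>i<DIM('e). (x \<bullet> b i) * h (e i) (e j))"
      by (simp add: f_def h_sum_left)
    also have "\<dots> = (\<Sum>i<DIM('e). if i = j then (x \<bullet> b j) * (if j = 0 then -1 else 1) else 0)"
      using e that unfolding lorentz_frame_def by (intro sum.cong) auto
    finally show ?thesis using that by simp
  qed
  have "inj f"
  proof (rule linear_injective_0[THEN iffD2, OF lf, rule_format])
    fix x assume "f x = 0"
    then have *: "x \<bullet> b j = 0" if "j < DIM('e)" for j using hf[OF that, of x] by (simp split: if_splits)
    then have "x \<bullet> c = 0" if "c \<in> Basis" for c
    proof -
      have "c \<in> b ` {..<DIM('e)}" using b that by (simp add: bij_betw_def)
      then obtain j where "c = b j" "j < DIM('e)" by blast
      then show ?thesis using * by blast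
    qed
    then show "x = 0" using euclidean_all_zero_iff by blast
  qed
  then have "surj f" by (rule linear_injective_imp_surjective[OF lf _ refl])
  then obtain x where x: "v = f x" by (metis surj_def)
  have "((if i = 0 then -1 else 1) * h (f x) (e i)) *\<^sub>R e i = (x \<bullet> b i) *\<^sub>R e i" if "i < DIM('e)" for i
    by (simp add: hf[OF that])
  then have "(\<Sum>i<DIM('e). ((if i = 0 then -1 else 1) * h (f x) (e i)) *\<^sub>R e i) = f x"
    using sum.cong[OF refl, of "{..<DIM('e)}" "\<lambda>i. ((if i = 0 then -1 else 1) * h (f x) (e i)) *\<^sub>R e i"
      "\<lambda>i. (x \<bullet> b i) *\<^sub>R e i"] by (simp only: f_def[symmetric] lessThan_iff)
  then show ?thesis unfolding x by (rule sym)
qed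

lemma h_frame:
  assumes "lorentz_frame h e"
  shows "h u v = - h u (e 0) * h v (e 0) + (\<Sum>i=1..<DIM('e). h u (e i) * h v (e i))"
proof -
  have "h u v = (\<Sum>i<DIM('e). (if i = 0 then -1 else 1) * h u (e i) * h v (e i))"
    by (subst frame_expansion[OF assms, of u])
      (auto simp: h_sum_left h_sym[of v] intro!: sum.cong)
  also have "\<dots> = - h u (e 0) * h v (e 0) + (\<Sum>i=1..<DIM('e). h u (e i) * h v (e i))"
    unfolding lessThan_atLeast0 by (subst sum.atLeast_Suc_lessThan) (auto intro!: sum.cong)
  finally show ?thesis .
qed

lemma frame_eqI:
  assumes "lorentz_frame h e" "\<And>i. i < DIM('e) \<Longrightarrow> h u (e i) = 0"
  shows "u = 0"
  by (subst frame_expansion[OF assms(1), of u]) (simp add: assms(2))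

lemma nondegenerate:
  assumes "\<And>w. h u w = 0" shows "u = 0"
proof -
  obtain e where "lorentz_frame h e" using lorentz unfolding lorentz_form_def by blast
  then show ?thesis using frame_eqI assms by blast
qed

lemma h_eqI: assumes "\<And>w. h u w = h v w" shows "u = v"
  using nondegenerate[of "u - v"] assms by simp

lemma ex_representing:
  assumes "linear l" shows "\<exists>z. \<forall>w. h z w = l w"
proof -
  define f where "f z = (\<Sum>b\<in>Basis. h z b *\<^sub>R b)" for z :: 'e
  have lf: "linear f" unfolding f_def
    by (rule linearI) (simp_all add: scaleR_left_distrib sum.distrib scaleR_sum_right)
  have fb: "f z \<bullet> b = h z b" if "b \<in> Basis" for z b
    using that by (simp add: f_def inner_sum_left inner_Basis if_distrib sum.delta cong: if_cong)
  have hl: "linear (h z)" for z using h_bilinear unfolding bilinear_def by blast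
  have "inj f"
  proof (rule linear_injective_0[THEN iffD2, OF lf, rule_format])
    fix z assume "f z = 0"
    then have "h z b = 0" if "b \<in> Basis" for b using fb[OF that, of z] by simp
    then have "h z w = 0" for w
      using linear_eq_stdbasis[OF hl[of z] linear_zero] by (simp add: fun_eq_iff)
    then show "z = 0" by (rule nondegenerate)
  qed
  then have "surj f" by (rule linear_injective_imp_surjective[OF lf _ refl])
  then obtain z where z: "(\<Sum>b\<in>Basis. l b *\<^sub>R b) = f z" by (metis surj_def)
  have "h z b = l b" if "b \<in> Basis" for b
    using fb[OF that, of z] that unfolding z[symmetric]
    by (simp add: inner_sum_left inner_Basis if_distrib sum.delta cong: if_cong)
  then have "h z = l" using linear_eq_stdbasis[OF hl assms] by blast
  then show ?thesis by blast
qed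

lemma form3_op:
  assumes "alternating3 s" shows "h (form3_op h s u v) w = s u v w"
proof -
  have "linear (s u v)"
    by (rule linearI) (simp_all add: alternating3_simps[OF assms])
  then obtain z where z: "\<And>w. h z w = s u v w" using ex_representing by blast
  have "form3_op h s u v = z" unfolding form3_op_def
    by (rule the_equality) (auto simp: z intro: h_eqI)
  then show ?thesis using z by simp
qed

text \<open>The form is positive definite on the orthogonal complement of the timelike vector
  \<open>e 0\<close>, which therefore contains no non-zero null vector.\<close>

lemma frame_zero_neq_0:
  assumes "lorentz_frame h e" "h p p = 0" "p \<noteq> 0" shows "h p (e 0) \<noteq> 0"
proof
  assume p0: "h p (e 0) = 0"
  then have "(\<Sum>i=1..<DIM('e). h p (e i) * h p (e i)) = 0"
    using h_frame[OF assms(1), of p p] assms(2) by simp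
  then have "\<forall>i\<in>{1..<DIM('e)}. h p (e i) * h p (e i) = 0"
    by (subst (asm) sum_nonneg_eq_0_iff) auto
  then have "h p (e i) = 0" if "i < DIM('e)" for i
    using that p0 by (cases "i = 0") auto
  then have "p = 0" by (rule frame_eqI[OF assms(1)])
  then show False using assms by simp
qed

lemma null_perp:
  assumes "h p p = 0" "p \<noteq> 0" "h p v = 0"
  shows "h v v \<ge> 0" "h v v = 0 \<Longrightarrow> \<exists>t. v = t *\<^sub>R p"
proof -
  obtain e where e: "lorentz_frame h e" using lorentz unfolding lorentz_form_def by blast
  have p0: "h p (e 0) \<noteq> 0" using frame_zero_neq_0[OF e assms(1,2)] .
  \<comment> \<open>This multiple of \<open>p\<close> removes the timelike component of
    \<open>v\<close>. Since \<open>p\<close> is null and orthogonal to \<open>v\<close>, the square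
    of \<open>v\<close> is unchanged and becomes a sum of squares.\<close>
  define t where "t = h v (e 0) / h p (e 0)"
  define w where "w = v - t *\<^sub>R p"
  have w0: "h w (e 0) = 0" using p0 by (simp add: w_def t_def)
  have vw: "h v v = h w w" using assms by (simp add: w_def h_sym[of v p])
  have ww: "h w w = (\<Sum>i=1..<DIM('e). h w (e i) * h w (e i))" using h_frame[OF e, of w w] w0 by simp
  show "h v v \<ge> 0" unfolding vw ww by (intro sum_nonneg) simp
  show "\<exists>t. v = t *\<^sub>R p" if "h v v = 0"
  proof -
    have "(\<Sum>i=1..<DIM('e). h w (e i) * h w (e i)) = 0" using that vw ww by simp
    then have "\<forall>i\<in>{1..<DIM('e)}. h w (e i) * h w (e i) = 0"
      by (subst (asm) sum_nonneg_eq_0_iff) auto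
    then have "h w (e i) = 0" if "i < DIM('e)" for i
      using that w0 by (cases "i = 0") auto
    then have "w = 0" by (rule frame_eqI[OF e])
    then show ?thesis unfolding w_def by auto
  qed
qed

lemma ex_dual_vector:
  assumes "p \<noteq> 0" shows "\<exists>q. h p q = 1"
proof -
  obtain w where "h p w \<noteq> 0" using nondegenerate[of p] assms by blast
  then have "h p ((1 / h p w) *\<^sub>R w) = 1" by simp
  then show ?thesis by blast
qed

text \<open>Components with a repeated timelike index vanish by alternation. Those with exactly one
  timelike index occur in three positions with equal squares and sign -1, which is the origin of the
  factor 3.\<close>

lemma form3_norm_sq_frame:
  assumes s: "alternating3 s"
  obtains e where "lorentz_frame h e"
    "form3_norm_sq h s = (\<Sum>i=1..<DIM('e). \<Sum>j=1..<DIM('e). \<Sum>k=1..<DIM('e). (s (e i) (e j) (e k))\<^sup>2)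
       - 3 * (\<Sum>j=1..<DIM('e). \<Sum>k=1..<DIM('e). (s (e 0) (e j) (e k))\<^sup>2)"
proof -
  define e where "e = (SOME e. lorentz_frame h e)"
  have e: "lorentz_frame h e"
    unfolding e_def using lorentz someI_ex[of "lorentz_frame h"] unfolding lorentz_form_def by blast
  define I where "I = {1..<DIM('e)}"
  have nz: "i \<in> I \<Longrightarrow> (i = 0) = False" for i by (simp add: I_def)
  have hh: "h (e i) (e i) = (if i = 0 then -1 else 1)" if "i < DIM('e)" for i
    using e that unfolding lorentz_frame_def by simp
  have split: "(\<Sum>i<DIM('e). f i) = f 0 + (\<Sum>i\<in>I. f i)" for f :: "nat \<Rightarrow> real"
    unfolding lessThan_atLeast0 I_def by (subst sum.atLeast_Suc_lessThan) auto
  let ?f = "\<lambda>i j k. (s (e i) (e j) (e k))\<^sup>2"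
  have sq: "i \<in> I \<Longrightarrow> ?f i 0 k = ?f 0 i k" "i \<in> I \<Longrightarrow> ?f i j 0 = ?f 0 i j" "?f 0 0 k = 0" "?f 0 j 0 = 0" for i j k
    using alternating3_skew(1)[OF s, of "e i" "e 0" "e k"] alternating3_skew(5)[OF s, of "e i" "e j" "e 0"]
    by (simp_all add: alternating3_same[OF s])
  have "form3_norm_sq h s = (\<Sum>i<DIM('e). \<Sum>j<DIM('e). \<Sum>k<DIM('e).
          h (e i) (e i) * h (e j) (e j) * h (e k) (e k) * ?f i j k)"
    unfolding form3_norm_sq_def e_def Let_def by simp
  also have "\<dots> = (\<Sum>i<DIM('e). \<Sum>j<DIM('e). \<Sum>k<DIM('e).
          (if i = 0 then -1 else 1) * (if j = 0 then -1 else 1) * (if k = 0 then -1 else 1) * ?f i j k)"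
    by (intro sum.cong refl) (simp only: hh lessThan_iff)
  also have "\<dots> = (\<Sum>i\<in>I. \<Sum>j\<in>I. \<Sum>k\<in>I. ?f i j k) - 3 * (\<Sum>j\<in>I. \<Sum>k\<in>I. ?f 0 j k)"
    by (simp add: split sq nz sum.distrib sum_negf sum_subtractf cong: sum.cong)
  finally show ?thesis using e that unfolding I_def by blast
qed

text \<open>The projections \<open>f i\<close> of the spacelike frame vectors along
  \<open>e 0\<close> span the complement of \<open>p\<close>. Since \<open>p\<close> annihilates
  \<open>s\<close>, the sum of squares of the components of \<open>s\<close> in the
  \<open>f i\<close> equals the indefinite norm, although the \<open>f i\<close> are not
  orthonormal.\<close>

lemma vanishes_on_perp:
  assumes s: "alternating3 s" and norm: "form3_norm_sq h s = 0"
    and p: "h p p = 0" "p \<noteq> 0" and sp: "\<And>v w. s p v w = 0"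
    and uvw: "h p u = 0" "h p v = 0" "h p w = 0"
  shows "s u v w = 0"
proof -
  define I where "I = {1..<DIM('e)}"
  let ?sum = "\<lambda>f :: nat \<Rightarrow> nat \<Rightarrow> nat \<Rightarrow> real. \<Sum>i\<in>I. \<Sum>j\<in>I. \<Sum>k\<in>I. f i j k"
  obtain e where e: "lorentz_frame h e"
    and n: "form3_norm_sq h s = ?sum (\<lambda>i j k. (s (e i) (e j) (e k))\<^sup>2)
       - 3 * (\<Sum>j\<in>I. \<Sum>k\<in>I. (s (e 0) (e j) (e k))\<^sup>2)"
    using form3_norm_sq_frame[OF s] unfolding I_def by blast
  have p0: "h p (e 0) \<noteq> 0" using frame_zero_neq_0[OF e p] .
  have s_frame: "x = (\<Sum>i\<in>I. h x (e i) *\<^sub>R e i) - h x (e 0) *\<^sub>R e 0" for x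
    using frame_expansion[OF e, of x] unfolding lessThan_atLeast0 I_def
    by (subst (asm) sum.atLeast_Suc_lessThan) (auto cong: sum.cong_simp)
  define c where "c i = h p (e i) / h p (e 0)" for i
  define f where "f i = e i - c i *\<^sub>R e 0" for i
  define b where "b j k = s (e 0) (e j) (e k)" for j k
  let ?s = "\<lambda>i j k. s (e i) (e j) (e k)" and ?k = "\<lambda>i j k. s (f i) (f j) (f k)"
  have expand: "x = (\<Sum>i\<in>I. h x (e i) *\<^sub>R f i)" if "h p x = 0" for x
  proof -
    have "h p (e 0) * h x (e 0) = (\<Sum>i\<in>I. h p (e i) * h x (e i))"
      using h_frame[OF e, of p x] that by (simp add: I_def)
    then have "h x (e 0) = (\<Sum>i\<in>I. h p (e i) * h x (e i)) / h p (e 0)"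
      using p0 by (simp add: field_simps)
    then have "h x (e 0) = (\<Sum>i\<in>I. h x (e i) * c i)"
      by (simp add: c_def sum_divide_distrib mult.commute)
    then show ?thesis
      by (subst s_frame) (simp add: f_def scaleR_diff_right sum_subtractf scaleR_sum_left)
  qed
  \<comment> \<open>The coefficients \<open>c\<close> are those of a multiple of \<open>p\<close>.
    Contracting a slot of \<open>s\<close> with them therefore gives zero against \<open>f\<close>
    and the component along \<open>e 0\<close> against \<open>e\<close>.\<close>
  have cf: "(\<Sum>i\<in>I. c i *\<^sub>R f i) = (1 / h p (e 0)) *\<^sub>R p"
    by (subst (2) expand[OF p(1)]) (simp add: scaleR_sum_right c_def)
  have ce: "(\<Sum>i\<in>I. c i *\<^sub>R e i) = (1 / h p (e 0)) *\<^sub>R p + e 0"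
    using p0 by (subst (2) s_frame[of p]) (simp add: scaleR_sum_right c_def scaleR_diff_right)
  have k1: "(\<Sum>i\<in>I. c i * s (f i) x y) = 0" for x y
    using arg_cong[OF cf, of "\<lambda>v. s v x y"] sp by (simp add: alternating3_sum[OF s] alternating3_scale[OF s])
  have k2: "(\<Sum>i\<in>I. c i * s x (f i) y) = 0" "(\<Sum>i\<in>I. c i * s x y (f i)) = 0" for x y
    using k1[of x y] k1[of x y] alternating3_skew(1)[OF s, of x _ y] alternating3_skew(5)[OF s, of x y]
    by (simp_all add: sum_negf)
  have b1: "(\<Sum>i\<in>I. c i * s (e i) x y) = s (e 0) x y" for x y
    using arg_cong[OF ce, of "\<lambda>v. s v x y"] sp
    by (simp add: alternating3_sum[OF s] alternating3_scale[OF s] alternating3_add[OF s])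
  have b2: "(\<Sum>i\<in>I. c i * s x (e i) y) = s x (e 0) y" "(\<Sum>i\<in>I. c i * s x y (e i)) = s x y (e 0)" for x y
    using b1[of x y] alternating3_skew(1)[OF s, of x _ y] alternating3_skew(5)[OF s, of x y]
    by (simp_all add: sum_negf)
  have kexp: "?k i j k = ?s i j k - c i * b j k - c j * s (e i) (e 0) (e k) - c k * s (e i) (e j) (e 0)" for i j k
    unfolding f_def b_def by (simp add: alternating3_simps[OF s] alternating3_skew(1)[OF s, of "e i" "e 0" "e 0"])
  \<comment> \<open>Only one of the two factors \<open>?k\<close> is expanded; the other one still
    kills every contraction with \<open>c\<close>.\<close>
  have "?sum (\<lambda>i j k. (?k i j k)\<^sup>2) = ?sum (\<lambda>i j k. ?k i j k * ?s i j k)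
     - ?sum (\<lambda>i j k. c i * ?k i j k * b j k)
     - ?sum (\<lambda>i j k. c j * ?k i j k * s (e i) (e 0) (e k))
     - ?sum (\<lambda>i j k. c k * ?k i j k * s (e i) (e j) (e 0))"
    unfolding sum_subtractf[symmetric]
    by (intro sum.cong refl) (simp add: power2_eq_square, subst (2) kexp, simp add: algebra_simps)
  also have "?sum (\<lambda>i j k. c i * ?k i j k * b j k) = 0"
  proof -
    have "?sum (\<lambda>i j k. c i * ?k i j k * b j k)
        = (\<Sum>j\<in>I. \<Sum>k\<in>I. (\<Sum>i\<in>I. c i * ?k i j k) * b j k)"
      unfolding sum_distrib_right by (subst sum.swap, rule sum.cong[OF refl], rule sum.swap)
    then show ?thesis by (simp add: k1)
  qed
  also have "?sum (\<lambda>i j k. c j * ?k i j k * s (e i) (e 0) (e k)) = 0"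
  proof -
    have "?sum (\<lambda>i j k. c j * ?k i j k * s (e i) (e 0) (e k))
        = (\<Sum>i\<in>I. \<Sum>k\<in>I. (\<Sum>j\<in>I. c j * ?k i j k) * s (e i) (e 0) (e k))"
      unfolding sum_distrib_right by (rule sum.cong[OF refl], rule sum.swap)
    then show ?thesis by (simp add: k2)
  qed
  also have "?sum (\<lambda>i j k. c k * ?k i j k * s (e i) (e j) (e 0)) = 0"
  proof -
    have "?sum (\<lambda>i j k. c k * ?k i j k * s (e i) (e j) (e 0))
        = (\<Sum>i\<in>I. \<Sum>j\<in>I. (\<Sum>k\<in>I. c k * ?k i j k) * s (e i) (e j) (e 0))"
      unfolding sum_distrib_right by simp
    then show ?thesis by (simp add: k2)
  qed
  \<comment> \<open>Expanding the remaining factor produces three equal sums of squares of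
    \<open>b\<close>, matching the term with factor 3 in the norm.\<close>
  also have "?sum (\<lambda>i j k. ?k i j k * ?s i j k) =
     ?sum (\<lambda>i j k. (?s i j k)\<^sup>2) - ?sum (\<lambda>i j k. c i * ?s i j k * b j k)
     - ?sum (\<lambda>i j k. c j * ?s i j k * s (e i) (e 0) (e k))
     - ?sum (\<lambda>i j k. c k * ?s i j k * s (e i) (e j) (e 0))"
    unfolding sum_subtractf[symmetric]
    by (intro sum.cong refl) (simp add: power2_eq_square, subst kexp, simp add: algebra_simps)
  also have "?sum (\<lambda>i j k. c i * ?s i j k * b j k) = (\<Sum>j\<in>I. \<Sum>k\<in>I. (b j k)\<^sup>2)"
  proof -
    have "?sum (\<lambda>i j k. c i * ?s i j k * b j k)
        = (\<Sum>j\<in>I. \<Sum>k\<in>I. (\<Sum>i\<in>I. c i * ?s i j k) * b j k)"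
      unfolding sum_distrib_right by (subst sum.swap, rule sum.cong[OF refl], rule sum.swap)
    then show ?thesis by (simp add: b1 b_def power2_eq_square)
  qed
  also have "?sum (\<lambda>i j k. c j * ?s i j k * s (e i) (e 0) (e k)) = (\<Sum>j\<in>I. \<Sum>k\<in>I. (b j k)\<^sup>2)"
  proof -
    have "?sum (\<lambda>i j k. c j * ?s i j k * s (e i) (e 0) (e k))
        = (\<Sum>i\<in>I. \<Sum>k\<in>I. (\<Sum>j\<in>I. c j * ?s i j k) * s (e i) (e 0) (e k))"
      unfolding sum_distrib_right by (rule sum.cong[OF refl], rule sum.swap)
    also have "\<dots> = (\<Sum>i\<in>I. \<Sum>k\<in>I. (b i k)\<^sup>2)"
      unfolding b2 by (intro sum.cong refl) (subst (1 2) alternating3_skew(1)[OF s], simp add: b_def power2_eq_square)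
    finally show ?thesis .
  qed
  also have "?sum (\<lambda>i j k. c k * ?s i j k * s (e i) (e j) (e 0)) = (\<Sum>j\<in>I. \<Sum>k\<in>I. (b j k)\<^sup>2)"
  proof -
    have "?sum (\<lambda>i j k. c k * ?s i j k * s (e i) (e j) (e 0))
        = (\<Sum>i\<in>I. \<Sum>j\<in>I. (\<Sum>k\<in>I. c k * ?s i j k) * s (e i) (e j) (e 0))"
      unfolding sum_distrib_right by simp
    also have "\<dots> = (\<Sum>i\<in>I. \<Sum>k\<in>I. (b i k)\<^sup>2)"
      unfolding b2 by (intro sum.cong refl) (subst (1 2) alternating3_skew(5)[OF s], simp add: b_def power2_eq_square)
    finally show ?thesis .
  qed
  finally have sum0: "?sum (\<lambda>i j k. (?k i j k)\<^sup>2) = 0"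
    using n norm unfolding b_def by simp
  have k0: "?k i j k = 0" if "i \<in> I" "j \<in> I" "k \<in> I" for i j k
  proof -
    have "\<forall>i\<in>I. (\<Sum>j\<in>I. \<Sum>k\<in>I. (?k i j k)\<^sup>2) = 0"
      using sum0 by (subst (asm) sum_nonneg_eq_0_iff) (auto intro!: sum_nonneg simp: I_def)
    then have "\<forall>j\<in>I. (\<Sum>k\<in>I. (?k i j k)\<^sup>2) = 0" using that(1)
      by (subst (asm) sum_nonneg_eq_0_iff) (auto intro!: sum_nonneg simp: I_def)
    then have "\<forall>k\<in>I. (?k i j k)\<^sup>2 = 0" using that(2)
      by (subst (asm) sum_nonneg_eq_0_iff) (auto simp: I_def)
    then show ?thesis using that(3) by simp
  qed
  show ?thesis
    by (subst expand[OF uvw(1)], subst expand[OF uvw(2)], subst expand[OF uvw(3)])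
      (simp add: alternating3_sum[OF s] alternating3_scale[OF s] k0)
qed

end

section \<open>Algebraic consequences of the curvature identities at a point\<close>

locale torsion_algebra = lorentz_space h for h :: "'e::euclidean_space \<Rightarrow> 'e \<Rightarrow> real" +
  fixes p :: 'e and s :: "'e \<Rightarrow> 'e \<Rightarrow> 'e \<Rightarrow> real" and T :: "'e \<Rightarrow> 'e \<Rightarrow> 'e"
    and R :: "'e \<Rightarrow> 'e \<Rightarrow> 'e \<Rightarrow> 'e"
  assumes null: "h p p = 0" and nonzero: "p \<noteq> 0"
    and alt: "alternating3 s"
    and torsion: "\<And>u v. T u v = h p u *\<^sub>R v - h p v *\<^sub>R u + form3_op h s u v"
    and R_skew: "\<And>u v w. R u v w = - R v u w"
    and R_metric: "\<And>u v w t. h (R u v w) t = - h (R u v t) w"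
    and R_p: "\<And>u v w. h (R u v w) p = 0"
    and R_bianchi: "\<And>u v w. R u v w + R v w u + R w u v =
        T (T u v) w + T (T v w) u + T (T w u) v"
    and R_form: "\<And>u v w x y. s (R u v w) x y + s w (R u v x) y + s w x (R u v y) = 0"
begin

lemmas s_simps = alternating3_simps[OF alt]
lemmas s_skew = alternating3_skew[OF alt]

lemma R_p_left: "R u v p = 0"
proof (rule nondegenerate)
  fix w show "h (R u v p) w = 0" using R_metric[of u v p w] R_p[of u v w] by simp
qed

lemma R_bianchi_expanded:
  "h (R u v w) x + h (R v w u) x + h (R w u v) x =
     s p u v * h w x + s p v w * h u x + s p w u * h v x
     + h p w * s u v x + h p u * s v w x + h p v * s w u x
     + h (form3_op h s u v) (form3_op h s w x) + h (form3_op h s v w) (form3_op h s u x)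
     + h (form3_op h s w u) (form3_op h s v x)"
proof -
  have TT: "h (T (T a b) c) x = s p a b * h c x - h p c * (h p a * h b x - h p b * h a x + s a b x)
      + h p a * s b c x - h p b * s a c x + h (form3_op h s a b) (form3_op h s c x)" for a b c
  proof -
    have pT: "h p (T a b) = s p a b"
      using form3_op[OF alt, of a b p] s_skew(5)[of p a b] s_skew(4)[of p a b]
      by (simp add: torsion h_sym[of p "form3_op h s a b"])
    have sT: "s (T a b) c x = h p a * s b c x - h p b * s a c x + s (form3_op h s a b) c x"
      by (simp add: torsion s_simps)
    have "s (form3_op h s a b) c x = s c x (form3_op h s a b)" by (rule s_skew(4))
    also have "\<dots> = h (form3_op h s c x) (form3_op h s a b)" by (simp add: form3_op[OF alt])
    finally have q: "s (form3_op h s a b) c x = h (form3_op h s a b) (form3_op h s c x)"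
      using h_sym by simp
    have "h (T (T a b) c) x = h p (T a b) * h c x - h p c * h (T a b) x + s (T a b) c x"
      by (subst torsion) (simp add: form3_op[OF alt])
    then show ?thesis
      unfolding pT sT q by (simp add: torsion form3_op[OF alt])
  qed
  have "h (R u v w) x + h (R v w u) x + h (R w u v) x = h (R u v w + R v w u + R w u v) x" by simp
  also have "\<dots> = h (T (T u v) w) x + h (T (T v w) u) x + h (T (T w u) v) x"
    unfolding R_bianchi by simp
  finally show ?thesis
    unfolding TT using s_skew(1)[of u w x] s_skew(1)[of v u x] s_skew(1)[of w v x]
    by (simp add: algebra_simps)
qed

text \<open>Twice the left side is the first plus the second minus the third minus the fourth of the
  cyclic sums that start at \<open>u\<close>, \<open>v\<close>, \<open>w\<close>, \<open>x\<close>.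
  The terms quadratic in \<open>s\<close> form a totally skew 4-form; a cyclic shift of four
  arguments is odd, so they cancel in this combination.\<close>

lemma R_pair_defect:
  "h (R u v w) x - h (R w x u) v =
     s p v w * h u x + s p w u * h v x + s p x v * h u w + s p u x * h v w
     + (s u v w * h p x + s v w x * h p u - s w x u * h p v - s x u v * h p w) / 2"
proof -
  have o: "form3_op h s a b = - form3_op h s b a" for a b
    by (rule h_eqI) (simp add: form3_op[OF alt], rule s_skew(1))
  have r1: "h (R a b c) d = - h (R b a c) d" for a b c d using R_skew[of a b c] by simp
  \<comment> \<open>These equations put the arguments of each kind of term into alphabetical order,
    so that the four identities share their atoms and only a linear combination of them remains to
    be found.\<close>
  note canonical_order =
      R_metric[of u v x w] R_metric[of u w x v] R_metric[of u x w v] R_metric[of v u x w]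
      R_metric[of v w x u] R_metric[of v x w u] R_metric[of w u x v] R_metric[of w v x u]
      R_metric[of w x v u] R_metric[of x u w v] R_metric[of x v w u] R_metric[of x w v u]
      r1[of v u w x] r1[of w u v x] r1[of x u v w] r1[of w v u x] r1[of x v u w] r1[of x w u v]
      o[of v u] o[of w u] o[of x u] o[of w v] o[of x v] o[of x w]
      h_sym[of v u] h_sym[of w u] h_sym[of x u] h_sym[of w v] h_sym[of x v] h_sym[of x w]
      s_skew(2)[of p v u] s_skew(2)[of p w u] s_skew(2)[of p x u] s_skew(2)[of p w v]
      s_skew(2)[of p x v] s_skew(2)[of p x w]
      s_skew(1)[of v u w] s_skew(2)[of u w v] s_skew(3)[of w v u] s_skew(5)[of v w u]
      s_skew(4)[of w u v] s_skew(1)[of v u x] s_skew(2)[of u x v] s_skew(3)[of x v u]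
      s_skew(5)[of v x u] s_skew(4)[of x u v] s_skew(1)[of w u x] s_skew(2)[of u x w]
      s_skew(3)[of x w u] s_skew(5)[of w x u] s_skew(4)[of x u w] s_skew(1)[of w v x]
      s_skew(2)[of v x w] s_skew(3)[of x w v] s_skew(5)[of w x v] s_skew(4)[of x v w]
      h_sym[of "form3_op h s w x" "form3_op h s u v"] h_sym[of "form3_op h s u x" "form3_op h s
      v w"] h_sym[of "form3_op h s v x" "form3_op h s u w"]
  show ?thesis
    using R_bianchi_expanded[of u v w x] R_bianchi_expanded[of v w x u]
      R_bianchi_expanded[of w x u v] R_bianchi_expanded[of x u v w]
    by (simp only: canonical_order bilinear_lneg[OF h_bilinear] bilinear_rneg[OF h_bilinear] minus_minus)
      (simp add: field_simps)
qed

text \<open>Since \<open>R x y p = 0\<close>, the pair defect gives \<open>R p w\<close> outright.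
  That it annihilates \<open>s\<close>, evaluated on \<open>p\<close>, \<open>q\<close>,
  \<open>w\<close>, makes \<open>A w\<close> null; being orthogonal to \<open>p\<close>, it is a
  multiple of \<open>p\<close>.\<close>

lemma s_p_perp:
  assumes w: "h p w = 0" and z: "h p z = 0"
  shows "s p w z = 0"
proof -
  define A where "A = form3_op h s p"
  have A: "h (A x) y = s p x y" for x y unfolding A_def by (rule form3_op[OF alt])
  \<comment> \<open>Three halves is one from the first four terms of \<open>R_pair_defect\<close>
    plus one half from the halved ones.\<close>
  have Rpw: "R p w x = (-3/2) *\<^sub>R (h p x *\<^sub>R A w - s p w x *\<^sub>R p)" for x
  proof (rule h_eqI)
    fix y
    have "h (R x y p) w = 0" by (simp add: R_p_left)
    then show "h (R p w x) y = h ((-3/2) *\<^sub>R (h p x *\<^sub>R A w - s p w x *\<^sub>R p)) y"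
      using R_pair_defect[of x y p w] w null s_skew(2)[of p x w] s_skew(3)[of x y p] s_skew(2)[of p y x]
        s_skew(4)[of p w x] s_skew(5)[of y p w] s_skew(1)[of y p w] s_skew(2)[of p y w] h_sym[of x p] h_sym[of y p]
      by (simp add: A s_simps field_simps)
  qed
  obtain q where q: "h p q = 1" using ex_dual_vector[OF nonzero] by blast
  have "s p (A w) w = 0"
    using R_form[of p w p q w] w q by (simp add: R_p_left Rpw s_simps)
  then have "h (A w) (A w) = 0" using A[of w "A w"] s_skew(2)[of p w "A w"] by simp
  moreover have "h p (A w) = 0" using A[of w p] h_sym[of p "A w"] by (simp add: s_simps)
  ultimately obtain t where "A w = t *\<^sub>R p" using null_perp(2)[OF null nonzero] by blast
  then show ?thesis using A[of w z] z by simp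
qed

text \<open>The relation \<open>norm_eq\<close> for all \<open>y\<close> orthogonal to
  \<open>p\<close> is the equality case of the Cauchy-Schwarz inequality with \<open>a\<close>, so
  the screen space is spanned by the class of \<open>a\<close>.\<close>

lemma dim_le_3_or_s_p_zero:
  "(\<exists>q a. span {p, a, q} = UNIV) \<or> (\<forall>v w. s p v w = 0)"
proof -
  obtain q where q: "h p q = 1" using ex_dual_vector[OF nonzero] by blast
  define a where "a = form3_op h s p q"
  have a: "h a x = s p q x" for x unfolding a_def by (rule form3_op[OF alt])
  have ap: "h a p = 0" and aq: "h a q = 0" by (simp_all add: a s_simps)
  have pa: "h p a = 0" using ap h_sym by simp
  have sp: "s p x y = h p x * h a y - h p y * h a x" for x y
  proof -
    have "s p (x - h p x *\<^sub>R q) (y - h p y *\<^sub>R q) = 0"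
      by (rule s_p_perp) (simp_all add: q)
    then show ?thesis using s_skew(2)[of p x q] by (simp add: s_simps a algebra_simps)
  qed
  show ?thesis
  proof (cases "a = 0")
    case True
    then show ?thesis using sp by simp
  next
    case False
    define N where "N = h a a"
    have N: "N > 0"
    proof (rule ccontr)
      assume "\<not> N > 0"
      then have "h a a = 0" using null_perp(1)[OF null nonzero pa] unfolding N_def by simp
      then obtain t where t: "a = t *\<^sub>R p" using null_perp(2)[OF null nonzero pa] by blast
      then have "t = 0" using aq q by simp
      then show False using t False by simp
    qed
    \<comment> \<open>The curvature annihilates \<open>s p\<close>, which is the wedge of
      \<open>p\<close> and \<open>a\<close>; evaluated on \<open>z\<close> and \<open>q\<close> only
      the product with \<open>a\<close> survives.\<close>
    have Ra: "h (R x y z) a = 0" if z: "h p z = 0" for x y z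
    proof -
      have "h p (R x y w) = 0" for w using R_p h_sym by simp
      then show ?thesis
        using R_form[of x y p z q] z q by (simp add: R_p_left s_simps sp h_sym[of a])
    qed
    have norm_eq: "N * h y y = (h a y)\<^sup>2" if y: "h p y = 0" for y
    proof -
      \<comment> \<open>This vector collects what \<open>R_pair_defect\<close> yields for
        \<open>R y a\<close>, given that \<open>R z w y\<close> is orthogonal to
        \<open>a\<close>.\<close>
      define u where "u = N *\<^sub>R y - h a y *\<^sub>R a + (1/2) *\<^sub>R form3_op h s y a"
      have hu: "h u x = N * h y x - h a y * h a x + s y a x / 2" for x
        by (simp add: u_def form3_op[OF alt])
      have Rya: "R y a z = h u z *\<^sub>R p - h p z *\<^sub>R u" for z
      proof (rule h_eqI)
        fix w
        have "h (R z w y) a = 0" by (rule Ra[OF y])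
        then show "h (R y a z) w = h (h u z *\<^sub>R p - h p z *\<^sub>R u) w"
          using R_pair_defect[of y a z w] y pa s_skew(1)[of w y a] s_skew(4)[of w y a]
          by (simp add: hu sp N_def h_sym[of w] algebra_simps s_simps)
      qed
      have pu: "h p u = 0"
        using hu[of p] h_sym[of p u] h_sym[of y p] y ap sp[of y a] s_skew(4)[of p y a] s_skew(5)[of p y a]
        by (simp add: pa)
      have ua: "h u a = 0"
        using hu[of a] h_sym[of y a] by (simp add: N_def s_simps)
      \<comment> \<open>On \<open>q\<close>, \<open>u\<close>, \<open>a\<close> the first and third
        terms of \<open>R_form\<close> vanish, and the middle one is \<open>h u u * s q p a\<close>
        with \<open>s q p a = - N\<close>.\<close>
      have "h u u * N = 0"
        using R_form[of y a q u a] q pu pa ua sp[of u a] s_skew(1)[of q p a] s_skew(1)[of q u p]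
          s_skew(5)[of q u p] sp[of q u] sp[of q a] h_sym[of a u]
        by (simp add: Rya s_simps N_def)
      then have "h u u = 0" using N by simp
      then obtain t where "u = t *\<^sub>R p" using null_perp(2)[OF null nonzero pu] by blast
      then have "h u y = 0" using y by simp
      then show ?thesis using hu[of y] by (simp add: s_simps power2_eq_square)
    qed
    have "x \<in> span {p, a, q}" for x
    proof -
      define y where "y = x - h p x *\<^sub>R q"
      define z where "z = y - (h a y / N) *\<^sub>R a"
      have py: "h p y = 0" by (simp add: y_def q)
      have pz: "h p z = 0" by (simp add: z_def py pa)
      have "h z z = h y y - (h a y)\<^sup>2 / N"
        using N by (simp add: z_def h_sym[of y a] N_def[symmetric] power2_eq_square field_simps)
      also have "\<dots> = 0" using norm_eq[OF py] N by (simp add: field_simps)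
      finally obtain t where t: "z = t *\<^sub>R p" using null_perp(2)[OF null nonzero pz] by blast
      have "x = t *\<^sub>R p + (h a y / N) *\<^sub>R a + h p x *\<^sub>R q"
        unfolding t[symmetric] z_def y_def by simp
      then show ?thesis by (metis insertCI span_add span_base span_scale)
    qed
    then show ?thesis by blast
  qed
qed

lemma s_p_zero:
  assumes norm: "form3_norm_sq h s = 0"
  shows "s p v w = 0"
proof (cases "\<forall>v w. s p v w = 0")
  case False
  then obtain q a where span: "span {p, a, q} = UNIV" using dim_le_3_or_s_p_zero by blast
  have "dim (UNIV :: 'e set) \<le> card {p, a, q}"
    by (rule dim_le_card) (simp_all add: span)
  also have "\<dots> \<le> 3" by (simp add: card_insert_if)
  finally have dim: "DIM('e) \<le> 3" by simp
  define I where "I = {1..<DIM('e)}"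
  obtain e where e: "lorentz_frame h e"
    and n: "form3_norm_sq h s = (\<Sum>i\<in>I. \<Sum>j\<in>I. \<Sum>k\<in>I. (s (e i) (e j) (e k))\<^sup>2)
       - 3 * (\<Sum>j\<in>I. \<Sum>k\<in>I. (s (e 0) (e j) (e k))\<^sup>2)"
    using form3_norm_sq_frame[OF alt] unfolding I_def by blast
  \<comment> \<open>At most two spacelike indices are available, so three of them repeat. Only
    components with one timelike index are left, and all of these enter the norm with the same
    sign.\<close>
  have sp: "s (e i) (e j) (e k) = 0" if "i \<in> I" "j \<in> I" "k \<in> I" for i j k
  proof -
    have "i = j \<or> j = k \<or> i = k" using that dim unfolding I_def by auto
    then show ?thesis by (auto simp: s_simps)
  qed
  then have "(\<Sum>j\<in>I. \<Sum>k\<in>I. (s (e 0) (e j) (e k))\<^sup>2) = 0" using n norm by simp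
  then have "\<forall>j\<in>I. (\<Sum>k\<in>I. (s (e 0) (e j) (e k))\<^sup>2) = 0"
    by (subst (asm) sum_nonneg_eq_0_iff) (auto intro!: sum_nonneg simp: I_def)
  then have s0: "s (e 0) (e j) (e k) = 0" if "j \<in> I" "k \<in> I" for j k
    using that by (subst (asm) sum_nonneg_eq_0_iff) (auto simp: I_def)
  have I0: "i \<in> I \<or> i = 0" if "i < DIM('e)" for i using that unfolding I_def by auto
  have "s (e i) (e j) (e k) = 0" if "i < DIM('e)" "j < DIM('e)" "k < DIM('e)" for i j k
    using I0[OF that(1)] I0[OF that(2)] I0[OF that(3)] sp s0 s_skew(1)[of "e i" "e 0" "e k"]
      s_skew(5)[of "e i" "e j" "e 0"] by (auto simp: s_simps)
  then show ?thesis
    by (subst (1) frame_expansion[OF e, of p], subst (1) frame_expansion[OF e, of v], subst (1) frame_expansion[OF e, of w])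
      (simp add: alternating3_sum[OF alt] s_simps)
qed blast

lemma s_perp_zero:
  assumes "form3_norm_sq h s = 0" "h p u = 0" "h p v = 0" "h p w = 0"
  shows "s u v w = 0"
  by (rule vanishes_on_perp[OF alt assms(1) null nonzero s_p_zero[OF assms(1)] assms(2-4)])

end

section \<open>Differential calculus\<close>

lemma has_derivative_cong_open:
  assumes "open S" "x \<in> S" "\<And>y. y \<in> S \<Longrightarrow> f y = g y"
  shows "(f has_derivative d) (at x) \<longleftrightarrow> (g has_derivative d) (at x)"
  using has_derivative_transform_within_open[OF _ assms(1,2), of f d UNIV g]
    has_derivative_transform_within_open[OF _ assms(1,2), of g d UNIV f] assms(3)
  by (metis (no_types, lifting))

lemma frechet_derivative_cong_open:
  assumes "open S" "x \<in> S" "\<And>y. y \<in> S \<Longrightarrow> f y = g y"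
  shows "frechet_derivative f (at x) = frechet_derivative g (at x)"
  unfolding frechet_derivative_def using has_derivative_cong_open[OF assms] by simp

lemma differentiable_cong_open:
  assumes "open S" "x \<in> S" "\<And>y. y \<in> S \<Longrightarrow> f y = g y"
  shows "f differentiable (at x) \<longleftrightarrow> g differentiable (at x)"
  unfolding differentiable_def using has_derivative_cong_open[OF assms] by simp

section \<open>Functions of class C^k on open sets\<close>

lemma Ck_on_cong:
  assumes "open S" "\<And>x. x \<in> S \<Longrightarrow> f x = g x"
  shows "Ck_on k S f \<longleftrightarrow> Ck_on k S g"
  using assms(2)
proof (induction k arbitrary: f g)
  case 0
  then show ?case by (simp cong: continuous_on_cong)
next
  case (Suc k)
  have "f differentiable (at x) \<longleftrightarrow> g differentiable (at x)" if "x \<in> S" for x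
    using differentiable_cong_open[OF assms(1) that] Suc.prems by blast
  moreover have "Ck_on k S (\<lambda>x. frechet_derivative f (at x) v) \<longleftrightarrow> Ck_on k S (\<lambda>x. frechet_derivative g (at x) v)" for v
    by (rule Suc.IH) (simp add: frechet_derivative_cong_open[OF assms(1) _ Suc.prems])
  ultimately show ?case by simp
qed

lemma Ck_on_subset: "Ck_on k S f \<Longrightarrow> T \<subseteq> S \<Longrightarrow> Ck_on k T f"
  by (induction k arbitrary: f) (auto intro: continuous_on_subset)

lemma Ck_on_local:
  assumes "\<And>x. x \<in> S \<Longrightarrow> \<exists>T. open T \<and> x \<in> T \<and> Ck_on k T f"
  shows "Ck_on k S f"
  using assms
proof (induction k arbitrary: f)
  case 0
  show ?case unfolding Ck_on.simps
  proof (intro continuous_at_imp_continuous_on ballI)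
    fix x assume "x \<in> S"
    then show "isCont f x" using 0 continuous_on_eq_continuous_at by (metis Ck_on.simps(1))
  qed
next
  case (Suc k)
  have "f differentiable (at x)" if "x \<in> S" for x using Suc.prems[OF that] by auto
  moreover have "Ck_on k S (\<lambda>x. frechet_derivative f (at x) v)" for v
    using Suc.prems by (intro Suc.IH) fastforce
  ultimately show ?case by simp
qed

lemma Ck_on_Suc_D: "Ck_on (Suc k) S f \<Longrightarrow> Ck_on k S f"
proof (induction k arbitrary: f)
  case 0
  then show ?case
    by (auto intro!: continuous_at_imp_continuous_on differentiable_imp_continuous_within)
next
  case (Suc k)
  from Suc.prems have "f differentiable (at x)" if "x \<in> S" for x using that by simp
  moreover from Suc.prems have "Ck_on (Suc k) S (\<lambda>x. frechet_derivative f (at x) v)" for v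
    by (subst (asm) Ck_on.simps) blast
  ultimately show ?case using Suc.IH by simp
qed

lemma Ck_on_SucI:
  assumes "open S" "\<And>x. x \<in> S \<Longrightarrow> (f has_derivative f' x) (at x)" "\<And>v. Ck_on k S (\<lambda>x. f' x v)"
  shows "Ck_on (Suc k) S f"
proof -
  have "frechet_derivative f (at x) = f' x" if "x \<in> S" for x
    using frechet_derivative_at[OF assms(2)[OF that]] by simp
  then have "Ck_on k S (\<lambda>x. frechet_derivative f (at x) v) \<longleftrightarrow> Ck_on k S (\<lambda>x. f' x v)" for v
    by (intro Ck_on_cong[OF assms(1)]) simp
  then show ?thesis using assms(2,3) unfolding Ck_on.simps differentiable_def by blast
qed

lemma Ck_on_SucD:
  assumes "Ck_on (Suc k) S f"
  shows "\<And>x. x \<in> S \<Longrightarrow> (f has_derivative frechet_derivative f (at x)) (at x)"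
    "\<And>v. Ck_on k S (\<lambda>x. frechet_derivative f (at x) v)"
  using assms frechet_derivative_works by auto

lemma Ck_on_const: "Ck_on k S (\<lambda>x. c)"
  by (induction k arbitrary: c) (simp_all add: frechet_derivative_const)

lemma Ck_on_bounded_linear:
  assumes "open S" "bounded_linear L" "Ck_on k S f"
  shows "Ck_on k S (\<lambda>x. L (f x))"
  using assms(3)
proof (induction k arbitrary: f)
  case 0
  then show ?case by (simp add: bounded_linear.continuous_on[OF assms(2)])
next
  case (Suc k)
  show ?case
  proof (rule Ck_on_SucI[OF assms(1)])
    fix x assume "x \<in> S"
    then show "((\<lambda>x. L (f x)) has_derivative (\<lambda>v. L (frechet_derivative f (at x) v))) (at x)"
      using Ck_on_SucD(1)[OF Suc.prems] bounded_linear.has_derivative[OF assms(2)] by blast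
  qed (rule Suc.IH, rule Ck_on_SucD(2)[OF Suc.prems])
qed

lemma Ck_on_add:
  assumes "open S" "Ck_on k S f" "Ck_on k S g"
  shows "Ck_on k S (\<lambda>x. f x + g x)"
  using assms(2,3)
proof (induction k arbitrary: f g)
  case 0
  then show ?case by (simp add: continuous_on_add)
next
  case (Suc k)
  show ?case
  proof (rule Ck_on_SucI[OF assms(1)])
    fix x assume "x \<in> S"
    then show "((\<lambda>x. f x + g x) has_derivative (\<lambda>v. frechet_derivative f (at x) v + frechet_derivative g (at x) v)) (at x)"
      using Ck_on_SucD(1)[OF Suc.prems(1)] Ck_on_SucD(1)[OF Suc.prems(2)] by (intro has_derivative_add)
  qed (intro Suc.IH Ck_on_SucD(2)[OF Suc.prems(1)] Ck_on_SucD(2)[OF Suc.prems(2)])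
qed

lemma Ck_on_bilinear:
  assumes "open S" "bounded_bilinear P" "Ck_on k S f" "Ck_on k S g"
  shows "Ck_on k S (\<lambda>x. P (f x) (g x))"
  using assms(3,4)
proof (induction k arbitrary: f g)
  case 0
  then show ?case by (simp add: bounded_bilinear.continuous_on[OF assms(2)])
next
  case (Suc k)
  show ?case
  proof (rule Ck_on_SucI[OF assms(1)])
    fix x assume "x \<in> S"
    then show "((\<lambda>x. P (f x) (g x)) has_derivative (\<lambda>v. P (f x) (frechet_derivative g (at x) v) + P (frechet_derivative f (at x) v) (g x))) (at x)"
      using Ck_on_SucD(1)[OF Suc.prems(1)] Ck_on_SucD(1)[OF Suc.prems(2)]
      by (intro bounded_bilinear.FDERIV[OF assms(2)])
  next
    fix v
    show "Ck_on k S (\<lambda>x. P (f x) (frechet_derivative g (at x) v) + P (frechet_derivative f (at x) v) (g x))"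
      by (intro Ck_on_add assms(1) Suc.IH Ck_on_SucD(2)[OF Suc.prems(1)] Ck_on_SucD(2)[OF Suc.prems(2)]
          Ck_on_Suc_D[OF Suc.prems(1)] Ck_on_Suc_D[OF Suc.prems(2)])
  qed
qed

lemma Ck_on_sum:
  assumes "open S" "\<And>i. i \<in> A \<Longrightarrow> Ck_on k S (f i)"
  shows "Ck_on k S (\<lambda>x. \<Sum>i\<in>A. f i x)"
  using assms(2) by (induction A rule: infinite_finite_induct) (auto intro: Ck_on_const Ck_on_add assms(1))

lemma linear_euclidean_expansion:
  assumes "linear f" shows "f v = (\<Sum>b\<in>Basis. (v \<bullet> b) *\<^sub>R f b)"
  by (subst euclidean_representation[of v, symmetric], subst linear_sum[OF assms])
    (simp add: linear_scale[OF assms])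

lemma Ck_on_compose:
  assumes "open S" "open T" "g ` S \<subseteq> T" "Ck_on k S g" "Ck_on k T f"
  shows "Ck_on k S (\<lambda>x. f (g x))"
  using assms(4,5)
proof (induction k arbitrary: f)
  case 0
  then show ?case using assms(3) by (auto intro: continuous_on_compose2)
next
  case (Suc k)
  show ?case
  proof (rule Ck_on_SucI[OF assms(1)])
    fix x assume x: "x \<in> S"
    then have f: "(f has_derivative frechet_derivative f (at (g x))) (at (g x))"
      using Ck_on_SucD(1)[OF Suc.prems(2)] assms(3) by blast
    have "((\<lambda>x. f (g x)) has_derivative (\<lambda>v. frechet_derivative f (at (g x)) (frechet_derivative g (at x) v))) (at x)"
      using has_derivative_compose[OF Ck_on_SucD(1)[OF Suc.prems(1) x] f] .
    \<comment> \<open>\<open>Ck_on\<close> controls derivatives in constant directions only, so the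
      direction \<open>frechet_derivative g (at x) v\<close>, which varies with \<open>x\<close>, is
      expanded in the basis.\<close>
    then show "((\<lambda>x. f (g x)) has_derivative
       (\<lambda>v. \<Sum>b\<in>Basis. (frechet_derivative g (at x) v \<bullet> b) *\<^sub>R frechet_derivative f (at (g x)) b)) (at x)"
      by (simp only: linear_euclidean_expansion[OF has_derivative_linear[OF f], of "frechet_derivative g (at x) _"])
  next
    fix v
    have "Ck_on k S (\<lambda>x. frechet_derivative f (at (g x)) b)" for b
      by (rule Suc.IH[OF Ck_on_Suc_D[OF Suc.prems(1)] Ck_on_SucD(2)[OF Suc.prems(2)]])
    moreover have "Ck_on k S (\<lambda>x. frechet_derivative g (at x) v \<bullet> b)" for b
      by (rule Ck_on_bounded_linear[OF assms(1) bounded_linear_inner_left Ck_on_SucD(2)[OF Suc.prems(1)]])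
    ultimately show "Ck_on k S (\<lambda>x. \<Sum>b\<in>Basis. (frechet_derivative g (at x) v \<bullet> b) *\<^sub>R frechet_derivative f (at (g x)) b)"
      by (intro Ck_on_sum Ck_on_bilinear[OF _ bounded_bilinear_scaleR] assms(1))
  qed
qed

lemma Ck_on_exp: "open S \<Longrightarrow> Ck_on k S (\<lambda>x::real. exp x)"
proof (induction k)
  case (Suc k)
  show ?case
  proof (rule Ck_on_SucI[OF Suc.prems])
    show "(exp has_derivative (\<lambda>v. exp x * v)) (at x)" for x :: real
      using DERIV_exp[of x] by (simp add: has_field_derivative_def)
    show "Ck_on k S (\<lambda>x. exp x * v)" for v
      by (intro Ck_on_bilinear[OF _ bounded_bilinear_mult] Suc Ck_on_const)
  qed
qed (simp add: continuous_on_exp)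

lemma Ck_on_inverse: "open S \<Longrightarrow> 0 \<notin> S \<Longrightarrow> Ck_on k S (\<lambda>x::real. inverse x)"
proof (induction k)
  case 0
  then show ?case by (auto intro!: continuous_on_inverse)
next
  case (Suc k)
  show ?case
  proof (rule Ck_on_SucI[OF Suc.prems(1)])
    show "(inverse has_derivative (\<lambda>v. - (inverse x * v * inverse x))) (at x)" if "x \<in> S" for x :: real
      using has_derivative_inverse'[of x] that Suc.prems by metis
    show "Ck_on k S (\<lambda>x. - (inverse x * v * inverse x))" for v
      by (intro Ck_on_bounded_linear[where L=uminus] bounded_linear_minus bounded_linear_ident
          Ck_on_bilinear[OF _ bounded_bilinear_mult] Suc Ck_on_const)
  qed
qed

text \<open>Near \<open>x\<close> the factor \<open>f\<close> is bounded by a multiple of the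
  distance and \<open>k\<close> tends to zero. The lemma is applied with \<open>k\<close> a
  component of the solution of a linear system, at a stage where that is known to be continuous but
  not yet differentiable.\<close>

lemma has_derivative_product_zero:
  fixes f k :: "'a::real_normed_vector \<Rightarrow> real"
  assumes "(f has_derivative f') (at x)" "f x = 0" "isCont k x" "k x = 0"
  shows "((\<lambda>y. f y * k y) has_derivative (\<lambda>v. 0)) (at x)"
proof -
  obtain B where B: "norm (f' v) \<le> norm v * B" for v
    using bounded_linear.bounded[OF has_derivative_bounded_linear[OF assms(1)]] by blast
  have lim: "((\<lambda>y. norm (f y - f x - f' (y - x)) / norm (y - x)) \<longlongrightarrow> 0) (at x)"
    using tendsto_norm[of "\<lambda>y. (f y - f x - f' (y - x)) /\<^sub>R norm (y - x)" 0 "at x"] assms(1)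
    unfolding has_derivative_at_within by (simp add: divide_inverse_commute abs_mult)
  have k0: "(k \<longlongrightarrow> 0) (at x)" using assms(3,4) by (simp add: isCont_def)
  have "((\<lambda>y. (norm (f y - f x - f' (y - x)) / norm (y - x) + \<bar>B\<bar>) * \<bar>k y\<bar>) \<longlongrightarrow> (0 + \<bar>B\<bar>) * 0) (at x)"
    by (intro tendsto_mult tendsto_add lim tendsto_const tendsto_rabs_zero k0)
  then have up: "((\<lambda>y. (norm (f y - f x - f' (y - x)) / norm (y - x) + \<bar>B\<bar>) * \<bar>k y\<bar>) \<longlongrightarrow> 0) (at x)"
    by simp
  have "((\<lambda>y. norm (f y * k y) / norm (y - x)) \<longlongrightarrow> 0) (at x)"
  proof (rule tendsto_sandwich[OF _ _ tendsto_const up])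
    show "\<forall>\<^sub>F y in at x. 0 \<le> norm (f y * k y) / norm (y - x)" by simp
    show "\<forall>\<^sub>F y in at x. norm (f y * k y) / norm (y - x)
        \<le> (norm (f y - f x - f' (y - x)) / norm (y - x) + \<bar>B\<bar>) * \<bar>k y\<bar>"
      unfolding eventually_at_filter
    proof (intro always_eventually allI impI)
      fix y assume "y \<noteq> x"
      have "\<bar>f' (y - x)\<bar> \<le> norm (y - x) * \<bar>B\<bar>"
        using B[of "y - x"] mult_left_mono[OF abs_ge_self[of B] norm_ge_zero[of "y - x"]] by simp
      then have "\<bar>f y\<bar> \<le> norm (f y - f x - f' (y - x)) + norm (y - x) * \<bar>B\<bar>"
        using assms(2) by simp
      then have "\<bar>f y\<bar> / norm (y - x) \<le> (norm (f y - f x - f' (y - x)) + norm (y - x) * \<bar>B\<bar>) / norm (y - x)"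
        by (rule divide_right_mono) simp
      also have "\<dots> = norm (f y - f x - f' (y - x)) / norm (y - x) + \<bar>B\<bar>"
        using \<open>y \<noteq> x\<close> by (simp add: add_divide_distrib)
      finally show "norm (f y * k y) / norm (y - x)
        \<le> (norm (f y - f x - f' (y - x)) / norm (y - x) + \<bar>B\<bar>) * \<bar>k y\<bar>"
        using mult_right_mono[OF _ abs_ge_zero[of "k y"]] by (fastforce simp: abs_mult)
    qed
  qed
  then have "((\<lambda>y. (f y * k y) /\<^sub>R norm (y - x)) \<longlongrightarrow> 0) (at x)"
    by (intro tendsto_norm_zero_cancel[of "\<lambda>y. (f y * k y) /\<^sub>R norm (y - x)"]) (simp add: divide_inverse_commute abs_mult)
  then show ?thesis
    unfolding has_derivative_at_within using assms(2) by (simp add: bounded_linear_zero)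
qed

text \<open>
  The coordinates \<open>z\<close> of a vector with prescribed products \<open>h\<close> with a frame solve the linear
  system whose matrix \<open>G\<close> is the Gram matrix. Their smoothness is obtained
  without determinants: the directional derivative \<open>z'\<close> solves \<open>G z' = h' - G' z\<close>, a system with the same matrix.
\<close>

lemma isCont_linear_system:
  fixes G :: "'a::euclidean_space \<Rightarrow> 'b::euclidean_space \<Rightarrow> 'b"
  assumes S: "open S" "x \<in> S"
    and lin: "\<And>y. y \<in> S \<Longrightarrow> linear (G y)" and inj: "inj (G x)"
    and G: "\<And>w. isCont (\<lambda>y. G y w) x" and h: "isCont h x"
    and z: "\<And>y. y \<in> S \<Longrightarrow> G y (z y) = h y"
  shows "isCont z x"
proof -
  obtain L where L: "linear L" "L \<circ> G x = id"
    using linear_injective_left_inverse[OF lin[OF S(2)] inj] by blast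
  then have LG: "L (G x w) = w" for w by (metis comp_apply id_apply)
  have bL: "bounded_linear L" using L(1) linear_conv_bounded_linear by blast
  obtain B where B: "B > 0" "\<And>w. norm (L w) \<le> norm w * B"
    using bounded_linear.pos_bounded[OF bL] by blast
  define r where "r y = h y - G y (z x)" for y
  have Gr: "G y (z y - z x) = r y" if "y \<in> S" for y
    using linear_diff[OF lin[OF that]] z[OF that] by (simp add: r_def)
  \<comment> \<open>\<open>E y\<close> is small, so \<open>G y\<close> is bounded below near \<open>x\<close>.\<close>
  define E where "E y w = G y w - G x w" for y w
  have Elin: "linear (E y)" if "y \<in> S" for y
    unfolding E_def by (intro linear_compose_sub lin that S)
  have Ebound: "norm (E y w) \<le> (\<Sum>b\<in>Basis. norm (E y b)) * norm w" if "y \<in> S" for y w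
  proof -
    have "norm (E y w) = norm (\<Sum>b\<in>Basis. (w \<bullet> b) *\<^sub>R E y b)"
      using arg_cong[OF linear_euclidean_expansion[OF Elin[OF that], of w], of norm] .
    also have "\<dots> \<le> (\<Sum>b\<in>Basis. norm (E y b) * norm w)"
    proof (rule sum_norm_le)
      fix b :: 'b assume "b \<in> Basis"
      show "norm ((w \<bullet> b) *\<^sub>R E y b) \<le> norm (E y b) * norm w"
        using mult_right_mono[OF Basis_le_norm[OF \<open>b \<in> Basis\<close>, of w] norm_ge_zero[of "E y b"]]
        by (simp add: mult.commute)
    qed
    finally show ?thesis by (simp add: sum_distrib_right)
  qed
  have zE: "z y - z x = L (r y) - L (E y (z y - z x))" if "y \<in> S" for y
    using Gr[OF that] LG[of "z y - z x"] by (simp add: E_def linear_diff[OF L(1)])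
  have "((\<lambda>y. \<Sum>b\<in>Basis. norm (E y b)) \<longlongrightarrow> (\<Sum>b\<in>Basis. norm (G x b - G x b))) (at x)"
    unfolding E_def
    by (intro tendsto_sum tendsto_norm tendsto_diff tendsto_const G[unfolded isCont_def])
  then have E0: "((\<lambda>y. \<Sum>b\<in>Basis. norm (E y b)) \<longlongrightarrow> 0) (at x)" by simp
  have "(r \<longlongrightarrow> h x - G x (z x)) (at x)"
    unfolding r_def by (intro tendsto_diff h[unfolded isCont_def] G[unfolded isCont_def])
  then have rc: "(r \<longlongrightarrow> 0) (at x)" using z[OF S(2)] by simp
  \<comment> \<open>\<open>L\<close> is bounded by \<open>B\<close>, so on this neighbourhood
    \<open>L (E y w)\<close> has at most half the norm of \<open>w\<close> and can be absorbed into
    the left side of \<open>zE\<close>; hence the factor \<open>2 * B\<close> below.\<close>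
  have ev: "\<forall>\<^sub>F y in at x. y \<in> S \<and> (\<Sum>b\<in>Basis. norm (E y b)) < 1 / (2 * B)"
    using order_tendstoD(2)[OF E0, of "1 / (2 * B)"] B(1) S
    by (auto intro: eventually_conj eventually_at_in_open')
  have "((\<lambda>y. z y - z x) \<longlongrightarrow> 0) (at x)"
  proof (rule Lim_null_comparison)
    show "((\<lambda>y. 2 * B * norm (r y)) \<longlongrightarrow> 0) (at x)"
      by (intro tendsto_mult_right_zero tendsto_norm_zero rc)
    show "\<forall>\<^sub>F y in at x. norm (z y - z x) \<le> 2 * B * norm (r y)"
      using ev
    proof eventually_elim
      case (elim y)
      let ?d = "norm (z y - z x)"
      have "norm (E y (z y - z x)) \<le> 1 / (2 * B) * ?d"
        using Ebound[of y "z y - z x"] elim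
          mult_right_mono[of "\<Sum>b\<in>Basis. norm (E y b)" "1 / (2 * B)" ?d] by simp
      then have "norm (E y (z y - z x)) * B \<le> (1 / (2 * B) * ?d) * B"
        using B(1) by (intro mult_right_mono) auto
      moreover have "?d \<le> norm (L (r y)) + norm (L (E y (z y - z x)))"
        using norm_triangle_ineq4[of "L (r y)" "L (E y (z y - z x))"] zE[of y] elim by metis
      ultimately show ?case using B(2)[of "r y"] B(2)[of "E y (z y - z x)"] B(1)
        by (simp add: field_simps)
    qed
  qed
  then show ?thesis unfolding isCont_def using Lim_null by blast
qed

lemma has_derivative_linear_system:
  fixes G :: "'a::euclidean_space \<Rightarrow> 'b::euclidean_space \<Rightarrow> 'b"
  assumes S: "open S" "x \<in> S"
    and lin: "\<And>y. y \<in> S \<Longrightarrow> linear (G y)" and inj: "\<And>y. y \<in> S \<Longrightarrow> inj (G y)"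
    and G: "\<And>w. Ck_on 1 S (\<lambda>y. G y w)"
    and h: "(h has_derivative h') (at x)"
    and z: "\<And>y. y \<in> S \<Longrightarrow> G y (z y) = h y"
  shows "\<exists>z'. (z has_derivative z') (at x) \<and>
     (\<forall>v. G x (z' v) = h' v - frechet_derivative (\<lambda>y. G y (z x)) (at x) v)"
proof -
  obtain L where L: "linear L" "L \<circ> G x = id"
    using linear_injective_left_inverse[OF lin[OF S(2)] inj[OF S(2)]] by blast
  then have LG: "L (G x w) = w" for w by (metis comp_apply id_apply)
  have GL: "G x (L w) = w" for w
  proof -
    obtain u where "w = G x u"
      using linear_injective_imp_surjective[OF lin[OF S(2)] inj[OF S(2)] refl] by (metis surjD)
    then show ?thesis by (simp add: LG)
  qed
  have bL: "bounded_linear L" using L(1) linear_conv_bounded_linear by blast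
  define r where "r y = h y - G y (z x)" for y
  define r' where "r' v = h' v - frechet_derivative (\<lambda>y. G y (z x)) (at x) v" for v
  have Gd: "((\<lambda>y. G y w) has_derivative frechet_derivative (\<lambda>y. G y w) (at x)) (at x)" for w
    using Ck_on_SucD(1)[of 0 S "\<lambda>y. G y w" x] G[of w] S(2) by simp
  have r: "(r has_derivative r') (at x)"
    unfolding r_def r'_def by (intro has_derivative_diff h Gd)
  have rx: "r x = 0" using z[OF S(2)] by (simp add: r_def)
  have Gr: "G y (z y - z x) = r y" if "y \<in> S" for y
    using linear_diff[OF lin[OF that]] z[OF that] by (simp add: r_def)
  define E where "E y w = G y w - G x w" for y w
  have E: "((\<lambda>y. E y w) has_derivative frechet_derivative (\<lambda>y. G y w) (at x)) (at x)" for w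
    unfolding E_def using has_derivative_diff[OF Gd has_derivative_const] by simp
  have Elin: "linear (E y)" if "y \<in> S" for y
    unfolding E_def by (intro linear_compose_sub lin that S)
  have zE: "z y - z x = L (r y) - L (E y (z y - z x))" if "y \<in> S" for y
    using Gr[OF that] LG[of "z y - z x"] by (simp add: E_def linear_diff[OF L(1)])
  have "isCont z x"
    by (rule isCont_linear_system[where G=G and S=S and h=h])
      (use S lin inj z has_derivative_continuous[OF Gd] has_derivative_continuous[OF h] in auto)
  then have "((\<lambda>y. z y - z x) \<longlongrightarrow> 0) (at x)" unfolding isCont_def using Lim_null by blast
  then have zc: "isCont (\<lambda>y. (z y - z x) \<bullet> b) x" for b
    using tendsto_inner[OF _ tendsto_const[of b]] by (fastforce simp: isCont_def)
  \<comment> \<open>\<open>E y\<close> is differentiable and vanishes at \<open>x\<close>, and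
    \<open>z y - z x\<close> is continuous and vanishes there. So the last term of \<open>zE\<close>
    has derivative zero, and the derivative of \<open>z\<close> is that of the explicit
    remainder.\<close>
  have "((\<lambda>y. ((z y - z x) \<bullet> b) *\<^sub>R E y b) has_derivative (\<lambda>v. 0)) (at x)" for b
  proof (rule has_derivative_componentwise_within[THEN iffD2], intro ballI)
    fix c :: 'b assume "c \<in> Basis"
    have "((\<lambda>y. (E y b \<bullet> c) * ((z y - z x) \<bullet> b)) has_derivative (\<lambda>v. 0)) (at x)"
      by (rule has_derivative_product_zero[OF has_derivative_inner_left[OF E] _ zc]) (simp_all add: E_def)
    then show "((\<lambda>y. ((z y - z x) \<bullet> b) *\<^sub>R E y b \<bullet> c) has_derivative (\<lambda>v. 0 \<bullet> c)) (at x)"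
      by (simp add: mult.commute)
  qed
  then have "((\<lambda>y. \<Sum>b\<in>Basis. ((z y - z x) \<bullet> b) *\<^sub>R E y b) has_derivative (\<lambda>v. \<Sum>b\<in>(Basis::'b set). 0)) (at x)"
    by (intro has_derivative_sum)
  then have Ez: "((\<lambda>y. \<Sum>b\<in>Basis. ((z y - z x) \<bullet> b) *\<^sub>R E y b) has_derivative (\<lambda>v. 0)) (at x)" by simp
  have "((\<lambda>y. z x + L (r y) - L (\<Sum>b\<in>Basis. ((z y - z x) \<bullet> b) *\<^sub>R E y b)) has_derivative
      (\<lambda>v. 0 + L (r' v) - L 0)) (at x)"
    by (intro has_derivative_diff has_derivative_add has_derivative_const
        bounded_linear.has_derivative[OF bL] r Ez)
  moreover have "z x + L (r y) - L (\<Sum>b\<in>Basis. ((z y - z x) \<bullet> b) *\<^sub>R E y b) = z y" if "y \<in> S" for y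
    using zE[OF that] linear_euclidean_expansion[OF Elin[OF that], of "z y - z x"] by (simp add: algebra_simps)
  ultimately have "(z has_derivative (\<lambda>v. L (r' v))) (at x)"
    using has_derivative_cong_open[OF S, of "\<lambda>y. z x + L (r y) - L (\<Sum>b\<in>Basis. ((z y - z x) \<bullet> b) *\<^sub>R E y b)" z]
      linear_0[OF L(1)] by simp
  then show ?thesis using GL unfolding r'_def by blast
qed

lemma Ck_on_linear_system:
  fixes G :: "'a::euclidean_space \<Rightarrow> 'b::euclidean_space \<Rightarrow> 'b"
  assumes S: "open S"
    and lin: "\<And>y. y \<in> S \<Longrightarrow> linear (G y)" and inj: "\<And>y. y \<in> S \<Longrightarrow> inj (G y)"
    and G: "\<And>w k. Ck_on k S (\<lambda>y. G y w)"
    and h: "Ck_on k S h"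
    and z: "\<And>y. y \<in> S \<Longrightarrow> G y (z y) = h y"
  shows "Ck_on k S z"
  using h z
proof (induction k arbitrary: h z)
  case 0
  have "isCont z x" if x: "x \<in> S" for x
  proof (rule isCont_linear_system[where G=G and S=S and h=h])
    show "isCont (\<lambda>y. G y w) x" for w
      using G[of 0 w] x continuous_on_eq_continuous_at[OF S, of "\<lambda>y. G y w"] by simp
    show "isCont h x" using 0(1) x continuous_on_eq_continuous_at[OF S, of h] by simp
  qed (use S x lin inj 0(2) in auto)
  then show ?case by (simp add: continuous_at_imp_continuous_on)
next
  case (Suc k)
  have "\<exists>z'. (z has_derivative z') (at x) \<and>
     (\<forall>v. G x (z' v) = frechet_derivative h (at x) v - frechet_derivative (\<lambda>y. G y (z x)) (at x) v)"
    if x: "x \<in> S" for x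
    by (rule has_derivative_linear_system[OF S x lin inj G Ck_on_SucD(1)[OF Suc.prems(1) x] Suc.prems(2)])
  then obtain z' where z': "\<And>x. x \<in> S \<Longrightarrow> (z has_derivative z' x) (at x)"
    "\<And>x v. x \<in> S \<Longrightarrow> G x (z' x v) = frechet_derivative h (at x) v - frechet_derivative (\<lambda>y. G y (z x)) (at x) v"
    by metis
  have Ck: "Ck_on k S z" by (rule Suc.IH[OF Ck_on_Suc_D[OF Suc.prems(1)] Suc.prems(2)])
  have eq: "frechet_derivative (\<lambda>y. G y (z x)) (at x) v =
      (\<Sum>b\<in>Basis. (z x \<bullet> b) *\<^sub>R frechet_derivative (\<lambda>y. G y b) (at x) v)" if x: "x \<in> S" for x v
  proof -
    have "((\<lambda>y. \<Sum>b\<in>Basis. (z x \<bullet> b) *\<^sub>R G y b) has_derivative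
        (\<lambda>v. \<Sum>b\<in>Basis. (z x \<bullet> b) *\<^sub>R frechet_derivative (\<lambda>y. G y b) (at x) v)) (at x)"
      by (intro has_derivative_sum bounded_linear.has_derivative[OF bounded_linear_scaleR_right]
          Ck_on_SucD(1)[OF G x])
    moreover have "(\<Sum>b\<in>Basis. (z x \<bullet> b) *\<^sub>R G y b) = G y (z x)" if "y \<in> S" for y
      using linear_euclidean_expansion[OF lin[OF that], of "z x"] by (rule sym)
    ultimately have "((\<lambda>y. G y (z x)) has_derivative
        (\<lambda>v. \<Sum>b\<in>Basis. (z x \<bullet> b) *\<^sub>R frechet_derivative (\<lambda>y. G y b) (at x) v)) (at x)"
      using has_derivative_cong_open[OF S x, of "\<lambda>y. \<Sum>b\<in>Basis. (z x \<bullet> b) *\<^sub>R G y b" "\<lambda>y. G y (z x)"] by blast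
    from frechet_derivative_at[OF this] show ?thesis by metis
  qed
  show ?case
  proof (rule Ck_on_SucI[OF S z'(1)])
    fix v
    \<comment> \<open>The right side of the system for \<open>z'\<close> involves only
      \<open>z\<close> and first derivatives of \<open>h\<close> and \<open>G\<close>, so the
      induction hypothesis applies to \<open>z'\<close> with this right side and the same
      matrix.\<close>
    have "Ck_on k S (\<lambda>x. frechet_derivative h (at x) v -
        (\<Sum>b\<in>Basis. (z x \<bullet> b) *\<^sub>R frechet_derivative (\<lambda>y. G y b) (at x) v))"
      unfolding diff_conv_add_uminus
      by (intro Ck_on_add S Ck_on_SucD(2)[OF Suc.prems(1)] Ck_on_sum Ck_on_SucD(2)[OF G]
          Ck_on_bounded_linear[where L=uminus] bounded_linear_minus bounded_linear_ident
          Ck_on_bilinear[OF _ bounded_bilinear_scaleR] Ck_on_bounded_linear[OF S bounded_linear_inner_left Ck])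
    then show "Ck_on k S (\<lambda>x. z' x v)"
      by (rule Suc.IH) (simp add: z'(2) eq)
  qed
qed

section \<open>Symmetry of second derivatives\<close>

lemma rectangle_mean_value:
  fixes f :: "'a::euclidean_space \<Rightarrow> real"
  assumes f: "\<And>y. y \<in> ball x e \<Longrightarrow> (f has_derivative f' y) (at y)"
    and f'': "\<And>y. y \<in> ball x e \<Longrightarrow> ((\<lambda>y. f' y v) has_derivative f'' y) (at y)"
    and t: "0 < t" "t * (norm v + norm w) < e"
  shows "\<exists>y. dist x y \<le> t * (norm v + norm w) \<and>
     f (x + t *\<^sub>R v + t *\<^sub>R w) - f (x + t *\<^sub>R v) - f (x + t *\<^sub>R w) + f x = t * t * f'' y w"
proof -
  have dist: "dist x (x + a *\<^sub>R v + b *\<^sub>R w) \<le> t * (norm v + norm w)"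
    if "0 \<le> a" "a \<le> t" "0 \<le> b" "b \<le> t" for a b
  proof -
    have "x - (x + a *\<^sub>R v + b *\<^sub>R w) = - (a *\<^sub>R v + b *\<^sub>R w)" by simp
    then have "dist x (x + a *\<^sub>R v + b *\<^sub>R w) = norm (a *\<^sub>R v + b *\<^sub>R w)"
      unfolding dist_norm by (simp only: norm_minus_cancel)
    also have "\<dots> \<le> a * norm v + b * norm w" using norm_triangle_ineq[of "a *\<^sub>R v" "b *\<^sub>R w"] that by simp
    also have "\<dots> \<le> t * (norm v + norm w)"
      using that by (simp add: distrib_left add_mono mult_right_mono)
    finally show ?thesis .
  qed
  then have ball: "x + a *\<^sub>R v + b *\<^sub>R w \<in> ball x e" if "0 \<le> a" "a \<le> t" "0 \<le> b" "b \<le> t" for a b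
    using that t by fastforce
  \<comment> \<open>The second difference over the parallelogram is the increment of
    \<open>k\<close>; the mean value theorem is applied along \<open>v\<close> and then, to the
    resulting derivative, along \<open>w\<close>.\<close>
  define k where "k a = f (x + a *\<^sub>R v + t *\<^sub>R w) - f (x + a *\<^sub>R v)" for a
  have lin: "linear (f' y)" if "y \<in> ball x e" for y using f[OF that] has_derivative_linear by blast
  have lin2: "linear (f'' y)" if "y \<in> ball x e" for y using f''[OF that] has_derivative_linear by blast
  have k': "(k has_real_derivative f' (x + a *\<^sub>R v + t *\<^sub>R w) v - f' (x + a *\<^sub>R v) v) (at a)" if "0 \<le> a" "a \<le> t" for a
  proof -
    have 1: "((\<lambda>a. x + a *\<^sub>R v + c) has_derivative (\<lambda>h. h *\<^sub>R v)) (at a)" for c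
      by (auto intro!: derivative_eq_intros)
    have "((\<lambda>a. f (x + a *\<^sub>R v + t *\<^sub>R w)) has_derivative (\<lambda>h. f' (x + a *\<^sub>R v + t *\<^sub>R w) (h *\<^sub>R v))) (at a)"
      by (rule has_derivative_compose[OF 1 f[OF ball]]) (use that t in auto)
    moreover have "((\<lambda>a. f (x + a *\<^sub>R v + 0)) has_derivative (\<lambda>h. f' (x + a *\<^sub>R v + 0) (h *\<^sub>R v))) (at a)"
      by (rule has_derivative_compose[OF 1 f]) (use ball[of a 0] that t in auto)
    ultimately have "(k has_derivative (\<lambda>h. f' (x + a *\<^sub>R v + t *\<^sub>R w) (h *\<^sub>R v) - f' (x + a *\<^sub>R v) (h *\<^sub>R v))) (at a)"
      unfolding k_def by (simp add: has_derivative_diff)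
    moreover have "f' (x + a *\<^sub>R v + t *\<^sub>R w) (h *\<^sub>R v) - f' (x + a *\<^sub>R v) (h *\<^sub>R v)
        = (f' (x + a *\<^sub>R v + t *\<^sub>R w) v - f' (x + a *\<^sub>R v) v) * h" for h
      using linear_scale[OF lin[OF ball[of a t]]] linear_scale[OF lin[OF ball[of a 0]]] that t
      by (simp add: algebra_simps)
    ultimately show ?thesis by (simp add: has_field_derivative_def)
  qed
  obtain a where a: "0 < a" "a < t" "k t - k 0 = t * (f' (x + a *\<^sub>R v + t *\<^sub>R w) v - f' (x + a *\<^sub>R v) v)"
    using MVT2[OF t(1) k'] by auto
  define l where "l b = f' (x + a *\<^sub>R v + b *\<^sub>R w) v" for b
  have l': "(l has_real_derivative f'' (x + a *\<^sub>R v + b *\<^sub>R w) w) (at b)" if "0 \<le> b" "b \<le> t" for b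
  proof -
    have 1: "((\<lambda>b. x + a *\<^sub>R v + b *\<^sub>R w) has_derivative (\<lambda>h. h *\<^sub>R w)) (at b)"
      by (auto intro!: derivative_eq_intros)
    have "(l has_derivative (\<lambda>h. f'' (x + a *\<^sub>R v + b *\<^sub>R w) (h *\<^sub>R w))) (at b)"
      unfolding l_def by (rule has_derivative_compose[OF 1 f''[OF ball]]) (use that a in auto)
    moreover have "f'' (x + a *\<^sub>R v + b *\<^sub>R w) (h *\<^sub>R w) = f'' (x + a *\<^sub>R v + b *\<^sub>R w) w * h" for h
      using linear_scale[OF lin2[OF ball[of a b]]] that a by simp
    ultimately show ?thesis by (simp add: has_field_derivative_def)
  qed
  obtain b where b: "0 < b" "b < t" "l t - l 0 = t * f'' (x + a *\<^sub>R v + b *\<^sub>R w) w"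
    using MVT2[OF t(1) l'] by auto
  have "f (x + t *\<^sub>R v + t *\<^sub>R w) - f (x + t *\<^sub>R v) - f (x + t *\<^sub>R w) + f x = k t - k 0"
    by (simp add: k_def)
  also have "\<dots> = t * t * f'' (x + a *\<^sub>R v + b *\<^sub>R w) w" using a(3) b(3) by (simp add: l_def)
  finally show ?thesis using dist[of a b] a b by (intro exI conjI) auto
qed

text \<open>The second difference over a parallelogram does not depend on the order of its two
  directions; as it shrinks, the two mean values tend to the two mixed derivatives.\<close>

lemma second_derivative_symmetric_real:
  fixes f :: "'a::euclidean_space \<Rightarrow> real"
  assumes S: "open S" "x \<in> S" and f: "Ck_on 2 S f"
  shows "frechet_derivative (\<lambda>y. frechet_derivative f (at y) v) (at x) w =
    frechet_derivative (\<lambda>y. frechet_derivative f (at y) w) (at x) v"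
proof -
  let ?G = "\<lambda>v w y. frechet_derivative (\<lambda>y. frechet_derivative f (at y) v) (at y) w"
  have f2: "Ck_on (Suc (Suc 0)) S f" using f by (simp only: numeral_2_eq_2)
  note f1 = Ck_on_SucD(2)[OF f2]
  have cont: "isCont (?G v w) x" for v w
    using Ck_on_SucD(2)[OF f1] S continuous_on_eq_continuous_at by (metis Ck_on.simps(1))
  obtain e where e: "e > 0" "ball x e \<subseteq> S" using S openE by blast
  let ?m = "norm v + norm w"
  have "\<bar>?G v w x - ?G w v x\<bar> \<le> 0 + \<epsilon>" if \<epsilon>: "\<epsilon> > 0" for \<epsilon>
  proof -
    obtain d1 where d1: "d1 > 0" "\<And>y. dist y x < d1 \<Longrightarrow> \<bar>?G v w y - ?G v w x\<bar> < \<epsilon> / 2"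
      using cont[of v w, unfolded continuous_at_eps_delta, rule_format, of "\<epsilon> / 2"] \<epsilon> by (auto simp: dist_real_def)
    obtain d2 where d2: "d2 > 0" "\<And>y. dist y x < d2 \<Longrightarrow> \<bar>?G w v y - ?G w v x\<bar> < \<epsilon> / 2"
      using cont[of w v, unfolded continuous_at_eps_delta, rule_format, of "\<epsilon> / 2"] \<epsilon> by (auto simp: dist_real_def)
    define d where "d = min e (min d1 d2)"
    \<comment> \<open>The summand 1 keeps the denominator positive when both directions are
      zero.\<close>
    define t where "t = d / (2 * (?m + 1))"
    have d: "d > 0" using e d1 d2 by (simp add: d_def)
    have m: "?m + 1 > 0" by (simp add: add_nonneg_pos)
    have t0: "t > 0" unfolding t_def using d m by simp
    have "t * ?m < t * (2 * (?m + 1))" using t0 by (intro mult_strict_left_mono) (auto simp: add_nonneg_pos)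
    also have "\<dots> = d" using m by (simp add: t_def)
    finally have tm: "t * ?m < d" .
    obtain y where y: "dist x y \<le> t * ?m"
      "f (x + t *\<^sub>R v + t *\<^sub>R w) - f (x + t *\<^sub>R v) - f (x + t *\<^sub>R w) + f x = t * t * ?G v w y"
      using rectangle_mean_value[of x e f "\<lambda>y. frechet_derivative f (at y)" v
          "\<lambda>y. frechet_derivative (\<lambda>y. frechet_derivative f (at y) v) (at y)" t w]
        Ck_on_SucD(1)[OF f2] Ck_on_SucD(1)[OF f1] e(2) t0 tm by (auto simp: d_def subset_iff)
    obtain z where z: "dist x z \<le> t * (norm w + norm v)"
      "f (x + t *\<^sub>R w + t *\<^sub>R v) - f (x + t *\<^sub>R w) - f (x + t *\<^sub>R v) + f x = t * t * ?G w v z"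
      using rectangle_mean_value[of x e f "\<lambda>y. frechet_derivative f (at y)" w
          "\<lambda>y. frechet_derivative (\<lambda>y. frechet_derivative f (at y) w) (at y)" t v]
        Ck_on_SucD(1)[OF f2] Ck_on_SucD(1)[OF f1] e(2) t0 tm by (auto simp: d_def subset_iff add.commute)
    have "x + t *\<^sub>R w + t *\<^sub>R v = x + t *\<^sub>R v + t *\<^sub>R w" by simp
    then have "t * t * ?G v w y = t * t * ?G w v z" using y(2) z(2) by (simp only:)
    then have "?G v w y = ?G w v z" using t0 by simp
    moreover have "\<bar>?G v w y - ?G v w x\<bar> < \<epsilon> / 2" using d1(2) y(1) tm by (simp add: d_def dist_commute)
    moreover have "\<bar>?G w v z - ?G w v x\<bar> < \<epsilon> / 2"
      using d2(2) z(1) tm by (simp add: d_def dist_commute add.commute)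
    ultimately show ?thesis by linarith
  qed
  then have "\<bar>?G v w x - ?G w v x\<bar> \<le> 0" by (rule field_le_epsilon)
  then show ?thesis by simp
qed

lemma second_derivative_symmetric:
  fixes f :: "'a::euclidean_space \<Rightarrow> 'b::euclidean_space"
  assumes S: "open S" "x \<in> S" and f: "Ck_on 2 S f"
  shows "frechet_derivative (\<lambda>y. frechet_derivative f (at y) v) (at x) w =
    frechet_derivative (\<lambda>y. frechet_derivative f (at y) w) (at x) v"
proof (rule euclidean_eqI)
  fix b :: 'b
  have f2: "Ck_on (Suc (Suc 0)) S f" using f by (simp only: numeral_2_eq_2)
  note f1 = Ck_on_SucD(2)[OF f2]
  have 1: "frechet_derivative (\<lambda>y. f y \<bullet> b) (at y) v = frechet_derivative f (at y) v \<bullet> b" if "y \<in> S" for y v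
    using frechet_derivative_at[OF bounded_linear.has_derivative[OF bounded_linear_inner_left Ck_on_SucD(1)[OF f2 that]]] by metis
  have 2: "frechet_derivative (\<lambda>y. frechet_derivative (\<lambda>y. f y \<bullet> b) (at y) v) (at x) w =
      frechet_derivative (\<lambda>y. frechet_derivative f (at y) v) (at x) w \<bullet> b" for v w
  proof -
    have "frechet_derivative (\<lambda>y. frechet_derivative (\<lambda>y. f y \<bullet> b) (at y) v) (at x) =
      frechet_derivative (\<lambda>y. frechet_derivative f (at y) v \<bullet> b) (at x)"
      by (rule frechet_derivative_cong_open[OF S 1])
    then show ?thesis
      using frechet_derivative_at[OF bounded_linear.has_derivative[OF bounded_linear_inner_left Ck_on_SucD(1)[OF f1 S(2)]]] by metis
  qed
  have "Ck_on 2 S (\<lambda>y. f y \<bullet> b)"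
    by (rule Ck_on_bounded_linear[OF S(1) bounded_linear_inner_left f])
  from second_derivative_symmetric_real[OF S this, of v w]
  show "frechet_derivative (\<lambda>y. frechet_derivative f (at y) v) (at x) w \<bullet> b =
    frechet_derivative (\<lambda>y. frechet_derivative f (at y) w) (at x) v \<bullet> b" unfolding 2 .
qed

section \<open>The Poincare lemma on a convex set\<close>

lemma closed_form_primitive:
  fixes \<theta> :: "'a::euclidean_space \<Rightarrow> 'a \<Rightarrow> real"
  assumes S: "open S" "convex S" "c \<in> S"
    and lin: "\<And>y. y \<in> S \<Longrightarrow> linear (\<theta> y)"
    and \<theta>: "\<And>v. Ck_on 1 S (\<lambda>y. \<theta> y v)"
    and closed: "\<And>y v w. y \<in> S \<Longrightarrow> frechet_derivative (\<lambda>y. \<theta> y v) (at y) w = frechet_derivative (\<lambda>y. \<theta> y w) (at y) v"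
  shows "\<exists>\<phi>. \<forall>y\<in>S. (\<phi> has_derivative \<theta> y) (at y)"
proof -
  let ?D = "\<lambda>v y. frechet_derivative (\<lambda>y. \<theta> y v) (at y)"
  let ?z = "\<lambda>y t. c + t *\<^sub>R (y - c)"
  have \<theta>1: "Ck_on (Suc 0) S (\<lambda>y. \<theta> y v)" for v using \<theta> by simp
  have D: "((\<lambda>y. \<theta> y v) has_derivative ?D v y) (at y)" if "y \<in> S" for v y
    by (rule Ck_on_SucD(1)[OF \<theta>1 that])
  have Dlin: "linear (?D v y)" if "y \<in> S" for v y using D[OF that] has_derivative_linear by blast
  have contD: "continuous_on S (\<lambda>y. ?D v y w)" for v w
    using Ck_on_SucD(2)[OF \<theta>1[of v], of w] by simp
  have cont\<theta>: "continuous_on S (\<lambda>y. \<theta> y v)" for v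
    using Ck_on_Suc_D[OF \<theta>1[of v]] by simp
  have zS: "?z y t \<in> S" if "y \<in> S" "t \<in> {0..1}" for y t
  proof -
    have "(1 - t) *\<^sub>R c + t *\<^sub>R y \<in> S" using convexD[OF S(2) S(3) that(1), of "1 - t" t] that(2) by simp
    then show ?thesis by (simp add: algebra_simps)
  qed
  \<comment> \<open>The primitive will be the integral of \<theta> along the segment from
    \<open>c\<close> to \<open>y\<close>. The integrand is written in components because
    differentiability is given for the values of \<theta> on fixed vectors.\<close>
  define f where "f y t = (\<Sum>b\<in>Basis. ((y - c) \<bullet> b) * \<theta> (?z y t) b)" for y t
  define f' where "f' y t = (\<Sum>b\<in>Basis. \<theta> (?z y t) b *\<^sub>R blinfun_inner_left b
      + ((y - c) \<bullet> b) *\<^sub>R t *\<^sub>R (\<Sum>d\<in>Basis. ?D b (?z y t) d *\<^sub>R blinfun_inner_left d))" for y t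
  have f'_apply: "blinfun_apply (f' y t) v = \<theta> (?z y t) v + t * ?D v (?z y t) (y - c)"
    if "y \<in> S" "t \<in> {0..1}" for y t v
  proof -
    note z = zS[OF that]
    have "blinfun_apply (f' y t) v = (\<Sum>b\<in>Basis. \<theta> (?z y t) b * (v \<bullet> b)
        + ((y - c) \<bullet> b) * (t * (\<Sum>d\<in>Basis. ?D b (?z y t) d * (v \<bullet> d))))"
      by (simp add: f'_def blinfun.sum_left blinfun.add_left blinfun.scaleR_left mult.assoc)
    \<comment> \<open>Closedness exchanges \<open>b\<close> and \<open>v\<close>, so that the
      derivative is taken along the segment.\<close>
    also have "\<dots> = (\<Sum>b\<in>Basis. \<theta> (?z y t) b * (v \<bullet> b) + ((y - c) \<bullet> b) * (t * ?D v (?z y t) b))"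
    proof -
      have "(\<Sum>d\<in>Basis. ?D b (?z y t) d * (v \<bullet> d)) = ?D v (?z y t) b" for b
        using linear_euclidean_expansion[OF Dlin[OF z], of b v] closed[OF z, of b v] by (simp add: mult.commute)
      then show ?thesis by simp
    qed
    also have "\<dots> = \<theta> (?z y t) v + t * (\<Sum>b\<in>Basis. ((y - c) \<bullet> b) * ?D v (?z y t) b)"
      using linear_euclidean_expansion[OF lin[OF z], of v]
      by (simp add: sum.distrib sum_distrib_left mult.commute mult.left_commute)
    also have "\<dots> = \<theta> (?z y t) v + t * ?D v (?z y t) (y - c)"
      using linear_euclidean_expansion[OF Dlin[OF z], of v "y - c"] by simp
    finally show ?thesis .
  qed
  have zc: "continuous_on (S \<times> {0..1}) (\<lambda>(y, t). ?z y t)"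
    unfolding split_beta by (intro continuous_intros)
  have cD: "continuous_on (S \<times> {0..1}) (\<lambda>(y, t). ?D v (?z y t) w)" for v w
    using continuous_on_compose2[OF contD[of v w] zc] zS by (fastforce simp: split_beta image_subset_iff)
  have c\<theta>: "continuous_on (S \<times> {0..1}) (\<lambda>(y, t). \<theta> (?z y t) v)" for v
    using continuous_on_compose2[OF cont\<theta>[of v] zc] zS by (fastforce simp: split_beta image_subset_iff)
  have cf': "continuous_on (S \<times> {0..1}) (\<lambda>(y, t). f' y t)"
    using cD c\<theta> unfolding f'_def split_beta by (intro continuous_intros) auto
  define \<phi> where "\<phi> y = integral {0..1} (f y)" for y
  have "(\<phi> has_derivative \<theta> y) (at y)" if y: "y \<in> S" for y
  proof -
    have fd: "((\<lambda>y. f y t) has_derivative blinfun_apply (f' y t)) (at y within S)"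
      if "y \<in> S" "t \<in> cbox 0 1" for y t
    proof -
      have t: "t \<in> {0..1}" using that by simp
      have z': "((\<lambda>y. ?z y t) has_derivative (\<lambda>v. t *\<^sub>R v)) (at y)"
        by (auto intro!: derivative_eq_intros)
      have \<theta>z: "((\<lambda>y. \<theta> (?z y t) b) has_derivative (\<lambda>v. ?D b (?z y t) (t *\<^sub>R v))) (at y)" for b
        by (rule has_derivative_compose[OF z' D[OF zS[OF that(1) t]]])
      have eq: "(f' y t) v = (\<Sum>b\<in>Basis. ((y - c) \<bullet> b) * ?D b (?z y t) (t *\<^sub>R v) + (v \<bullet> b) * \<theta> (?z y t) b)" for v
      proof -
        have "(\<Sum>d\<in>Basis. ?D b (?z y t) d * (v \<bullet> d)) = ?D b (?z y t) v" for b
          using linear_euclidean_expansion[OF Dlin[OF zS[OF that(1) t]], of b v] by (simp add: mult.commute)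
        then show ?thesis
          using linear_scale[OF Dlin[OF zS[OF that(1) t]]]
          by (simp add: f'_def blinfun.sum_left blinfun.add_left blinfun.scaleR_left mult_ac add.commute)
      qed
      have "((\<lambda>y. f y t) has_derivative
          (\<lambda>v. \<Sum>b\<in>Basis. ((y - c) \<bullet> b) * ?D b (?z y t) (t *\<^sub>R v) + (v \<bullet> b) * \<theta> (?z y t) b)) (at y)"
        unfolding f_def
        by (intro has_derivative_sum has_derivative_mult[OF _ \<theta>z]) (auto intro!: derivative_eq_intros)
      then have "((\<lambda>y. f y t) has_derivative (\<lambda>v. f' y t v)) (at y)" unfolding eq .
      then show ?thesis by (rule has_derivative_at_withinI)
    qed
    have int: "f y integrable_on cbox 0 1" if "y \<in> S" for y
    proof -
      have "continuous_on {0..1} (\<lambda>t. \<theta> (?z y t) b)" for b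
        by (rule continuous_on_compose2[OF cont\<theta>[of b]]) (use zS[OF that] in \<open>auto intro!: continuous_intros\<close>)
      then have "continuous_on {0..1} (f y)"
        unfolding f_def by (intro continuous_intros)
      then show ?thesis using integrable_continuous_real by (simp add: cbox_interval)
    qed
    have "((\<lambda>y. integral (cbox 0 1) (f y)) has_derivative blinfun_apply (integral (cbox 0 1) (f' y))) (at y within S)"
      by (rule leibniz_rule[OF fd int _ y S(2)]) (use cf' in \<open>simp_all add: cbox_interval\<close>)
    then have d: "(\<phi> has_derivative blinfun_apply (integral {0..1} (f' y))) (at y)"
      using at_within_open[OF y S(1)] by (simp add: \<phi>_def[abs_def] cbox_interval)
    have f'int: "f' y integrable_on {0..1}"
    proof (rule integrable_continuous_real)
      show "continuous_on {0..1} (f' y)"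
        using continuous_on_compose2[OF cf', of "{0..1}" "\<lambda>t. (y, t)"] y
        by (force intro!: continuous_intros)
    qed
    have "blinfun_apply (integral {0..1} (f' y)) v = \<theta> y v" for v
    proof -
      have "blinfun_apply (integral {0..1} (f' y)) v = integral {0..1} (\<lambda>t. blinfun_apply (f' y t) v)"
        using blinfun_apply_integral[OF f'int] by simp
      \<comment> \<open>By \<open>f'_apply\<close> the integrand is the derivative of
        \<open>t * \<theta> (?z y t) v\<close> with respect to \<open>t\<close>.\<close>
      moreover have "((\<lambda>t. blinfun_apply (f' y t) v) has_integral (1 * \<theta> (?z y 1) v - 0 * \<theta> (?z y 0) v)) {0..1}"
      proof (rule fundamental_theorem_of_calculus)
        fix t :: real assume t: "t \<in> {0..1}"
        have z': "((\<lambda>t. ?z y t) has_derivative (\<lambda>h. h *\<^sub>R (y - c))) (at t)"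
          by (auto intro!: derivative_eq_intros)
        have "((\<lambda>t. \<theta> (?z y t) v) has_derivative (\<lambda>h. ?D v (?z y t) (h *\<^sub>R (y - c)))) (at t)"
          by (rule has_derivative_compose[OF z' D[OF zS[OF y t]]])
        then have "((\<lambda>t. t * \<theta> (?z y t) v) has_derivative
            (\<lambda>h. t * ?D v (?z y t) (h *\<^sub>R (y - c)) + h * \<theta> (?z y t) v)) (at t)"
          by (rule has_derivative_mult[OF has_derivative_ident])
        moreover have "t * ?D v (?z y t) (h *\<^sub>R (y - c)) + h * \<theta> (?z y t) v = h *\<^sub>R blinfun_apply (f' y t) v" for h
          unfolding linear_scale[OF Dlin[OF zS[OF y t]]] f'_apply[OF y t] by (simp add: distrib_left mult.left_commute)
        ultimately show "((\<lambda>t. t * \<theta> (?z y t) v) has_vector_derivative blinfun_apply (f' y t) v) (at t within {0..1})"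
          unfolding has_vector_derivative_def by (simp add: has_derivative_at_withinI)
      qed simp
      ultimately show ?thesis by (simp add: integral_unique)
    qed
    then have "blinfun_apply (integral {0..1} (f' y)) = \<theta> y" by (rule ext)
    then show ?thesis using d by simp
  qed
  then show ?thesis by blast
qed

section \<open>Smooth functions on open sets\<close>

lemma smooth_on_Ck: "smooth_on S f \<Longrightarrow> Ck_on k S f" by (simp add: smooth_on_def)

lemma smooth_on_cong: "open S \<Longrightarrow> (\<And>x. x \<in> S \<Longrightarrow> f x = g x) \<Longrightarrow> smooth_on S f \<longleftrightarrow> smooth_on S g"
  unfolding smooth_on_def using Ck_on_cong by blast

lemma smooth_on_subset: "smooth_on S f \<Longrightarrow> T \<subseteq> S \<Longrightarrow> smooth_on T f"
  unfolding smooth_on_def using Ck_on_subset by blast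

lemma smooth_on_local:
  assumes "\<And>x. x \<in> S \<Longrightarrow> \<exists>T. open T \<and> x \<in> T \<and> smooth_on T f"
  shows "smooth_on S f"
  unfolding smooth_on_def using assms Ck_on_local unfolding smooth_on_def by metis

lemma smooth_on_has_derivative:
  "smooth_on S f \<Longrightarrow> x \<in> S \<Longrightarrow> (f has_derivative frechet_derivative f (at x)) (at x)"
  using Ck_on_SucD(1)[OF smooth_on_Ck] .

lemma smooth_on_linear_derivative:
  "smooth_on S f \<Longrightarrow> x \<in> S \<Longrightarrow> linear (frechet_derivative f (at x))"
  using smooth_on_has_derivative has_derivative_linear by blast

lemma smooth_on_derivative: "smooth_on S f \<Longrightarrow> smooth_on S (\<lambda>x. frechet_derivative f (at x) v)"
  unfolding smooth_on_def using Ck_on_SucD(2) by blast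

lemma smooth_on_const: "smooth_on S (\<lambda>x. c)"
  unfolding smooth_on_def using Ck_on_const by blast

lemma smooth_on_bounded_linear: "open S \<Longrightarrow> bounded_linear L \<Longrightarrow> smooth_on S f \<Longrightarrow> smooth_on S (\<lambda>x. L (f x))"
  unfolding smooth_on_def using Ck_on_bounded_linear by blast

lemma smooth_on_add:
  assumes "open S" "smooth_on S f" "smooth_on S g"
  shows "smooth_on S (\<lambda>x. f x + g x)"
  unfolding smooth_on_def by (intro allI Ck_on_add smooth_on_Ck assms)

lemma smooth_on_scaleR:
  assumes "open S" "smooth_on S f" "smooth_on S g"
  shows "smooth_on S (\<lambda>x. f x *\<^sub>R g x)"
  unfolding smooth_on_def by (intro allI Ck_on_bilinear[OF _ bounded_bilinear_scaleR] smooth_on_Ck assms)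

lemma smooth_on_mult:
  assumes "open S" "smooth_on S f" "smooth_on S g"
  shows "smooth_on S (\<lambda>x. f x * g x :: real)"
  unfolding smooth_on_def by (intro allI Ck_on_bilinear[OF _ bounded_bilinear_mult] smooth_on_Ck assms)

lemma smooth_on_sum:
  assumes "open S" "\<And>i. i \<in> A \<Longrightarrow> smooth_on S (f i)"
  shows "smooth_on S (\<lambda>x. \<Sum>i\<in>A. f i x)"
  unfolding smooth_on_def by (intro allI Ck_on_sum smooth_on_Ck assms)

lemma smooth_on_compose:
  assumes "open S" "open T" "g ` S \<subseteq> T" "smooth_on S g" "smooth_on T f"
  shows "smooth_on S (\<lambda>x. f (g x))"
  unfolding smooth_on_def
  by (rule allI, rule Ck_on_compose[OF assms(1-3) smooth_on_Ck[OF assms(4)] smooth_on_Ck[OF assms(5)]])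

lemma smooth_on_exp:
  assumes "open S" "smooth_on S f" shows "smooth_on S (\<lambda>x. exp (f x :: real))"
proof (rule smooth_on_compose[where T=UNIV and g=f and f=exp])
  show "smooth_on UNIV (exp :: real \<Rightarrow> real)" unfolding smooth_on_def using Ck_on_exp[OF open_UNIV] by (rule allI)
qed (rule assms open_UNIV subset_UNIV)+

lemma smooth_on_inverse:
  assumes "open S" "smooth_on S f" "\<And>x. x \<in> S \<Longrightarrow> f x \<noteq> 0"
  shows "smooth_on S (\<lambda>x. inverse (f x :: real))"
proof (rule smooth_on_compose[where T="- {0}" and g=f and f=inverse])
  have o: "open (- {0 :: real})" by (rule open_Compl[OF closed_singleton])
  show "smooth_on (- {0}) (inverse :: real \<Rightarrow> real)"
    unfolding smooth_on_def by (rule allI, rule Ck_on_inverse[OF o]) blast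
  show "open (- {0 :: real})" by (fact o)
  show "f ` S \<subseteq> - {0}" using assms(3) by auto
qed (rule assms)+

lemma smooth_on_derivative_along:
  assumes "open S" "smooth_on S f" "smooth_on S u"
  shows "smooth_on S (\<lambda>x. frechet_derivative f (at x) (u x))"
proof -
  have "smooth_on S (\<lambda>x. \<Sum>b\<in>Basis. (u x \<bullet> b) *\<^sub>R frechet_derivative f (at x) b)"
    by (intro smooth_on_sum smooth_on_scaleR smooth_on_derivative smooth_on_bounded_linear[OF _ bounded_linear_inner_left] assms)
  moreover have "(\<Sum>b\<in>Basis. (u x \<bullet> b) *\<^sub>R frechet_derivative f (at x) b) = frechet_derivative f (at x) (u x)"
    if "x \<in> S" for x
    using linear_euclidean_expansion[OF smooth_on_linear_derivative[OF assms(2) that]] by metis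
  ultimately show ?thesis using smooth_on_cong[OF assms(1)] by (metis (no_types, lifting))
qed

lemma smooth_on_linear_system:
  fixes G :: "'a::euclidean_space \<Rightarrow> 'b::euclidean_space \<Rightarrow> 'b"
  assumes "open S" "\<And>y. y \<in> S \<Longrightarrow> linear (G y)" "\<And>y. y \<in> S \<Longrightarrow> inj (G y)"
    "\<And>w. smooth_on S (\<lambda>y. G y w)" "smooth_on S h" "\<And>y. y \<in> S \<Longrightarrow> G y (z y) = h y"
  shows "smooth_on S z"
  unfolding smooth_on_def
  using Ck_on_linear_system[OF assms(1-3) smooth_on_Ck[OF assms(4)] smooth_on_Ck[OF assms(5)] assms(6)] by blast

lemma smooth_on_primitive:
  assumes "open S" "\<And>x. x \<in> S \<Longrightarrow> (f has_derivative f' x) (at x)" "\<And>v. smooth_on S (\<lambda>x. f' x v)"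
  shows "smooth_on S f"
  unfolding smooth_on_def using Ck_on_SucI[OF assms(1,2) smooth_on_Ck[OF assms(3)]] Ck_on_Suc_D by blast

section \<open>Gluing local primitives\<close>

text \<open>The condition \<open>compatible\<close> says that two local primitives differ by a
  locally constant function. Nothing is said about differentiation, so the gluing is purely
  topological.\<close>

locale local_primitives =
  fixes P :: "('m::topological_space set \<times> ('m \<Rightarrow> real)) set"
  assumes open_domain: "(U, f) \<in> P \<Longrightarrow> open U"
    and covers: "\<exists>U f. (U, f) \<in> P \<and> x \<in> U"
    and compatible: "(U, f) \<in> P \<Longrightarrow> (V, g) \<in> P \<Longrightarrow> x \<in> U \<Longrightarrow> x \<in> V \<Longrightarrow>
      \<exists>W. open W \<and> x \<in> W \<and> W \<subseteq> U \<inter> V \<and> (\<forall>y\<in>W. f y - f x = g y - g x)"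
begin

text \<open>\<open>F\<close> is a primitive, along \<gamma>, of the closed form that the local
  primitives represent. Only differences of \<open>F\<close> are prescribed, so \<open>F\<close> is
  free up to a constant and needs no base point.\<close>

definition lifts :: "'k::topological_space set \<Rightarrow> ('k \<Rightarrow> 'm) \<Rightarrow> ('k \<Rightarrow> real) \<Rightarrow> bool" where
  "lifts K \<gamma> F \<longleftrightarrow> continuous_on K \<gamma> \<and> (\<forall>k\<in>K. \<exists>U f N. (U, f) \<in> P \<and> open N \<and> k \<in> N \<and>
     (\<forall>l\<in>N \<inter> K. \<gamma> l \<in> U \<and> F l - F k = f (\<gamma> l) - f (\<gamma> k)))"

text \<open>Compatibility allows any local primitive around \<open>\<gamma> k\<close> in place of
  the one that the definition provides.\<close>

lemma liftsD:
  assumes "lifts K \<gamma> F" "k \<in> K" "(U, f) \<in> P" "\<gamma> k \<in> U"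
  shows "\<exists>N. open N \<and> k \<in> N \<and> (\<forall>l\<in>N \<inter> K. \<gamma> l \<in> U \<and> F l - F k = f (\<gamma> l) - f (\<gamma> k))"
proof -
  obtain V g N where V: "(V, g) \<in> P" "open N" "k \<in> N"
    "\<And>l. l \<in> N \<inter> K \<Longrightarrow> \<gamma> l \<in> V \<and> F l - F k = g (\<gamma> l) - g (\<gamma> k)"
    using assms(1,2) unfolding lifts_def by blast
  obtain W where W: "open W" "\<gamma> k \<in> W" "W \<subseteq> U \<inter> V" "\<And>y. y \<in> W \<Longrightarrow> f y - f (\<gamma> k) = g y - g (\<gamma> k)"
    using compatible[OF assms(3) V(1) assms(4)] V(4)[of k] V(3) assms(2) by blast
  obtain A where A: "open A" "A \<inter> K = \<gamma> -` W \<inter> K"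
    using assms(1) W(1) unfolding lifts_def continuous_on_open_invariant by blast
  show ?thesis
  proof (intro exI[of _ "A \<inter> N"] conjI ballI)
    show "open (A \<inter> N)" using A V by blast
    show "k \<in> A \<inter> N" using A(2) W(2) assms(2) V(3) by blast
    fix l assume l: "l \<in> A \<inter> N \<inter> K"
    then have lW: "\<gamma> l \<in> W" using A(2) by blast
    then show "\<gamma> l \<in> U" using W(3) by blast
    show "F l - F k = f (\<gamma> l) - f (\<gamma> k)" using V(4)[of l] W(4)[OF lW] l by simp
  qed
qed

lemma liftsE:
  assumes "lifts K \<gamma> F" "k \<in> K"
  obtains U f N where "(U, f) \<in> P" "open N" "k \<in> N" "\<And>l. l \<in> N \<Longrightarrow> l \<in> K \<Longrightarrow> \<gamma> l \<in> U"
    "\<And>l. l \<in> N \<Longrightarrow> l \<in> K \<Longrightarrow> F l - F k = f (\<gamma> l) - f (\<gamma> k)"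
  using assms unfolding lifts_def by (metis IntI)

lemma liftsI:
  assumes "continuous_on K \<gamma>"
    and "\<And>k. k \<in> K \<Longrightarrow> \<exists>U f N. (U, f) \<in> P \<and> open N \<and> k \<in> N \<and>
      (\<forall>l. l \<in> N \<longrightarrow> l \<in> K \<longrightarrow> \<gamma> l \<in> U \<and> F l - F k = f (\<gamma> l) - f (\<gamma> k))"
  shows "lifts K \<gamma> F"
  unfolding lifts_def
proof (intro conjI ballI)
  fix k assume "k \<in> K"
  from assms(2)[OF this] show "\<exists>U f N. (U, f) \<in> P \<and> open N \<and> k \<in> N \<and>
     (\<forall>l\<in>N \<inter> K. \<gamma> l \<in> U \<and> F l - F k = f (\<gamma> l) - f (\<gamma> k))"
    by (elim exE conjE, intro exI conjI) (assumption+, simp)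
qed (rule assms(1))

lemma lifts_continuous: "lifts K \<gamma> F \<Longrightarrow> continuous_on K \<gamma>"
  by (simp add: lifts_def)

lemma lifts_compose:
  assumes F: "lifts K \<gamma> F" and u: "continuous_on L u" "u ` L \<subseteq> K" and eq: "\<And>l. l \<in> L \<Longrightarrow> \<gamma> (u l) = \<delta> l"
  shows "lifts L \<delta> (\<lambda>l. F (u l))"
proof (rule liftsI)
  have "continuous_on L (\<lambda>l. \<gamma> (u l))"
    by (rule continuous_on_compose2[OF lifts_continuous[OF F] u])
  then show "continuous_on L \<delta>" by (rule continuous_on_eq) (rule eq)
  fix k assume k: "k \<in> L"
  have uK: "u l \<in> K" if "l \<in> L" for l using u(2) that by blast
  from F uK[OF k] obtain U f N where U: "(U, f) \<in> P" "open N" "u k \<in> N"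
    "\<And>l. l \<in> N \<Longrightarrow> l \<in> K \<Longrightarrow> \<gamma> l \<in> U"
    "\<And>l. l \<in> N \<Longrightarrow> l \<in> K \<Longrightarrow> F l - F (u k) = f (\<gamma> l) - f (\<gamma> (u k))"
    by (rule liftsE) (rule that)
  obtain A where A: "open A" "A \<inter> L = u -` N \<inter> L"
    using u(1) U(2) unfolding continuous_on_open_invariant by auto
  have uN: "u l \<in> N" if "l \<in> A" "l \<in> L" for l using A(2) that by auto
  have kA: "k \<in> A" using A(2) k U(3) by auto
  have "\<delta> l \<in> U \<and> F (u l) - F (u k) = f (\<delta> l) - f (\<delta> k)" if "l \<in> A" "l \<in> L" for l
    using U(4,5)[OF uN[OF that] uK[OF that(2)]] eq[OF that(2)] eq[OF k] by simp
  with U(1) A(1) kA show "\<exists>U f N. (U, f) \<in> P \<and> open N \<and> k \<in> N \<and>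
     (\<forall>l. l \<in> N \<longrightarrow> l \<in> L \<longrightarrow> \<delta> l \<in> U \<and> F (u l) - F (u k) = f (\<delta> l) - f (\<delta> k))"
    by metis
qed

lemma lifts_subset:
  assumes "lifts K \<gamma> F" "L \<subseteq> K" shows "lifts L \<gamma> F"
  by (rule lifts_compose[where u="\<lambda>l. l" and F=F and \<gamma>=\<gamma>, OF assms(1)]) (use assms(2) in auto)

lemma lifts_unique:
  assumes "lifts K \<gamma> F" "lifts K \<gamma> G" "connected K" "k \<in> K" "l \<in> K"
  shows "F k - G k = F l - G l"
proof (rule connected_local_const[OF assms(3-5)], intro ballI)
  fix k assume k: "k \<in> K"
  obtain U f where U: "(U, f) \<in> P" "\<gamma> k \<in> U" using covers by blast
  obtain N where N: "open N" "k \<in> N" "\<And>l. l \<in> N \<inter> K \<Longrightarrow> \<gamma> l \<in> U \<and> F l - F k = f (\<gamma> l) - f (\<gamma> k)"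
    using liftsD[OF assms(1) k U] by blast
  obtain N' where N': "open N'" "k \<in> N'" "\<And>l. l \<in> N' \<inter> K \<Longrightarrow> \<gamma> l \<in> U \<and> G l - G k = f (\<gamma> l) - f (\<gamma> k)"
    using liftsD[OF assms(2) k U] by blast
  have "F k - G k = F l - G l" if "l \<in> N \<inter> N'" "l \<in> K" for l
    using N(3)[of l] N'(3)[of l] that by simp
  then show "\<forall>\<^sub>F b in at k within K. F k - G k = F b - G b"
    unfolding eventually_at_topological using N(1,2) N'(1,2) by (intro exI[of _ "N \<inter> N'"]) auto
qed

lemma lifts_shift: "lifts K \<gamma> F \<Longrightarrow> lifts K \<gamma> (\<lambda>k. F k + c)"
  unfolding lifts_def by simp

text \<open>On the connected overlap the two functions differ by a constant, by which one of them is
  shifted. Closedness provides, around a point outside one piece, a neighbourhood that misses this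
  piece.\<close>

lemma lifts_glue:
  assumes F: "lifts A \<gamma> F" and G: "lifts B \<gamma> G" and closed: "closed A" "closed B"
    and conn: "connected (A \<inter> B)"
  shows "\<exists>H. lifts (A \<union> B) \<gamma> H"
proof -
  obtain c where c: "\<And>k. k \<in> A \<inter> B \<Longrightarrow> F k = G k + c"
  proof (cases "A \<inter> B = {}")
    case False
    then obtain k0 where k0: "k0 \<in> A \<inter> B" by blast
    have "F k = G k + (F k0 - G k0)" if "k \<in> A \<inter> B" for k
      using lifts_unique[OF lifts_subset[OF F] lifts_subset[OF G] conn that k0] by simp
    then show ?thesis using that by blast
  qed (use that in blast)
  define G' where "G' k = G k + c" for k
  have G': "lifts B \<gamma> G'" unfolding G'_def by (rule lifts_shift[OF G])
  define H where "H k = (if k \<in> A then F k else G' k)" for k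
  have HA: "H k = F k" if "k \<in> A" for k using that by (simp add: H_def)
  have HB: "H k = G' k" if "k \<in> B" for k using that c by (simp add: H_def G'_def)
  have "lifts (A \<union> B) \<gamma> H"
    unfolding lifts_def
  proof (intro conjI ballI)
    show "continuous_on (A \<union> B) \<gamma>"
      using F G closed unfolding lifts_def by (blast intro: continuous_on_closed_Un)
    fix k assume k: "k \<in> A \<union> B"
    obtain U f where U: "(U, f) \<in> P" "\<gamma> k \<in> U" using covers by blast
    have "\<exists>N. open N \<and> k \<in> N \<and> (\<forall>l\<in>N \<inter> A. \<gamma> l \<in> U \<and> H l - H k = f (\<gamma> l) - f (\<gamma> k))"
    proof (cases "k \<in> A")
      case True
      then obtain N where N: "open N" "k \<in> N" "\<forall>l\<in>N \<inter> A. \<gamma> l \<in> U \<and> F l - F k = f (\<gamma> l) - f (\<gamma> k)"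
        using liftsD[OF F True U] by blast
      then have "\<forall>l\<in>N \<inter> A. \<gamma> l \<in> U \<and> H l - H k = f (\<gamma> l) - f (\<gamma> k)" using HA True by simp
      then show ?thesis using N by blast
    next
      case False
      then show ?thesis using closed(1) by (intro exI[of _ "- A"]) auto
    qed
    then obtain N where N: "open N" "k \<in> N" "\<And>l. l \<in> N \<inter> A \<Longrightarrow> \<gamma> l \<in> U \<and> H l - H k = f (\<gamma> l) - f (\<gamma> k)"
      by blast
    have "\<exists>N. open N \<and> k \<in> N \<and> (\<forall>l\<in>N \<inter> B. \<gamma> l \<in> U \<and> H l - H k = f (\<gamma> l) - f (\<gamma> k))"
    proof (cases "k \<in> B")
      case True
      then obtain N where N: "open N" "k \<in> N" "\<forall>l\<in>N \<inter> B. \<gamma> l \<in> U \<and> G' l - G' k = f (\<gamma> l) - f (\<gamma> k)"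
        using liftsD[OF G' True U] by blast
      then have "\<forall>l\<in>N \<inter> B. \<gamma> l \<in> U \<and> H l - H k = f (\<gamma> l) - f (\<gamma> k)" using HB True by simp
      then show ?thesis using N by blast
    next
      case False
      then show ?thesis using closed(2) by (intro exI[of _ "- B"]) auto
    qed
    then obtain N' where N': "open N'" "k \<in> N'" "\<And>l. l \<in> N' \<inter> B \<Longrightarrow> \<gamma> l \<in> U \<and> H l - H k = f (\<gamma> l) - f (\<gamma> k)"
      by blast
    have "\<forall>l\<in>N \<inter> N' \<inter> (A \<union> B). \<gamma> l \<in> U \<and> H l - H k = f (\<gamma> l) - f (\<gamma> k)"
      using N(3) N'(3) by blast
    then show "\<exists>U f N. (U, f) \<in> P \<and> open N \<and> k \<in> N \<and> (\<forall>l\<in>N \<inter> (A \<union> B). \<gamma> l \<in> U \<and> H l - H k = f (\<gamma> l) - f (\<gamma> k))"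
      using U(1) open_Int[OF N(1) N'(1)] N(2) N'(2) by blast
  qed
  then show ?thesis by blast
qed

lemma lifts_domain:
  assumes "(U, f) \<in> P" "continuous_on K \<gamma>" "\<gamma> ` K \<subseteq> U"
  shows "lifts K \<gamma> (\<lambda>k. f (\<gamma> k))"
  unfolding lifts_def using assms by (intro conjI ballI exI[of _ U] exI[of _ f] exI[of _ UNIV]) auto

lemma lifts_local:
  assumes "continuous_on K \<gamma>" "k \<in> K"
  shows "\<exists>N F. open N \<and> k \<in> N \<and> lifts (K \<inter> N) \<gamma> F"
proof -
  obtain U f where U: "(U, f) \<in> P" "\<gamma> k \<in> U" using covers by blast
  obtain N where N: "open N" "N \<inter> K = \<gamma> -` U \<inter> K"
    using assms(1) open_domain[OF U(1)] unfolding continuous_on_open_invariant by blast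
  have "lifts (K \<inter> N) \<gamma> (\<lambda>k. f (\<gamma> k))"
    by (rule lifts_domain[OF U(1)]) (use N(2) in \<open>auto intro: continuous_on_subset[OF assms(1)]\<close>)
  then show ?thesis using N U(2) assms(2) by blast
qed

text \<open>Small rectangles have lifts because they are mapped into the domain of one local
  primitive. \<open>Bolzano\<close> is used twice: around a fixed \<open>s\<close> it stacks
  rectangles into a thin strip, whose width depends on \<open>s\<close>, and then it joins
  strips.\<close>

lemma lifts_square:
  fixes \<gamma> :: "real \<times> real \<Rightarrow> 'm"
  assumes cont: "continuous_on ({0..1} \<times> {0..1}) \<gamma>"
  shows "\<exists>F. lifts ({0..1} \<times> {0..1}) \<gamma> F"
proof -
  \<comment> \<open>The intervals supplied by \<open>Bolzano\<close> may leave [0,1], hence the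
    intersection with the square. All overlaps are again of this form, so they are convex and
    thereby connected.\<close>
  define R where "R a b c d = ({0..1} \<times> {0..1}) \<inter> ({a..b} \<times> {c..d})" for a b c d :: real
  have R: "closed (R a b c d)" "connected (R a b c d)" for a b c d
    unfolding R_def
    by (intro closed_Int closed_Times closed_atLeastAtMost,
        intro convex_connected convex_Int convex_Times convex_real_interval)
  have strip: "\<exists>\<delta>>0. \<forall>a b. a \<le> s \<and> s \<le> b \<and> b - a < \<delta> \<longrightarrow> (\<exists>F. lifts (R a b 0 1) \<gamma> F)"
    if s: "0 \<le> s" "s \<le> 1" for s
  proof (rule Bolzano[where P="\<lambda>c d. \<exists>\<delta>>0. \<forall>a b. a \<le> s \<and> s \<le> b \<and> b - a < \<delta> \<longrightarrow> (\<exists>F. lifts (R a b c d) \<gamma> F)"])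
    show "(0::real) \<le> 1" by simp
    fix c d e :: real
    assume "\<exists>\<delta>>0. \<forall>a b. a \<le> s \<and> s \<le> b \<and> b - a < \<delta> \<longrightarrow> (\<exists>F. lifts (R a b c d) \<gamma> F)"
      and "\<exists>\<delta>>0. \<forall>a b. a \<le> s \<and> s \<le> b \<and> b - a < \<delta> \<longrightarrow> (\<exists>F. lifts (R a b d e) \<gamma> F)"
      and le: "c \<le> d" "d \<le> e"
    then obtain \<delta>1 \<delta>2 where \<delta>: "\<delta>1 > 0" "\<delta>2 > 0"
      "\<And>a b. a \<le> s \<Longrightarrow> s \<le> b \<Longrightarrow> b - a < \<delta>1 \<Longrightarrow> \<exists>F. lifts (R a b c d) \<gamma> F"
      "\<And>a b. a \<le> s \<Longrightarrow> s \<le> b \<Longrightarrow> b - a < \<delta>2 \<Longrightarrow> \<exists>F. lifts (R a b d e) \<gamma> F" by blast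
    have "\<exists>F. lifts (R a b c e) \<gamma> F" if ab: "a \<le> s" "s \<le> b" "b - a < min \<delta>1 \<delta>2" for a b
    proof -
      obtain F G where "lifts (R a b c d) \<gamma> F" "lifts (R a b d e) \<gamma> G" using \<delta>(3,4)[of a b] ab by auto
      moreover have "R a b c d \<inter> R a b d e = R a b d d" using le by (auto simp: R_def)
      moreover have "R a b c d \<union> R a b d e = R a b c e" using le by (auto simp: R_def)
      ultimately show ?thesis using lifts_glue[of "R a b c d" \<gamma> F "R a b d e" G] R by metis
    qed
    then show "\<exists>\<delta>>0. \<forall>a b. a \<le> s \<and> s \<le> b \<and> b - a < \<delta> \<longrightarrow> (\<exists>F. lifts (R a b c e) \<gamma> F)"
      using \<delta>(1,2) by (intro exI[of _ "min \<delta>1 \<delta>2"]) simp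
  next
    fix t :: real assume t: "0 \<le> t" "t \<le> 1"
    obtain N F where N: "open N" "(s, t) \<in> N" "lifts (({0..1} \<times> {0..1}) \<inter> N) \<gamma> F"
      using lifts_local[OF cont, of "(s, t)"] s t by auto
    obtain A B where AB: "open A" "open B" "s \<in> A" "t \<in> B" "A \<times> B \<subseteq> N"
      using N(1,2) open_prod_elim by (metis mem_Sigma_iff)
    obtain e1 where e1: "e1 > 0" "\<And>y. dist y s < e1 \<Longrightarrow> y \<in> A" using AB(1,3) open_dist by blast
    obtain e2 where e2: "e2 > 0" "\<And>y. dist y t < e2 \<Longrightarrow> y \<in> B" using AB(2,4) open_dist by blast
    have "lifts (R a b c d) \<gamma> F" if "a \<le> s" "s \<le> b" "b - a < e1" "c \<le> t" "t \<le> d" "d - c < e2" for a b c d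
    proof (rule lifts_subset[OF N(3)])
      have "{a..b} \<subseteq> A" "{c..d} \<subseteq> B" using that by (auto intro!: e1(2) e2(2) simp: dist_real_def)
      then show "R a b c d \<subseteq> ({0..1} \<times> {0..1}) \<inter> N" using AB(5) unfolding R_def by blast
    qed
    then show "\<exists>d>0. \<forall>a b. a \<le> t \<and> t \<le> b \<and> b - a < d \<longrightarrow>
        (\<exists>\<delta>>0. \<forall>aa ba. aa \<le> s \<and> s \<le> ba \<and> ba - aa < \<delta> \<longrightarrow> (\<exists>F. lifts (R aa ba a b) \<gamma> F))"
      using e1(1) e2(1) by blast
  qed
  have "\<exists>F. lifts (R 0 1 0 1) \<gamma> F"
  proof (rule Bolzano[where P="\<lambda>a b. \<exists>F. lifts (R a b 0 1) \<gamma> F"])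
    show "(0::real) \<le> 1" by simp
    fix a b c :: real
    assume "\<exists>F. lifts (R a b 0 1) \<gamma> F" "\<exists>F. lifts (R b c 0 1) \<gamma> F" and le: "a \<le> b" "b \<le> c"
    then obtain F G where "lifts (R a b 0 1) \<gamma> F" "lifts (R b c 0 1) \<gamma> G" by blast
    moreover have "R a b 0 1 \<inter> R b c 0 1 = R b b 0 1" using le by (auto simp: R_def)
    moreover have "R a b 0 1 \<union> R b c 0 1 = R a c 0 1" using le by (auto simp: R_def)
    ultimately show "\<exists>F. lifts (R a c 0 1) \<gamma> F"
      using lifts_glue[of "R a b 0 1" \<gamma> F "R b c 0 1" G] R by metis
  qed (use strip in blast)
  then show ?thesis by (simp add: R_def)
qed

lemma lifts_path_exists:
  assumes "path p" shows "\<exists>f. lifts {0..1} p f"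
proof -
  \<comment> \<open>The path is regarded as a map of the square that is constant in the first
    coordinate.\<close>
  have "continuous_on ({0..1::real} \<times> {0..1}) (\<lambda>x. p (snd x))"
    using assms unfolding path_def
    by (rule continuous_on_compose2) (auto intro!: continuous_intros)
  from lifts_square[OF this] obtain F where "lifts ({0..1::real} \<times> {0..1}) (\<lambda>x. p (snd x)) F" ..
  then have "lifts {0..1} p (\<lambda>t. F (0, t))"
    by (rule lifts_compose) (auto intro!: continuous_intros)
  then show ?thesis by blast
qed

text \<open>A contraction of the loop is lifted to \<open>F\<close> on the square, the first
  coordinate being the homotopy parameter. The edges with second coordinate 0 and 1 carry the same
  curve, so \<open>F\<close> has equal increments along them; the edge of the constant loop has
  increment zero, hence so does the edge of \<open>p\<close>.\<close>

lemma lifts_loop: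
  assumes sc: "simply_connected (UNIV :: 'm set)"
    and p: "path p" "pathfinish p = pathstart p" and f: "lifts {0..1} p f"
  shows "f 1 = f 0"
proof -
  let ?q = "\<lambda>t::real. p 0"
  have "homotopic_loops UNIV p ?q"
    using sc p unfolding simply_connected_def by (auto simp: path_def pathfinish_def pathstart_def)
  then obtain h where h': "continuous_on ({0..1::real} \<times> {0..1::real}) h" "\<forall>t\<in>{0..1}. h (0, t) = p t"
    "\<forall>t\<in>{0..1}. h (1, t) = p 0" "\<forall>s\<in>{0..1}. pathfinish (h \<circ> Pair s) = pathstart (h \<circ> Pair s)"
    unfolding homotopic_loops by (elim exE conjE) (rule that; assumption)
  note h = h'(1) h'(2,3)[rule_format] h'(4)[unfolded pathfinish_def pathstart_def o_def, rule_format]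
  obtain F where F: "lifts ({0..1} \<times> {0..1}) h F" using lifts_square[OF h(1)] by blast
  have F0: "lifts {0..1} p (\<lambda>t. F (0, t))"
    by (rule lifts_compose[OF F]) (auto intro!: continuous_intros simp: h(2))
  have F1: "lifts {0..1} ?q (\<lambda>t. F (1, t))"
    by (rule lifts_compose[OF F]) (auto intro!: continuous_intros simp: h(3))
  obtain U g where U: "(U, g) \<in> P" "p 0 \<in> U" using covers by blast
  have g: "lifts {0..1::real} ?q (\<lambda>t. g (p 0))" by (rule lifts_domain[OF U(1)]) (use U(2) in auto)
  have b: "lifts {0..1} (\<lambda>s. h (s, 0)) (\<lambda>s. F (s, 0))"
    by (rule lifts_compose[OF F]) (auto intro!: continuous_intros)
  have t: "lifts {0..1} (\<lambda>s. h (s, 0)) (\<lambda>s. F (s, 1))"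
    by (rule lifts_compose[OF F]) (auto intro!: continuous_intros simp: h(4))
  have "f 1 - F (0, 1) = f 0 - F (0, 0)" using lifts_unique[OF f F0, of 1 0] by simp
  moreover have "F (1, 1) = F (1, 0)" using lifts_unique[OF F1 g, of 1 0] by simp
  moreover have "F (0, 0) - F (0, 1) = F (1, 0) - F (1, 1)" using lifts_unique[OF b t, of 0 1] by simp
  ultimately show ?thesis by simp
qed

lemma lifts_reversepath:
  assumes "lifts {0..1} p f" shows "lifts {0..1} (reversepath p) (\<lambda>t. f (1 - t))"
  by (rule lifts_compose[OF assms]) (auto intro!: continuous_intros simp: reversepath_def)

lemma lifts_joinpaths:
  assumes "pathfinish p = pathstart q"
    and f: "lifts {0..1} p f" and g: "lifts {0..1} q g" and k: "lifts {0..1} (p +++ q) k"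
  shows "k 1 - k 0 = (f 1 - f 0) + (g 1 - g 0)"
proof -
  have "lifts {0..1} p (\<lambda>t. k (t / 2))"
    by (rule lifts_compose[OF k]) (auto intro!: continuous_intros simp: joinpaths_def)
  then have "f 1 - k (1 / 2) = f 0 - k 0" using lifts_unique[OF f, of "\<lambda>t. k (t / 2)" 1 0] by simp
  moreover have "lifts {0..1} q (\<lambda>t. k ((t + 1) / 2))"
    by (rule lifts_compose[OF k])
      (use assms(1) in \<open>auto intro!: continuous_intros simp: joinpaths_def pathstart_def pathfinish_def field_simps\<close>)
  then have "g 1 - k 1 = g 0 - k (1 / 2)" using lifts_unique[OF g, of "\<lambda>t. k ((t + 1) / 2)" 1 0] by simp
  ultimately show ?thesis by simp
qed

text \<open>\<open>simply_connected\<close> makes any two loops freely homotopic, constant ones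
  included; the trace of the base point under such a homotopy joins \<open>a\<close> to
  \<open>b\<close>.\<close>

lemma simply_connected_path:
  assumes sc: "simply_connected (UNIV :: 'm set)"
  shows "\<exists>p. path p \<and> pathstart p = a \<and> pathfinish p = (b::'m)"
proof -
  have "homotopic_loops UNIV (\<lambda>t::real. a) (\<lambda>t. b)"
    using sc unfolding simply_connected_def by (auto simp: path_def pathfinish_def pathstart_def)
  then obtain h where h: "continuous_on ({0..1::real} \<times> {0..1::real}) h" "h (0, 0) = a" "h (1, 0) = b"
    unfolding homotopic_loops by auto
  have "continuous_on {0..1} (\<lambda>s. h (s, 0))"
    by (rule continuous_on_compose2[OF h(1)]) (auto intro!: continuous_intros)
  then show ?thesis
    using h by (intro exI[of _ "\<lambda>s. h (s, 0)"]) (auto simp: path_def pathstart_def pathfinish_def)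
qed

theorem global_primitive:
  assumes sc: "simply_connected (UNIV :: 'm set)"
    and lpc: "\<And>x U. open U \<Longrightarrow> x \<in> U \<Longrightarrow> \<exists>W. open W \<and> x \<in> W \<and> W \<subseteq> U \<and> path_connected (W :: 'm set)"
  obtains \<phi> where "\<And>U f x. (U, f) \<in> P \<Longrightarrow> x \<in> U \<Longrightarrow>
    \<exists>W. open W \<and> x \<in> W \<and> W \<subseteq> U \<and> (\<forall>y\<in>W. \<phi> y - \<phi> x = f y - f x)"
proof -
  \<comment> \<open>An arbitrary base point.\<close>
  define a :: 'm where "a = undefined"
  obtain c where c: "\<And>x. path (c x)" "\<And>x. pathstart (c x) = a" "\<And>x. pathfinish (c x) = x"
    using simply_connected_path[OF sc, of a] by metis
  obtain l where l: "\<And>x. lifts {0..1} (c x) (l x)" using lifts_path_exists[OF c(1)] by metis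
  define \<phi> where "\<phi> x = l x 1 - l x 0" for x
  have "\<exists>W. open W \<and> x \<in> W \<and> W \<subseteq> U \<and> (\<forall>y\<in>W. \<phi> y - \<phi> x = f y - f x)" if U: "(U, f) \<in> P" "x \<in> U" for U f x
  proof -
    obtain W where W: "open W" "x \<in> W" "W \<subseteq> U" "path_connected W" using lpc[OF open_domain[OF U(1)] U(2)] by blast
    have "\<phi> y - \<phi> x = f y - f x" if y: "y \<in> W" for y
    proof -
      obtain q where q: "path q" "path_image q \<subseteq> W" "pathstart q = x" "pathfinish q = y"
        using W(4) W(2) y unfolding path_connected_def by blast
      have lq: "lifts {0..1} q (\<lambda>t. f (q t))"
        by (rule lifts_domain[OF U(1)]) (use q W(3) in \<open>auto simp: path_def path_image_def\<close>)
      \<comment> \<open>The loop from the base point through \<open>x\<close> and \<open>y\<close>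
        and back has increment zero, so the increment of \<phi> from \<open>x\<close> to
        \<open>y\<close> is that of \<open>f\<close> along \<open>q\<close>.\<close>
      let ?r = "(c x +++ q) +++ reversepath (c y)"
      have pq: "path (c x +++ q)" using c q by simp
      have pr: "path ?r" using c q by simp
      obtain k where k: "lifts {0..1} (c x +++ q) k" using lifts_path_exists[OF pq] by blast
      obtain m where m: "lifts {0..1} ?r m" using lifts_path_exists[OF pr] by blast
      have "k 1 - k 0 = \<phi> x + (f y - f x)"
        using lifts_joinpaths[OF _ l lq k] c q by (simp add: \<phi>_def pathstart_def pathfinish_def)
      moreover have "m 1 - m 0 = (k 1 - k 0) - \<phi> y"
        using lifts_joinpaths[OF _ k lifts_reversepath[OF l] m] c q by (simp add: \<phi>_def)
      moreover have "m 1 = m 0" using lifts_loop[OF sc pr _ m] c q by simp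
      ultimately show ?thesis by simp
    qed
    then show ?thesis using W by blast
  qed
  then show ?thesis using that by blast
qed

end

section \<open>Calculus on manifolds\<close>

locale smooth_mfd =
  fixes M :: "('m::{t2_space,second_countable_topology}, 'e::euclidean_space) manifold"
  assumes smooth: "smooth_manifold M"
begin

abbreviation "chart_image c U \<equiv> cmap c ` (cdomain c \<inter> U)"

lemma chart_atlas: "chart_at M x \<in> atlas M" and chart_dom: "x \<in> cdomain (chart_at M x)"
  using smooth unfolding smooth_manifold_def by blast+

lemma chart_homeomorphism:
  "c \<in> atlas M \<Longrightarrow> homeomorphism (cdomain c) (cmap c ` cdomain c) (cmap c) (cinv c)"
  using smooth unfolding smooth_manifold_def is_chart_def by blast

lemma open_cdomain: "c \<in> atlas M \<Longrightarrow> open (cdomain c)"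
  and open_cimage: "c \<in> atlas M \<Longrightarrow> open (cmap c ` cdomain c)"
  using smooth unfolding smooth_manifold_def is_chart_def by blast+

lemma cinv_cmap: "c \<in> atlas M \<Longrightarrow> x \<in> cdomain c \<Longrightarrow> cinv c (cmap c x) = x"
  using homeomorphism_apply1[OF chart_homeomorphism] .

lemma open_chart_image:
  assumes "c \<in> atlas M" "open U" shows "open (chart_image c U)"
proof -
  have "continuous_on (cmap c ` cdomain c) (cinv c)"
    using homeomorphism_cont2[OF chart_homeomorphism[OF assms(1)]] .
  then have "open (cinv c -` U \<inter> cmap c ` cdomain c)"
    using continuous_on_open_vimage[OF open_cimage[OF assms(1)]] assms(2) by blast
  moreover have "cinv c -` U \<inter> cmap c ` cdomain c = chart_image c U"
    using cinv_cmap[OF assms(1)] by auto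
  ultimately show ?thesis by simp
qed

lemma cinv_chart_image:
  assumes "c \<in> atlas M" "y \<in> chart_image c U"
  shows "cinv c y \<in> cdomain c" "cinv c y \<in> U" "cmap c (cinv c y) = y"
  using assms cinv_cmap by auto

lemma transition_smooth:
  "c \<in> atlas M \<Longrightarrow> c' \<in> atlas M \<Longrightarrow> smooth_on (chart_image c (cdomain c')) (\<lambda>y. cmap c' (cinv c y))"
  using smooth unfolding smooth_manifold_def o_def by blast

definition J :: "('m, 'e) chart \<Rightarrow> ('m, 'e) chart \<Rightarrow> 'm \<Rightarrow> 'e \<Rightarrow> 'e" where
  "J c c' x = frechet_derivative (\<lambda>y. cmap c' (cinv c y)) (at (cmap c x))"

lemma chart_diff_J: "chart_diff M c x = J (chart_at M x) c x"
  by (simp add: chart_diff_def J_def o_def)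

lemma J_derivative:
  assumes "c \<in> atlas M" "c' \<in> atlas M" "x \<in> cdomain c" "x \<in> cdomain c'"
  shows "((\<lambda>y. cmap c' (cinv c y)) has_derivative J c c' x) (at (cmap c x))"
  unfolding J_def by (rule smooth_on_has_derivative[OF transition_smooth]) (use assms in auto)

lemma J_linear:
  assumes "c \<in> atlas M" "c' \<in> atlas M" "x \<in> cdomain c" "x \<in> cdomain c'"
  shows "linear (J c c' x)"
  using J_derivative[OF assms] has_derivative_linear by blast

lemma J_chain:
  assumes c: "c \<in> atlas M" "c' \<in> atlas M" "c'' \<in> atlas M"
    and x: "x \<in> cdomain c" "x \<in> cdomain c'" "x \<in> cdomain c''"
  shows "J c' c'' x (J c c' x v) = J c c'' x v"
proof -
  let ?T = "chart_image c (cdomain c' \<inter> cdomain c'')"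
  have T: "open ?T" "cmap c x \<in> ?T"
    using open_chart_image[OF c(1) open_Int[OF open_cdomain[OF c(2)] open_cdomain[OF c(3)]]] x by auto
  have x': "cmap c' (cinv c (cmap c x)) = cmap c' x" using cinv_cmap[OF c(1) x(1)] by simp
  have "((\<lambda>y. cmap c'' (cinv c' (cmap c' (cinv c y)))) has_derivative (\<lambda>v. J c' c'' x (J c c' x v))) (at (cmap c x))"
    by (rule has_derivative_compose[OF J_derivative[OF c(1,2) x(1,2)] J_derivative[OF c(2,3) x(2,3), folded x']])
  moreover have "cmap c'' (cinv c' (cmap c' (cinv c y))) = cmap c'' (cinv c y)" if "y \<in> ?T" for y
    using cinv_chart_image[OF c(1) that] cinv_cmap[OF c(2)] by simp
  ultimately have "((\<lambda>y. cmap c'' (cinv c y)) has_derivative (\<lambda>v. J c' c'' x (J c c' x v))) (at (cmap c x))"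
    by (rule has_derivative_transform_within_open[OF _ T])
  then show ?thesis using has_derivative_unique[OF _ J_derivative[OF c(1,3) x(1,3)]] by metis
qed

lemma J_same:
  assumes "c \<in> atlas M" "x \<in> cdomain c" shows "J c c x v = v"
proof -
  have T: "open (chart_image c UNIV)" "cmap c x \<in> chart_image c UNIV"
    using open_chart_image[OF assms(1) open_UNIV] assms(2) by auto
  have "((\<lambda>y. cmap c (cinv c y)) has_derivative (\<lambda>v. v)) (at (cmap c x))"
    using has_derivative_cong_open[OF T, of "\<lambda>y. cmap c (cinv c y)" "\<lambda>y. y"]
      cinv_chart_image(3)[OF assms(1)] has_derivative_ident by blast
  then show ?thesis using has_derivative_unique[OF _ J_derivative[OF assms(1,1,2,2)]] by metis
qed

lemma chart_diff_linear:
  "c \<in> atlas M \<Longrightarrow> x \<in> cdomain c \<Longrightarrow> linear (chart_diff M c x)"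
  unfolding chart_diff_J using J_linear[OF chart_atlas _ chart_dom] .

lemma chart_diff_change:
  "c \<in> atlas M \<Longrightarrow> c' \<in> atlas M \<Longrightarrow> x \<in> cdomain c \<Longrightarrow> x \<in> cdomain c' \<Longrightarrow>
    J c c' x (chart_diff M c x v) = chart_diff M c' x v"
  unfolding chart_diff_J using J_chain[OF chart_atlas _ _ chart_dom] .

lemma chart_diff_chart_at: "chart_diff M (chart_at M x) x v = v"
  unfolding chart_diff_J by (rule J_same[OF chart_atlas chart_dom])

text \<open>The coordinate field of the chart \<open>c\<close> in the constant direction
  \<open>w\<close>. For \<open>c = chart_at M x\<close> its value at \<open>x\<close> is
  \<open>w\<close>, so these fields extend every tangent vector at \<open>x\<close> to a smooth
  field.\<close>

definition coord_vf :: "('m, 'e) chart \<Rightarrow> 'e \<Rightarrow> 'm \<Rightarrow> 'e" where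
  "coord_vf c w x = J c (chart_at M x) x w"

lemma chart_diff_coord_vf:
  "c \<in> atlas M \<Longrightarrow> c' \<in> atlas M \<Longrightarrow> x \<in> cdomain c \<Longrightarrow> x \<in> cdomain c' \<Longrightarrow>
    chart_diff M c' x (coord_vf c w x) = J c c' x w"
  unfolding coord_vf_def chart_diff_J by (rule J_chain[OF _ chart_atlas _ _ chart_dom])

lemma coord_vf_chart_diff:
  "c \<in> atlas M \<Longrightarrow> x \<in> cdomain c \<Longrightarrow> coord_vf c (chart_diff M c x v) x = v"
  unfolding coord_vf_def
  using chart_diff_change[OF _ chart_atlas _ chart_dom, of c x v] by (simp add: chart_diff_chart_at)

lemma coord_vf_linear: "c \<in> atlas M \<Longrightarrow> x \<in> cdomain c \<Longrightarrow> linear (\<lambda>w. coord_vf c w x)"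
  unfolding coord_vf_def using J_linear[OF _ chart_atlas _ chart_dom] by simp

lemma coord_vf_chart_at: "coord_vf (chart_at M x) w x = w"
  unfolding coord_vf_def by (rule J_same[OF chart_atlas chart_dom])

section \<open>Smooth functions and vector fields in charts\<close>

lemma smooth_funD:
  "smooth_fun M U f \<Longrightarrow> c \<in> atlas M \<Longrightarrow> smooth_on (chart_image c U) (\<lambda>y. f (cinv c y))"
  unfolding smooth_fun_def o_def by blast

lemma smooth_vfD:
  "smooth_vf M U X \<Longrightarrow> c \<in> atlas M \<Longrightarrow> smooth_on (chart_image c U) (vf_in_chart M c X)"
  unfolding smooth_vf_def by blast

lemma smooth_fun_subset: "smooth_fun M U f \<Longrightarrow> V \<subseteq> U \<Longrightarrow> smooth_fun M V f"
  unfolding smooth_fun_def by (meson Int_mono image_mono order_refl smooth_on_subset)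

lemma smooth_vf_subset: "smooth_vf M U f \<Longrightarrow> V \<subseteq> U \<Longrightarrow> smooth_vf M V f"
  unfolding smooth_vf_def by (meson Int_mono image_mono order_refl smooth_on_subset)

lemma chart_image_mem: "x \<in> cdomain c \<Longrightarrow> x \<in> U \<Longrightarrow> cmap c x \<in> chart_image c U" by blast

lemma transition_into:
  assumes "c \<in> atlas M" "c' \<in> atlas M"
  shows "(\<lambda>y. cmap c (cinv c' y)) ` chart_image c' (cdomain c \<inter> V) \<subseteq> chart_image c V"
  using cinv_cmap[OF assms(2)] by auto

text \<open>One chart around each point suffices, because in any other chart the local expression is
  composed with a smooth change of charts.\<close>

lemma smooth_funI:
  assumes "\<And>x. x \<in> U \<Longrightarrow> \<exists>c V. c \<in> atlas M \<and> open V \<and> x \<in> V \<and> x \<in> cdomain c \<and>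
    smooth_on (chart_image c V) (\<lambda>y. f (cinv c y))"
  shows "smooth_fun M U f"
  unfolding smooth_fun_def o_def
proof (intro ballI smooth_on_local)
  fix c' y assume c': "c' \<in> atlas M" and y: "y \<in> chart_image c' U"
  define x where "x = cinv c' y"
  note x = cinv_chart_image[OF c' y, folded x_def]
  obtain c V where c: "c \<in> atlas M" "open V" "x \<in> V" "x \<in> cdomain c"
    "smooth_on (chart_image c V) (\<lambda>y. f (cinv c y))" using assms[OF x(2)] by blast
  let ?T = "chart_image c' (cdomain c \<inter> V)"
  have T: "open ?T" by (intro open_chart_image c' open_Int open_cdomain c)
  have yT: "y \<in> ?T" using x c by (metis Int_iff image_eqI)
  have "smooth_on ?T (\<lambda>y. f (cinv c (cmap c (cinv c' y))))"
    by (rule smooth_on_compose[where f="\<lambda>y. f (cinv c y)" and g="\<lambda>y. cmap c (cinv c' y)",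
          OF T open_chart_image[OF c(1,2)] transition_into[OF c(1) c'] _ c(5)])
      (rule smooth_on_subset[OF transition_smooth[OF c' c(1)]], blast)
  moreover have "f (cinv c (cmap c (cinv c' y))) = f (cinv c' y)" if "y \<in> ?T" for y
    using cinv_chart_image[OF c' that] cinv_cmap[OF c(1)] by simp
  ultimately have "smooth_on ?T (\<lambda>y. f (cinv c' y))" using smooth_on_cong[OF T, of "\<lambda>y. f (cinv c (cmap c (cinv c' y)))" "\<lambda>y. f (cinv c' y)"] by simp
  then show "\<exists>T. open T \<and> y \<in> T \<and> smooth_on T (\<lambda>y. f (cinv c' y))" using T yT by blast
qed

lemma vf_in_chart_change:
  assumes "c \<in> atlas M" "c' \<in> atlas M" "y \<in> chart_image c' (cdomain c)"
  shows "vf_in_chart M c' X y = frechet_derivative (\<lambda>y. cmap c' (cinv c y)) (at (cmap c (cinv c' y)))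
    (vf_in_chart M c X (cmap c (cinv c' y)))"
  using chart_diff_change[OF assms(1,2), of "cinv c' y" "X (cinv c' y)"] cinv_chart_image[OF assms(2,3)]
    cinv_cmap[OF assms(1)] by (simp add: vf_in_chart_def J_def)

text \<open>As for functions, except that the components are also transformed by the Jacobian, that
  is, by a derivative in a direction that varies with the point.\<close>

lemma smooth_vfI:
  assumes "\<And>x. x \<in> U \<Longrightarrow> \<exists>c V. c \<in> atlas M \<and> open V \<and> x \<in> V \<and> x \<in> cdomain c \<and>
    smooth_on (chart_image c V) (vf_in_chart M c X)"
  shows "smooth_vf M U X"
  unfolding smooth_vf_def
proof (intro ballI smooth_on_local)
  fix c' y assume c': "c' \<in> atlas M" and y: "y \<in> chart_image c' U"
  define x where "x = cinv c' y"
  note x = cinv_chart_image[OF c' y, folded x_def]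
  obtain c V where c: "c \<in> atlas M" "open V" "x \<in> V" "x \<in> cdomain c"
    "smooth_on (chart_image c V) (vf_in_chart M c X)" using assms[OF x(2)] by blast
  let ?T = "chart_image c' (cdomain c \<inter> V)" and ?S = "chart_image c (V \<inter> cdomain c')"
  let ?t = "\<lambda>y. cmap c (cinv c' y)"
  have T: "open ?T" by (intro open_chart_image c' open_Int open_cdomain c)
  have S: "open ?S" by (intro open_chart_image c' open_Int open_cdomain c)
  have yT: "y \<in> ?T" using x c by (metis Int_iff image_eqI)
  have tS: "?t ` ?T \<subseteq> ?S" using cinv_cmap[OF c'] by auto
  have "smooth_on ?S (\<lambda>y. frechet_derivative (\<lambda>y. cmap c' (cinv c y)) (at y) (vf_in_chart M c X y))"
    by (rule smooth_on_derivative_along[OF S smooth_on_subset[OF transition_smooth[OF c(1) c']] smooth_on_subset[OF c(5)]]) auto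
  then have "smooth_on ?T (\<lambda>y. frechet_derivative (\<lambda>y. cmap c' (cinv c y)) (at (?t y)) (vf_in_chart M c X (?t y)))"
    by (rule smooth_on_compose[where f="\<lambda>y. frechet_derivative (\<lambda>y. cmap c' (cinv c y)) (at y) (vf_in_chart M c X y)" and g="?t",
          OF T S tS smooth_on_subset[OF transition_smooth[OF c' c(1)]], rotated]) auto
  moreover have "vf_in_chart M c' X y = frechet_derivative (\<lambda>y. cmap c' (cinv c y)) (at (?t y)) (vf_in_chart M c X (?t y))"
    if "y \<in> ?T" for y
    by (rule vf_in_chart_change[OF c(1) c']) (use that in auto)
  ultimately have "smooth_on ?T (vf_in_chart M c' X)" using smooth_on_cong[OF T] by (metis (no_types, lifting))
  then show "\<exists>T. open T \<and> y \<in> T \<and> smooth_on T (vf_in_chart M c' X)" using T yT by blast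
qed

lemma smooth_fun_local:
  assumes "\<And>x. x \<in> U \<Longrightarrow> \<exists>V. open V \<and> x \<in> V \<and> smooth_fun M V f"
  shows "smooth_fun M U f"
proof (rule smooth_funI)
  fix x assume "x \<in> U"
  then obtain V where V: "open V" "x \<in> V" "smooth_fun M V f" using assms by blast
  then show "\<exists>c V. c \<in> atlas M \<and> open V \<and> x \<in> V \<and> x \<in> cdomain c \<and> smooth_on (chart_image c V) (\<lambda>y. f (cinv c y))"
    using smooth_funD[OF V(3) chart_atlas] chart_atlas chart_dom by blast
qed

lemma smooth_fun_cong:
  assumes "open U" "\<And>x. x \<in> U \<Longrightarrow> f x = g x" "smooth_fun M U f"
  shows "smooth_fun M U g"
  unfolding smooth_fun_def o_def
proof
  fix c assume c: "c \<in> atlas M"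
  show "smooth_on (chart_image c U) (\<lambda>y. g (cinv c y))"
    using smooth_on_cong[OF open_chart_image[OF c assms(1)], of "\<lambda>y. f (cinv c y)" "\<lambda>y. g (cinv c y)"]
      smooth_funD[OF assms(3) c] assms(2) cinv_chart_image(2)[OF c] by blast
qed

lemma smooth_vf_cong:
  assumes "open U" "\<And>x. x \<in> U \<Longrightarrow> X x = Y x" "smooth_vf M U X"
  shows "smooth_vf M U Y"
  unfolding smooth_vf_def
proof
  fix c assume c: "c \<in> atlas M"
  have "vf_in_chart M c X y = vf_in_chart M c Y y" if "y \<in> chart_image c U" for y
    using assms(2)[OF cinv_chart_image(2)[OF c that]] by (simp add: vf_in_chart_def)
  then show "smooth_on (chart_image c U) (vf_in_chart M c Y)"
    using smooth_on_cong[OF open_chart_image[OF c assms(1)], of "vf_in_chart M c X" "vf_in_chart M c Y"]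
      smooth_vfD[OF assms(3) c] by blast
qed

lemma smooth_fun_const: "smooth_fun M U (\<lambda>x. k)"
  unfolding smooth_fun_def o_def by (intro ballI smooth_on_const)

lemma smooth_fun_add:
  assumes "open U" "smooth_fun M U f" "smooth_fun M U g"
  shows "smooth_fun M U (\<lambda>x. f x + g x)"
  unfolding smooth_fun_def o_def
  by (intro ballI smooth_on_add open_chart_image smooth_funD[OF assms(2)] smooth_funD[OF assms(3)] assms(1))

lemma smooth_fun_mult:
  assumes "open U" "smooth_fun M U f" "smooth_fun M U g"
  shows "smooth_fun M U (\<lambda>x. f x * g x)"
  unfolding smooth_fun_def o_def
  by (intro ballI smooth_on_mult open_chart_image smooth_funD[OF assms(2)] smooth_funD[OF assms(3)] assms(1))

lemma smooth_fun_minus: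
  assumes "open U" "smooth_fun M U f" shows "smooth_fun M U (\<lambda>x. - f x)"
  using smooth_fun_mult[OF assms(1) smooth_fun_const[of U "-1"] assms(2)] by simp

lemma smooth_fun_exp:
  assumes "open U" "smooth_fun M U f" shows "smooth_fun M U (\<lambda>x. exp (f x))"
  unfolding smooth_fun_def o_def
  by (intro ballI smooth_on_exp open_chart_image smooth_funD[OF assms(2)] assms(1))

lemma smooth_fun_divide:
  assumes "open U" "smooth_fun M U f" "smooth_fun M U g" "\<And>x. x \<in> U \<Longrightarrow> g x \<noteq> 0"
  shows "smooth_fun M U (\<lambda>x. f x / g x)"
  unfolding smooth_fun_def o_def divide_inverse
proof
  fix c assume c: "c \<in> atlas M"
  show "smooth_on (chart_image c U) (\<lambda>y. f (cinv c y) * inverse (g (cinv c y)))"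
    by (intro smooth_on_mult smooth_on_inverse open_chart_image smooth_funD[OF assms(2)] smooth_funD[OF assms(3)]
        assms(1,4) cinv_chart_image(2) c)
qed

lemma smooth_vf_add:
  assumes "open U" "smooth_vf M U X" "smooth_vf M U Y"
  shows "smooth_vf M U (\<lambda>x. X x + Y x)"
  unfolding smooth_vf_def
proof
  fix c assume c: "c \<in> atlas M"
  have eq: "vf_in_chart M c (\<lambda>x. X x + Y x) y = vf_in_chart M c X y + vf_in_chart M c Y y" if "y \<in> chart_image c U" for y
    using linear_add[OF chart_diff_linear[OF c cinv_chart_image(1)[OF c that]]] by (simp add: vf_in_chart_def)
  have "smooth_on (chart_image c U) (\<lambda>y. vf_in_chart M c X y + vf_in_chart M c Y y)"
    by (intro smooth_on_add open_chart_image smooth_vfD assms c)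
  then show "smooth_on (chart_image c U) (vf_in_chart M c (\<lambda>x. X x + Y x))"
    using smooth_on_cong[OF open_chart_image[OF c assms(1)], of "vf_in_chart M c (\<lambda>x. X x + Y x)"
        "\<lambda>y. vf_in_chart M c X y + vf_in_chart M c Y y"] eq by simp
qed

lemma smooth_vf_scaleR:
  assumes "open U" "smooth_fun M U f" "smooth_vf M U X"
  shows "smooth_vf M U (\<lambda>x. f x *\<^sub>R X x)"
  unfolding smooth_vf_def
proof
  fix c assume c: "c \<in> atlas M"
  have eq: "vf_in_chart M c (\<lambda>x. f x *\<^sub>R X x) y = f (cinv c y) *\<^sub>R vf_in_chart M c X y" if "y \<in> chart_image c U" for y
    using linear_scale[OF chart_diff_linear[OF c cinv_chart_image(1)[OF c that]]] by (simp add: vf_in_chart_def)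
  have "smooth_on (chart_image c U) (\<lambda>y. f (cinv c y) *\<^sub>R vf_in_chart M c X y)"
    by (intro smooth_on_scaleR open_chart_image smooth_vfD smooth_funD assms c)
  then show "smooth_on (chart_image c U) (vf_in_chart M c (\<lambda>x. f x *\<^sub>R X x))"
    using smooth_on_cong[OF open_chart_image[OF c assms(1)], of "vf_in_chart M c (\<lambda>x. f x *\<^sub>R X x)"
        "\<lambda>y. f (cinv c y) *\<^sub>R vf_in_chart M c X y"] eq by simp
qed

lemma smooth_vf_zero: "open U \<Longrightarrow> smooth_vf M U (\<lambda>x. 0)"
  unfolding smooth_vf_def
proof
  fix c assume U: "open U" and c: "c \<in> atlas M"
  have "vf_in_chart M c (\<lambda>x. 0) y = 0" if "y \<in> chart_image c U" for y
    using linear_0[OF chart_diff_linear[OF c cinv_chart_image(1)[OF c that]]] by (simp add: vf_in_chart_def)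
  then show "smooth_on (chart_image c U) (vf_in_chart M c (\<lambda>x. 0))"
    using smooth_on_cong[OF open_chart_image[OF c U], of "vf_in_chart M c (\<lambda>x. 0)" "\<lambda>y. 0"] smooth_on_const by simp
qed

lemma smooth_coord_vf:
  assumes c: "c \<in> atlas M" shows "smooth_vf M (cdomain c) (coord_vf c w)"
proof (rule smooth_vfI)
  fix x assume x: "x \<in> cdomain c"
  have "vf_in_chart M c (coord_vf c w) y = w" if "y \<in> chart_image c (cdomain c)" for y
    using cinv_chart_image[OF c that] chart_diff_coord_vf[OF c c] J_same[OF c] by (simp add: vf_in_chart_def)
  then have "smooth_on (chart_image c (cdomain c)) (vf_in_chart M c (coord_vf c w))"
    using smooth_on_cong[OF open_chart_image[OF c open_cdomain[OF c]], of "vf_in_chart M c (coord_vf c w)" "\<lambda>y. w"]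
      smooth_on_const by simp
  then show "\<exists>c' V. c' \<in> atlas M \<and> open V \<and> x \<in> V \<and> x \<in> cdomain c' \<and>
      smooth_on (chart_image c' V) (vf_in_chart M c' (coord_vf c w))"
    using c x open_cdomain by blast
qed

section \<open>Differentials of functions and brackets of coordinate fields\<close>

lemma smooth_fun_has_derivative:
  assumes "smooth_fun M U f" "c \<in> atlas M" "x \<in> cdomain c" "x \<in> U"
  shows "((\<lambda>y. f (cinv c y)) has_derivative frechet_derivative (\<lambda>y. f (cinv c y)) (at (cmap c x))) (at (cmap c x))"
  by (rule smooth_on_has_derivative[OF smooth_funD[OF assms(1,2)]]) (use assms in blast)

lemma dfun_has_derivative:
  assumes "smooth_fun M U f" "x \<in> U"
  shows "((\<lambda>y. f (cinv (chart_at M x) y)) has_derivative dfun M f x) (at (cmap (chart_at M x) x))"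
  using smooth_fun_has_derivative[OF assms(1) chart_atlas chart_dom assms(2)] by (simp add: dfun_def o_def)

lemma dfun_unique:
  assumes "((\<lambda>y. f (cinv (chart_at M x) y)) has_derivative d) (at (cmap (chart_at M x) x))"
  shows "dfun M f x = d"
  using frechet_derivative_at[OF assms] by (simp add: dfun_def o_def)

lemma dfun_chart:
  assumes f: "smooth_fun M U f" "open U" "x \<in> U" and c: "c \<in> atlas M" "x \<in> cdomain c"
  shows "dfun M f x v = frechet_derivative (\<lambda>y. f (cinv c y)) (at (cmap c x)) (chart_diff M c x v)"
proof -
  let ?a = "chart_at M x"
  let ?T = "chart_image ?a (cdomain c \<inter> U)"
  have T: "open ?T" "cmap ?a x \<in> ?T"
    using open_chart_image[OF chart_atlas open_Int[OF open_cdomain[OF c(1)] f(2)]] c(2) f(3) chart_dom by auto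
  have x: "cmap c (cinv ?a (cmap ?a x)) = cmap c x" using cinv_cmap[OF chart_atlas chart_dom] by simp
  have fx: "((\<lambda>y. f (cinv c y)) has_derivative frechet_derivative (\<lambda>y. f (cinv c y)) (at (cmap c x)))
      (at (cmap c (cinv ?a (cmap ?a x))))"
    unfolding x by (rule smooth_fun_has_derivative[OF f(1) c f(3)])
  have "((\<lambda>y. f (cinv c (cmap c (cinv ?a y)))) has_derivative
      (\<lambda>v. frechet_derivative (\<lambda>y. f (cinv c y)) (at (cmap c x)) (J ?a c x v))) (at (cmap ?a x))"
    by (rule has_derivative_compose[OF J_derivative[OF chart_atlas c(1) chart_dom c(2)] fx])
  moreover have "f (cinv c (cmap c (cinv ?a y))) = f (cinv ?a y)" if "y \<in> ?T" for y
    using cinv_chart_image[OF chart_atlas that] cinv_cmap[OF c(1)] by simp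
  ultimately have "((\<lambda>y. f (cinv ?a y)) has_derivative
      (\<lambda>v. frechet_derivative (\<lambda>y. f (cinv c y)) (at (cmap c x)) (J ?a c x v))) (at (cmap ?a x))"
    by (rule has_derivative_transform_within_open[OF _ T])
  then show ?thesis using dfun_unique chart_diff_J by metis
qed

lemma dfun_coord_vf:
  assumes "smooth_fun M U f" "open U" "x \<in> U" "c \<in> atlas M" "x \<in> cdomain c"
  shows "dfun M f x (coord_vf c w x) = frechet_derivative (\<lambda>y. f (cinv c y)) (at (cmap c x)) w"
  using dfun_chart[OF assms] chart_diff_coord_vf[OF assms(4,4,5,5)] J_same[OF assms(4,5)] by simp

lemma dfun_cong:
  assumes "open U" "x \<in> U" "\<And>y. y \<in> U \<Longrightarrow> f y = g y"
  shows "dfun M f x = dfun M g x"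
  unfolding dfun_def o_def
proof (rule frechet_derivative_cong_open)
  show "open (chart_image (chart_at M x) U)" by (rule open_chart_image[OF chart_atlas assms(1)])
  show "cmap (chart_at M x) x \<in> chart_image (chart_at M x) U" using assms(2) chart_dom by blast
qed (simp add: assms(3) cinv_chart_image(2)[OF chart_atlas])

lemma dfun_const: "dfun M (\<lambda>x. k) x v = 0"
  using dfun_unique[OF has_derivative_const] by metis

lemma dfun_add:
  assumes "smooth_fun M U f" "smooth_fun M U g" "x \<in> U"
  shows "dfun M (\<lambda>y. f y + g y) x v = dfun M f x v + dfun M g x v"
  using dfun_unique[OF has_derivative_add[OF dfun_has_derivative[OF assms(1,3)] dfun_has_derivative[OF assms(2,3)]]] by simp

lemma dfun_mult:
  assumes "smooth_fun M U f" "smooth_fun M U g" "x \<in> U"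
  shows "dfun M (\<lambda>y. f y * g y) x v = f x * dfun M g x v + dfun M f x v * g x"
  using dfun_unique[OF has_derivative_mult[OF dfun_has_derivative[OF assms(1,3)] dfun_has_derivative[OF assms(2,3)]]]
  by (simp add: cinv_cmap[OF chart_atlas chart_dom])

lemma dfun_minus:
  assumes "smooth_fun M U f" "x \<in> U"
  shows "dfun M (\<lambda>y. - f y) x v = - dfun M f x v"
  using dfun_unique[OF has_derivative_minus[OF dfun_has_derivative[OF assms]]] by simp

lemma dfun_exp:
  assumes "smooth_fun M U f" "x \<in> U"
  shows "dfun M (\<lambda>y. exp (f y)) x v = exp (f x) * dfun M f x v"
  using dfun_unique[OF has_derivative_exp[OF dfun_has_derivative[OF assms]]]
  by (simp add: cinv_cmap[OF chart_atlas chart_dom] mult.commute)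

lemma smooth_fun_dfun:
  assumes U: "open U" and f: "smooth_fun M U f" and X: "smooth_vf M U X"
  shows "smooth_fun M U (\<lambda>x. dfun M f x (X x))"
  unfolding smooth_fun_def o_def
proof
  fix c assume c: "c \<in> atlas M"
  have eq: "dfun M f (cinv c y) (X (cinv c y)) =
      frechet_derivative (\<lambda>y. f (cinv c y)) (at y) (vf_in_chart M c X y)" if y: "y \<in> chart_image c U" for y
    using dfun_chart[OF f U cinv_chart_image(2)[OF c y] c cinv_chart_image(1)[OF c y]] cinv_chart_image(3)[OF c y]
    by (simp add: vf_in_chart_def)
  have "smooth_on (chart_image c U) (\<lambda>y. frechet_derivative (\<lambda>y. f (cinv c y)) (at y) (vf_in_chart M c X y))"
    by (intro smooth_on_derivative_along open_chart_image smooth_funD smooth_vfD c U f X)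
  then show "smooth_on (chart_image c U) (\<lambda>y. dfun M f (cinv c y) (X (cinv c y)))"
    using smooth_on_cong[OF open_chart_image[OF c U], of "\<lambda>y. dfun M f (cinv c y) (X (cinv c y))"
        "\<lambda>y. frechet_derivative (\<lambda>y. f (cinv c y)) (at y) (vf_in_chart M c X y)"] eq by simp
qed

lemma dfun_coord_commute:
  assumes c: "c \<in> atlas M" and f: "smooth_fun M (cdomain c) f" and x: "x \<in> cdomain c"
  shows "dfun M (\<lambda>y. dfun M f y (coord_vf c u y)) x (coord_vf c v x) =
    dfun M (\<lambda>y. dfun M f y (coord_vf c v y)) x (coord_vf c u x)"
proof -
  note o = open_cdomain[OF c] and oi = open_chart_image[OF c open_cdomain[OF c]]
  have "dfun M (\<lambda>y. dfun M f y (coord_vf c u y)) x (coord_vf c v x) =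
      frechet_derivative (\<lambda>y. frechet_derivative (\<lambda>y. f (cinv c y)) (at y) u) (at (cmap c x)) v" for u v
  proof -
    have "dfun M (\<lambda>y. dfun M f y (coord_vf c u y)) x (coord_vf c v x) =
       frechet_derivative (\<lambda>y. dfun M f (cinv c y) (coord_vf c u (cinv c y))) (at (cmap c x)) v"
      by (rule dfun_coord_vf[OF smooth_fun_dfun[OF o f smooth_coord_vf[OF c]] o x c x])
    also have "frechet_derivative (\<lambda>y. dfun M f (cinv c y) (coord_vf c u (cinv c y))) (at (cmap c x)) =
       frechet_derivative (\<lambda>y. frechet_derivative (\<lambda>y. f (cinv c y)) (at y) u) (at (cmap c x))"
    proof (rule frechet_derivative_cong_open[OF oi])
      show "cmap c x \<in> chart_image c (cdomain c)" using x by blast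
      fix y assume y: "y \<in> chart_image c (cdomain c)"
      show "dfun M f (cinv c y) (coord_vf c u (cinv c y)) = frechet_derivative (\<lambda>y. f (cinv c y)) (at y) u"
        using dfun_coord_vf[OF f o cinv_chart_image(1)[OF c y] c cinv_chart_image(1)[OF c y]] cinv_chart_image(3)[OF c y]
        by simp
    qed
    finally show ?thesis .
  qed
  then show ?thesis
    using second_derivative_symmetric[OF oi chart_image_mem[OF x x] smooth_on_Ck[OF smooth_funD[OF f c]]] by metis
qed

text \<open>\<open>lie_bracket\<close> is evaluated in the preferred chart at \<open>x\<close>,
  whereas the fields may come from another chart \<open>c\<close>, as they do at the other points of
  a chart domain. The derivatives of their components are second derivatives of the change of
  charts, which are symmetric.\<close>

lemma lie_bracket_coord:
  assumes c: "c \<in> atlas M" and x: "x \<in> cdomain c"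
  shows "lie_bracket M (coord_vf c u) (coord_vf c v) x = 0"
proof -
  let ?a = "chart_at M x"
  let ?T = "chart_image ?a (cdomain c)" and ?S = "chart_image c (cdomain ?a)"
  let ?f = "\<lambda>y. cmap ?a (cinv c y)" and ?t = "\<lambda>y. cmap c (cinv ?a y)"
  have T: "open ?T" "cmap ?a x \<in> ?T" using open_chart_image[OF chart_atlas open_cdomain[OF c]] x chart_dom by auto
  have S: "open ?S" "cmap c x \<in> ?S" using open_chart_image[OF c open_cdomain[OF chart_atlas]] x chart_dom by auto
  have fs: "smooth_on ?S ?f" by (rule transition_smooth[OF c chart_atlas])
  have xx: "?t (cmap ?a x) = cmap c x" using cinv_cmap[OF chart_atlas chart_dom] by simp
  have "frechet_derivative (vf_in_chart M ?a (coord_vf c v)) (at (cmap ?a x)) (coord_vf c u x) =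
     frechet_derivative (\<lambda>y. frechet_derivative ?f (at y) v) (at (cmap c x)) u" for u v
  proof -
    have eq: "vf_in_chart M ?a (coord_vf c v) y = frechet_derivative ?f (at (?t y)) v" if y: "y \<in> ?T" for y
      using chart_diff_coord_vf[OF c chart_atlas] cinv_chart_image[OF chart_atlas y]
      by (simp add: vf_in_chart_def J_def)
    have fx: "((\<lambda>y. frechet_derivative ?f (at y) v) has_derivative
        frechet_derivative (\<lambda>y. frechet_derivative ?f (at y) v) (at (cmap c x))) (at (?t (cmap ?a x)))"
      unfolding xx by (rule smooth_on_has_derivative[OF smooth_on_derivative[OF fs] S(2)])
    have "((\<lambda>y. frechet_derivative ?f (at (?t y)) v) has_derivative
       (\<lambda>w. frechet_derivative (\<lambda>y. frechet_derivative ?f (at y) v) (at (cmap c x)) (J ?a c x w))) (at (cmap ?a x))"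
      by (rule has_derivative_compose[OF J_derivative[OF chart_atlas c chart_dom x] fx])
    then have "(vf_in_chart M ?a (coord_vf c v) has_derivative
       (\<lambda>w. frechet_derivative (\<lambda>y. frechet_derivative ?f (at y) v) (at (cmap c x)) (J ?a c x w))) (at (cmap ?a x))"
      by (rule has_derivative_transform_within_open[OF _ T]) (simp only: eq)
    then have "frechet_derivative (vf_in_chart M ?a (coord_vf c v)) (at (cmap ?a x)) =
       (\<lambda>w. frechet_derivative (\<lambda>y. frechet_derivative ?f (at y) v) (at (cmap c x)) (J ?a c x w))"
      using frechet_derivative_at by metis
    moreover have "J ?a c x (coord_vf c u x) = u"
      unfolding coord_vf_def using J_chain[OF c chart_atlas c x chart_dom x] J_same[OF c x] by simp
    ultimately show ?thesis by simp
  qed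
  then show ?thesis
    using second_derivative_symmetric[OF S smooth_on_Ck[OF fs]] by (simp add: lie_bracket_def Let_def)
qed

end

section \<open>Metric connections with twistor-free torsion\<close>

lemma alternating2_bilinear: "alternating2 b \<Longrightarrow> bilinear b"
  by (simp add: alternating2_def)

lemma alternating2_skew: "alternating2 b \<Longrightarrow> b u v = - b v u"
  unfolding alternating2_def by (elim conjE allE)

context lorentz_space
begin

text \<open>
  Writing \<open>s(v) = p(v) B - p \<and> B v\<close>, where \<open>B\<close> is the endomorphism of \<open>b\<close>, the action of
  \<open>s(v)\<close> on \<open>s = p \<and> b\<close> cancels by the symmetry of \<open>h (B x) (B y)\<close>.
\<close>

lemma wedge_self_action:
  assumes s: "\<And>u v w. s u v w = wedge12 (h p) b u v w" and b: "alternating2 b" and bp: "\<And>v. b p v = 0"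
    and p: "h p p = 0" and z: "\<And>x w. h (z x) w = s v x w"
  shows "s (z x) y w + s x (z y) w + s x y (z w) = 0"
proof -
  note bil = alternating2_bilinear[OF b] and skew = alternating2_skew[OF b]
  have "linear (b u)" for u using bil unfolding bilinear_def by (elim conjE allE)
  then have "\<exists>z. \<forall>w. h z w = b u w" for u by (rule ex_representing)
  then obtain B where B: "\<And>u w. h (B u) w = b u w" by metis
  have z': "z x = h p v *\<^sub>R B x - h p x *\<^sub>R B v + b v x *\<^sub>R p" for x
  proof (rule h_eqI)
    fix w show "h (z x) w = h (h p v *\<^sub>R B x - h p x *\<^sub>R B v + b v x *\<^sub>R p) w"
      using skew[of w v] by (simp add: z s wedge12_def B)
  qed
  have pB: "h p (B u) = 0" for u using B[of u p] bp[of u] skew[of u p] h_sym by simp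
  have pz: "h p (z x) = 0" for x by (simp add: z' pB p)
  have bB: "b (B x) y = - h (B x) (B y)" for x y using B[of y "B x"] skew[of "B x" y] h_sym[of "B y" "B x"] by simp
  have bz: "b (z x) y = - (h p v * h (B x) (B y)) + h p x * h (B v) (B y)" for x y
    unfolding z' by (simp add: bilinear_ladd[OF bil] bilinear_lsub[OF bil] bilinear_lmul[OF bil] bB bp)
  have bz': "b y (z x) = h p v * h (B x) (B y) - h p x * h (B v) (B y)" for x y
    using skew[of y "z x"] bz by simp
  show ?thesis
    unfolding s wedge12_def pz bz bz'
    using h_sym[of "B x" "B y"] h_sym[of "B x" "B w"] h_sym[of "B y" "B w"] by (simp add: algebra_simps)
qed

text \<open>\<open>B\<close> is the difference of the two connections in direction \<open>v\<close>.
  The bivector terms along \<open>p\<close> are killed by \<open>s\<close>, and the others add up to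
  the right side because the wedge of \<open>p\<close> with \<open>s\<close> is zero. The multiple
  of \<open>s\<close> in \<open>B\<close> contributes nothing by
  \<open>wedge_self_action\<close>.\<close>

lemma wedge_action:
  assumes s: "\<And>u v w. s u v w = wedge12 (h p) b u v w" and alt: "alternating3 s"
    and b: "alternating2 b" and bp: "\<And>v. b p v = 0" and p: "h p p = 0"
    and B: "\<And>x. B x = bivector h v p x + (1/2) *\<^sub>R form3_op h s v x"
  shows "s (B x) y w + s x (B y) w + s x y (B w) = - h p v * s x y w"
proof -
  note bil = alternating2_bilinear[OF b] and skew = alternating2_skew[OF b]
  have pzero: "b v p = 0" for v using bp[of v] skew[of v p] by simp
  have sp: "s p u v = 0" "s u p v = 0" "s u v p = 0" for u v
    by (simp_all add: s wedge12_def p bp pzero)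
  have 1: "s (B x) y w + s x (B y) w + s x y (B w) =
     - (h p x * s v y w + h p y * s x v w + h p w * s x y v)
     + (1/2) * (s (form3_op h s v x) y w + s x (form3_op h s v y) w + s x y (form3_op h s v w))"
    by (simp add: B bivector_def alternating3_simps[OF alt] sp algebra_simps)
  have 2: "s (form3_op h s v x) y w + s x (form3_op h s v y) w + s x y (form3_op h s v w) = 0"
    by (rule wedge_self_action[OF s b bp p form3_op[OF alt]])
  have 3: "h p x * s v y w + h p y * s x v w + h p w * s x y v = h p v * s x y w"
    using skew[of w v] skew[of y v] skew[of v x] skew[of w x] skew[of v y] skew[of y x] skew[of v w] skew[of w y] skew[of x v]
    by (simp add: s wedge12_def algebra_simps)
  show ?thesis unfolding 1 2 3 by simp
qed

end

section \<open>Smooth fields and 3-forms on a Lorentzian manifold\<close>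

locale lorentz_mfd = smooth_mfd M for M :: "('m::{t2_space,second_countable_topology}, 'e::euclidean_space) manifold" +
  fixes g :: "'m \<Rightarrow> 'e \<Rightarrow> 'e \<Rightarrow> real"
  assumes lorentzian: "lorentzian_manifold M g"
begin

lemma metric: "lorentz_space (g x)"
  using lorentzian unfolding lorentzian_manifold_def lorentz_space_def by blast

lemmas g_simps = lorentz_space.h_simps[OF metric]
lemmas g_sym = lorentz_space.h_sym[OF metric]
lemmas g_eqI = lorentz_space.h_eqI[OF metric]

lemma dim_ge_2: "DIM('e) \<ge> 2"
  using lorentzian unfolding lorentzian_manifold_def by blast

lemma smooth_fun_g: "open U \<Longrightarrow> smooth_vf M U X \<Longrightarrow> smooth_vf M U Y \<Longrightarrow> smooth_fun M U (\<lambda>x. g x (X x) (Y x))"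
  using lorentzian unfolding lorentzian_manifold_def by blast

text \<open>Tested on coordinate fields, the hypothesis makes the components of \<open>Z\<close> the
  solution of a linear system with smooth right side, whose matrix is the Gram matrix of the metric.
  The subsets \<open>V\<close> occur because coordinate fields live on chart domains.\<close>

lemma smooth_vf_raise:
  assumes U: "open U" and l: "\<And>V Y. open V \<Longrightarrow> V \<subseteq> U \<Longrightarrow> smooth_vf M V Y \<Longrightarrow> smooth_fun M V (\<lambda>x. g x (Z x) (Y x))"
  shows "smooth_vf M U Z"
proof (rule smooth_vfI)
  fix x assume x: "x \<in> U"
  define c where "c = chart_at M x"
  have c: "c \<in> atlas M" "x \<in> cdomain c" unfolding c_def by (rule chart_atlas chart_dom)+
  let ?V = "cdomain c \<inter> U"
  let ?S = "chart_image c ?V"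
  have V: "open ?V" using open_cdomain[OF c(1)] U by blast
  have S: "open ?S" by (rule open_chart_image[OF c(1) V])
  have E: "smooth_vf M ?V (coord_vf c w)" for w by (rule smooth_vf_subset[OF smooth_coord_vf[OF c(1)]]) blast
  define G where "G y w = (\<Sum>b\<in>Basis. g (cinv c y) (coord_vf c w (cinv c y)) (coord_vf c b (cinv c y)) *\<^sub>R b)" for y w
  define k where "k y = (\<Sum>b\<in>Basis. g (cinv c y) (Z (cinv c y)) (coord_vf c b (cinv c y)) *\<^sub>R b)" for y
  have dom: "cinv c y \<in> cdomain c" if "y \<in> ?S" for y using cinv_chart_image[OF c(1) that] by blast
  have lin: "linear (G y)" if y: "y \<in> ?S" for y
    unfolding G_def using linear_add[OF coord_vf_linear[OF c(1) dom[OF y]]] linear_scale[OF coord_vf_linear[OF c(1) dom[OF y]]]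
    by (intro linearI) (simp_all add: g_simps scaleR_left_distrib sum.distrib scaleR_sum_right)
  have "smooth_on ?S (vf_in_chart M c Z)"
  proof (rule smooth_on_linear_system[OF S lin])
    fix y assume y: "y \<in> ?S"
    show "inj (G y)"
    proof (rule linear_injective_0[THEN iffD2, OF lin[OF y], rule_format])
      fix w assume Gw: "G y w = 0"
      have Gb: "G y w \<bullet> b = g (cinv c y) (coord_vf c w (cinv c y)) (coord_vf c b (cinv c y))" if "b \<in> Basis" for b
        using that by (simp add: G_def inner_sum_left inner_Basis if_distrib sum.delta cong: if_cong)
      from Gw have "g (cinv c y) (coord_vf c w (cinv c y)) (coord_vf c b (cinv c y)) = 0" if "b \<in> Basis" for b
        using Gb[OF that] by simp
      moreover have lb: "linear (\<lambda>u. g (cinv c y) (coord_vf c w (cinv c y)) (coord_vf c u (cinv c y)))"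
        using linear_add[OF coord_vf_linear[OF c(1) dom[OF y]]] linear_scale[OF coord_vf_linear[OF c(1) dom[OF y]]]
        by (intro linearI) (simp_all add: g_simps)
      ultimately have "g (cinv c y) (coord_vf c w (cinv c y)) (coord_vf c u (cinv c y)) = 0" for u
        using linear_euclidean_expansion[OF lb, of u] by simp
      then have "g (cinv c y) (coord_vf c w (cinv c y)) v = 0" for v
        using coord_vf_chart_diff[OF c(1) dom[OF y], of v] by metis
      then have "coord_vf c w (cinv c y) = 0" by (rule lorentz_space.nondegenerate[OF metric])
      then show "w = 0"
        using chart_diff_coord_vf[OF c(1,1) dom[OF y] dom[OF y], of w] J_same[OF c(1) dom[OF y], of w]
          linear_0[OF chart_diff_linear[OF c(1) dom[OF y]]] by simp
    qed
    show "G y (vf_in_chart M c Z y) = k y"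
      unfolding G_def k_def vf_in_chart_def coord_vf_chart_diff[OF c(1) dom[OF y]] ..
  next
    show "smooth_on ?S (\<lambda>y. G y w)" for w
      unfolding G_def
      by (intro smooth_on_sum S smooth_on_scaleR smooth_on_const smooth_funD[OF smooth_fun_g[OF V E E] c(1)])
    show "smooth_on ?S k"
      unfolding k_def
      by (intro smooth_on_sum S smooth_on_scaleR smooth_on_const smooth_funD[OF l[OF V _ E] c(1)]) blast
  qed
  then show "\<exists>c V. c \<in> atlas M \<and> open V \<and> x \<in> V \<and> x \<in> cdomain c \<and> smooth_on (chart_image c V) (vf_in_chart M c Z)"
    using c V x by blast
qed

lemma form3_alternating: "form3 M S \<Longrightarrow> alternating3 (S x)"
  by (simp add: form3_def)

lemma form3_smooth: "form3 M S \<Longrightarrow> open U \<Longrightarrow> smooth_vf M U X \<Longrightarrow> smooth_vf M U Y \<Longrightarrow> smooth_vf M U Z \<Longrightarrow>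
    smooth_fun M U (\<lambda>x. S x (X x) (Y x) (Z x))"
  by (simp add: form3_def)

lemma g_form3_op: "form3 M S \<Longrightarrow> g x (form3_op (g x) (S x) u v) w = S x u v w"
  by (rule lorentz_space.form3_op[OF metric form3_alternating])

lemma smooth_vf_form3_op:
  assumes "form3 M S" "open U" "smooth_vf M U X" "smooth_vf M U Y"
  shows "smooth_vf M U (\<lambda>x. form3_op (g x) (S x) (X x) (Y x))"
  by (rule smooth_vf_raise[OF assms(2)])
    (simp add: g_form3_op[OF assms(1)] form3_smooth[OF assms(1)] smooth_vf_subset[OF assms(3)] smooth_vf_subset[OF assms(4)])

lemma smooth_fun_scale_form3:
  assumes f: "smooth_fun M UNIV f" and S: "form3 M S"
  shows "form3 M (\<lambda>x u v w. f x * S x u v w)"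
  unfolding form3_def
proof (intro conjI allI impI)
  fix x
  show "alternating3 (\<lambda>u v w. f x * S x u v w)"
    unfolding alternating3_def
  proof (intro conjI allI)
    fix u v w
    show "linear (\<lambda>u. f x * S x u v w)"
      by (rule linearI) (simp_all add: alternating3_simps[OF form3_alternating[OF S]] algebra_simps)
    show "f x * S x u v w = - (f x * S x v u w)"
      using alternating3_skew(1)[OF form3_alternating[OF S], of x u v w] by simp
    show "f x * S x u v w = - (f x * S x u w v)"
      using alternating3_skew(2)[OF form3_alternating[OF S], of x u v w] by simp
  qed
next
  fix U X Y Z assume "open U \<and> smooth_vf M U X \<and> smooth_vf M U Y \<and> smooth_vf M U Z"
  then show "smooth_fun M U (\<lambda>x. f x * S x (X x) (Y x) (Z x))"
    by (intro smooth_fun_mult smooth_fun_subset[OF f subset_UNIV] form3_smooth[OF S]) simp_all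
qed

end

section \<open>Metric connections\<close>

locale lorentz_conn = lorentz_mfd M g
  for M :: "('m::{t2_space,second_countable_topology}, 'e::euclidean_space) manifold" and g +
  fixes D :: "('m, 'e) conn"
  assumes conn: "connection M D" and metric_conn: "metric_conn M g D"
begin

lemma D_linear:
  assumes "open U" "smooth_vf M U Y" "x \<in> U" shows "linear (\<lambda>v. D x v Y)"
  using conn[unfolded connection_def, THEN spec, THEN spec, THEN mp, OF conjI[OF assms(1,2)], THEN conjunct1] assms(3)
  by (rule bspec)

lemma D_add:
  assumes "open U" "smooth_vf M U Y" "smooth_vf M U Z" "x \<in> U"
  shows "D x v (\<lambda>y. Y y + Z y) = D x v Y + D x v Z"
  using conn[unfolded connection_def, THEN spec, THEN spec, THEN mp, OF conjI[OF assms(1,2)], THEN conjunct2,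
    THEN conjunct1, THEN bspec, OF assms(4), THEN spec, THEN spec] assms(3) by (rule mp)

lemma D_scaleR:
  assumes "open U" "smooth_vf M U Y" "smooth_fun M U f" "x \<in> U"
  shows "D x v (\<lambda>y. f y *\<^sub>R Y y) = dfun M f x v *\<^sub>R Y x + f x *\<^sub>R D x v Y"
  using conn[unfolded connection_def, THEN spec, THEN spec, THEN mp, OF conjI[OF assms(1,2)], THEN conjunct2,
    THEN conjunct2, THEN conjunct1, THEN bspec, OF assms(4), THEN spec, THEN spec] assms(3) by (rule mp)

lemma D_cong:
  assumes "open U" "smooth_vf M U Y" "\<And>y. y \<in> U \<Longrightarrow> Z y = Y y" "x \<in> U"
  shows "D x v Z = D x v Y"
  using conn[unfolded connection_def, THEN spec, THEN spec, THEN mp, OF conjI[OF assms(1,2)], THEN conjunct2,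
    THEN conjunct2, THEN conjunct2, THEN conjunct1, THEN bspec, OF assms(4), THEN spec, THEN spec]
  by (rule mp) (simp add: assms(3))

lemma D_smooth:
  assumes "open U" "smooth_vf M U Y" "smooth_vf M U X" shows "smooth_vf M U (\<lambda>x. D x (X x) Y)"
  using conn[unfolded connection_def, THEN spec, THEN spec, THEN mp, OF conjI[OF assms(1,2)], THEN conjunct2,
    THEN conjunct2, THEN conjunct2, THEN conjunct2, THEN spec] assms(3) by (rule mp)

lemma D_metric: "open U \<Longrightarrow> smooth_vf M U Y \<Longrightarrow> smooth_vf M U Z \<Longrightarrow> x \<in> U \<Longrightarrow>
    dfun M (\<lambda>y. g y (Y y) (Z y)) x v = g x (D x v Y) (Z x) + g x (Y x) (D x v Z)"
  using metric_conn unfolding metric_conn_def by simp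

lemma D_zero: "open U \<Longrightarrow> x \<in> U \<Longrightarrow> D x v (\<lambda>y. 0) = 0"
  using D_add[of U "\<lambda>y. 0" "\<lambda>y. 0" x v] smooth_vf_zero[of U] by simp

lemma D_minus: "open U \<Longrightarrow> smooth_vf M U Y \<Longrightarrow> x \<in> U \<Longrightarrow> D x v (\<lambda>y. - Y y) = - D x v Y"
  using D_scaleR[of U Y "\<lambda>y. -1" x v] smooth_fun_const[of U "-1"] by (simp add: dfun_const)

end

context lorentz_mfd
begin

lemma form3_op_linear:
  assumes S: "form3 M S"
  shows "linear (\<lambda>u. form3_op (g x) (S x) u v)" "linear (\<lambda>v. form3_op (g x) (S x) u v)"
  by (rule linearI; rule g_eqI[where x=x]; simp add: g_form3_op[OF S] g_simps alternating3_simps[OF form3_alternating[OF S]])+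

text \<open>The correction terms are tensorial, so the rules of a connection are inherited from
  \<open>D\<close>; they are skew with respect to \<open>g\<close>, so metricity is inherited as
  well.\<close>

lemma lorentz_conn_twistor_free_conn:
  assumes D: "lorentz_conn M g D" and \<xi>: "smooth_vf M UNIV \<xi>" and S: "form3 M S"
  shows "lorentz_conn M g (twistor_free_conn g D \<xi> S)"
proof -
  interpret D: lorentz_conn M g D by (rule D)
  note alt = alternating3_simps[OF form3_alternating[OF S]]
  let ?N = "twistor_free_conn g D \<xi> S"
  have \<xi>U: "smooth_vf M U \<xi>" for U by (rule smooth_vf_subset[OF \<xi> subset_UNIV])
  have lin: "linear (\<lambda>v. ?N x v Y)" if "open U" "smooth_vf M U Y" "x \<in> U" for U Y x
    unfolding twistor_free_conn_def bivector_def
    using linear_add[OF D.D_linear[OF that]] linear_scale[OF D.D_linear[OF that]]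
      linear_add[OF form3_op_linear(1)[OF S]] linear_scale[OF form3_op_linear(1)[OF S]]
    by (intro linearI) (simp_all add: g_simps algebra_simps)
  have add: "?N x v (\<lambda>y. Y y + Z y) = ?N x v Y + ?N x v Z"
    if "open U" "smooth_vf M U Y" "smooth_vf M U Z" "x \<in> U" for U Y Z x v
    unfolding twistor_free_conn_def bivector_def D.D_add[OF that]
    using linear_add[OF form3_op_linear(2)[OF S]] by (simp add: g_simps algebra_simps)
  have scale: "?N x v (\<lambda>y. f y *\<^sub>R Y y) = dfun M f x v *\<^sub>R Y x + f x *\<^sub>R ?N x v Y"
    if "open U" "smooth_vf M U Y" "smooth_fun M U f" "x \<in> U" for U Y f x v
    unfolding twistor_free_conn_def bivector_def D.D_scaleR[OF that]
    using linear_scale[OF form3_op_linear(2)[OF S]] by (simp add: g_simps algebra_simps)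
  have cong: "?N x v Z = ?N x v Y" if "open U" "smooth_vf M U Y" "\<forall>y\<in>U. Z y = Y y" "x \<in> U" for U Y Z x v
    unfolding twistor_free_conn_def using D.D_cong[OF that(1,2) _ that(4), of Z] that(3,4) by simp
  have sm: "smooth_vf M U (\<lambda>x. ?N x (X x) Y)" if U: "open U" and Y: "smooth_vf M U Y" and X: "smooth_vf M U X" for U X Y
  proof (rule smooth_vf_cong[OF U])
    show "smooth_vf M U (\<lambda>x. D x (X x) Y + (g x (X x) (Y x) *\<^sub>R \<xi> x + (- g x (\<xi> x) (Y x)) *\<^sub>R X x)
        + (1/2) *\<^sub>R form3_op (g x) (S x) (X x) (Y x))"
      by (intro smooth_vf_add smooth_vf_scaleR smooth_fun_minus smooth_fun_g smooth_fun_const D.D_smooth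
          smooth_vf_form3_op[OF S] U X Y \<xi>U)
  qed (simp add: twistor_free_conn_def bivector_def)
  show ?thesis
  proof (unfold_locales)
    show "connection M ?N"
      unfolding connection_def
      by (intro allI impI conjI ballI; (elim conjE)?; (rule lin add scale cong sm; assumption)?)
    show "metric_conn M g ?N"
      unfolding metric_conn_def
    proof (intro allI impI ballI)
      fix U Y Z x v assume YZ: "open U \<and> smooth_vf M U Y \<and> smooth_vf M U Z" and x: "x \<in> U"
      have "dfun M (\<lambda>y. g y (Y y) (Z y)) x v = g x (D x v Y) (Z x) + g x (Y x) (D x v Z)"
        by (rule D.D_metric) (use YZ x in simp_all)
      then show "dfun M (\<lambda>y. g y (Y y) (Z y)) x v = g x (?N x v Y) (Z x) + g x (Y x) (?N x v Z)"
        using alternating3_skew(2)[OF form3_alternating[OF S], of x v "Z x" "Y x"]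
          g_sym[of x "Y x" "form3_op (g x) (S x) v (Z x)"] g_sym[of x "Y x" "\<xi> x"] g_sym[of x "Y x" v]
        by (simp add: twistor_free_conn_def bivector_def g_simps g_form3_op[OF S])
    qed
  qed
qed

end

section \<open>The torsion and its covariant derivative\<close>

locale twistor_free = lorentz_mfd M g
  for M :: "('m::{t2_space,second_countable_topology}, 'e::euclidean_space) manifold" and g +
  fixes D N :: "('m, 'e) conn" and \<xi> S
  assumes levi_civita: "levi_civita M g D" and conn_N: "connection M N" and metric_N: "metric_conn M g N"
    and smooth_\<xi>: "smooth_vf M UNIV \<xi>" and form_S: "form3 M S"
    and N_eq: "\<And>U Y x v. open U \<Longrightarrow> smooth_vf M U Y \<Longrightarrow> x \<in> U \<Longrightarrow> N x v Y = twistor_free_conn g D \<xi> S x v Y"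
begin

sublocale D: lorentz_conn M g D
  using levi_civita by unfold_locales (simp_all add: levi_civita_def)

sublocale N: lorentz_conn M g N
  by unfold_locales (rule conn_N metric_N)+

lemma smooth_\<xi>_on: "smooth_vf M U \<xi>" by (rule smooth_vf_subset[OF smooth_\<xi> subset_UNIV])

lemmas S_simps = alternating3_simps[OF form3_alternating[OF form_S]]
lemmas S_skew = alternating3_skew[OF form3_alternating[OF form_S]]
lemmas g_S = g_form3_op[OF form_S]

definition T :: "'m \<Rightarrow> 'e \<Rightarrow> 'e \<Rightarrow> 'e" where
  "T x u v = g x (\<xi> x) u *\<^sub>R v - g x (\<xi> x) v *\<^sub>R u + form3_op (g x) (S x) u v"

lemma g_T: "g x (T x u v) w = g x (\<xi> x) u * g x v w - g x (\<xi> x) v * g x u w + S x u v w"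
  by (simp add: T_def g_simps g_S)

lemma smooth_T:
  assumes "open U" "smooth_vf M U X" "smooth_vf M U Y"
  shows "smooth_vf M U (\<lambda>y. T y (X y) (Y y))"
proof (rule smooth_vf_cong[OF assms(1)])
  show "smooth_vf M U (\<lambda>y. (g y (\<xi> y) (X y) *\<^sub>R Y y + (- g y (\<xi> y) (Y y)) *\<^sub>R X y) + form3_op (g y) (S y) (X y) (Y y))"
    by (intro smooth_vf_add smooth_vf_scaleR smooth_fun_minus smooth_fun_g smooth_vf_form3_op[OF form_S] assms smooth_\<xi>_on)
qed (simp add: T_def)

lemma torsion_T: "torsion_tensor M N T"
  unfolding torsion_tensor_def
proof (intro allI impI ballI)
  fix U X Y x assume XY: "open U \<and> smooth_vf M U X \<and> smooth_vf M U Y" and x: "x \<in> U"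
  have "torsion_tensor M D (\<lambda>_ _ _. 0)" using levi_civita by (simp add: levi_civita_def)
  then have "0 = D x (X x) Y - D x (Y x) X - lie_bracket M X Y x"
    using XY x unfolding torsion_tensor_def by simp
  then have "D x (X x) Y = D x (Y x) X + lie_bracket M X Y x" by (simp add: algebra_simps)
  \<comment> \<open>The two covariant derivatives each contribute half of \<open>S(X,Y)\<close>;
    this is why the connection contains the factor one half and the torsion does not.\<close>
  moreover have "form3_op (g x) (S x) (Y x) (X x) = - form3_op (g x) (S x) (X x) (Y x)"
    by (rule g_eqI[where x=x]) (simp add: g_simps g_S S_skew(1)[of x "Y x"])
  ultimately show "T x (X x) (Y x) = N x (X x) Y - N x (Y x) X - lie_bracket M X Y x"
    using XY x g_sym[of x "Y x" "X x"] scaleR_add_left[of "1/2" "1/2" "form3_op (g x) (S x) (X x) (Y x)"]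
    by (simp add: N_eq[of U] twistor_free_conn_def bivector_def T_def algebra_simps)
qed

text \<open>The value at \<open>x\<close> of the covariant derivative of \<open>S\<close> with
  respect to \<open>N\<close> in direction \<open>v\<close>, on the fields \<open>X\<close>,
  \<open>Y\<close>, \<open>Z\<close>.\<close>

definition DS :: "('m \<Rightarrow> 'e) \<Rightarrow> ('m \<Rightarrow> 'e) \<Rightarrow> ('m \<Rightarrow> 'e) \<Rightarrow> 'm \<Rightarrow> 'e \<Rightarrow> real" where
  "DS X Y Z x v = dfun M (\<lambda>y. S y (X y) (Y y) (Z y)) x v -
     S x (N x v X) (Y x) (Z x) - S x (X x) (N x v Y) (Z x) - S x (X x) (Y x) (N x v Z)"

lemma torsion_derivative:
  assumes U: "open U" "x \<in> U" and X: "smooth_vf M U X" and Y: "smooth_vf M U Y" and W: "smooth_vf M U W"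
  shows "g x (N x v (\<lambda>y. T y (X y) (Y y)) - T x (N x v X) (Y x) - T x (X x) (N x v Y)) (W x) =
    g x (N x v \<xi>) (X x) * g x (Y x) (W x) - g x (N x v \<xi>) (Y x) * g x (X x) (W x) + DS X Y W x v"
proof -
  note sg = smooth_fun_g[OF U(1)] and \<xi> = smooth_\<xi>_on[of U]
  have "dfun M (\<lambda>y. g y (T y (X y) (Y y)) (W y)) x v =
      dfun M (\<lambda>y. (g y (\<xi> y) (X y) * g y (Y y) (W y) + - (g y (\<xi> y) (Y y) * g y (X y) (W y))) + S y (X y) (Y y) (W y)) x v"
    by (rule fun_cong[OF dfun_cong[OF U]]) (simp add: g_T)
  also have "\<dots> = (g x (\<xi> x) (X x) * dfun M (\<lambda>y. g y (Y y) (W y)) x v + dfun M (\<lambda>y. g y (\<xi> y) (X y)) x v * g x (Y x) (W x)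
      - (g x (\<xi> x) (Y x) * dfun M (\<lambda>y. g y (X y) (W y)) x v + dfun M (\<lambda>y. g y (\<xi> y) (Y y)) x v * g x (X x) (W x)))
      + dfun M (\<lambda>y. S y (X y) (Y y) (W y)) x v"
    using dfun_add[OF smooth_fun_add[OF U(1) smooth_fun_mult[OF U(1) sg[OF \<xi> X] sg[OF Y W]]
          smooth_fun_minus[OF U(1) smooth_fun_mult[OF U(1) sg[OF \<xi> Y] sg[OF X W]]]] form3_smooth[OF form_S U(1) X Y W] U(2), of v]
      dfun_add[OF smooth_fun_mult[OF U(1) sg[OF \<xi> X] sg[OF Y W]]
          smooth_fun_minus[OF U(1) smooth_fun_mult[OF U(1) sg[OF \<xi> Y] sg[OF X W]]] U(2), of v]
      dfun_minus[OF smooth_fun_mult[OF U(1) sg[OF \<xi> Y] sg[OF X W]] U(2), of v]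
      dfun_mult[OF sg[OF \<xi> X] sg[OF Y W] U(2), of v] dfun_mult[OF sg[OF \<xi> Y] sg[OF X W] U(2), of v] by simp
  finally show ?thesis
    unfolding N.D_metric[OF U(1) smooth_T[OF U(1) X Y] W U(2)] N.D_metric[OF U(1) \<xi> X U(2)]
      N.D_metric[OF U(1) \<xi> Y U(2)] N.D_metric[OF U(1) Y W U(2)] N.D_metric[OF U(1) X W U(2)]
    by (simp add: g_simps g_T DS_def algebra_simps)
qed

lemma parallel_torsionI:
  assumes \<xi>: "\<And>x v. N x v \<xi> = 0" and S: "parallel_form3 M N S"
  shows "parallel_torsion M N"
  unfolding parallel_torsion_def
proof (intro exI conjI allI impI ballI, rule torsion_T)
  fix U X Y x v assume XY: "open U \<and> smooth_vf M U X \<and> smooth_vf M U Y" and x: "x \<in> U"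
  let ?c = "chart_at M x"
  \<comment> \<open>The tensor identity is tested against coordinate fields, which are smooth on the
    chart domain; hence the restriction.\<close>
  let ?V = "U \<inter> cdomain ?c"
  have V: "open ?V" "x \<in> ?V" using XY x chart_dom open_cdomain[OF chart_atlas] by auto
  have XV: "smooth_vf M ?V X" and YV: "smooth_vf M ?V Y"
    using XY smooth_vf_subset Int_lower1 by blast+
  show "N x v (\<lambda>y. T y (X y) (Y y)) = T x (N x v X) (Y x) + T x (X x) (N x v Y)"
  proof (rule g_eqI)
    fix w
    have W: "smooth_vf M ?V (coord_vf ?c w)" by (rule smooth_vf_subset[OF smooth_coord_vf[OF chart_atlas]]) blast
    have "DS X Y (coord_vf ?c w) x v = 0"
      using S V XV YV W unfolding parallel_form3_def DS_def by simp
    then show "g x (N x v (\<lambda>y. T y (X y) (Y y))) w = g x (T x (N x v X) (Y x) + T x (X x) (N x v Y)) w"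
      using torsion_derivative[OF V XV YV W, of v] by (simp add: \<xi> g_simps coord_vf_chart_at)
  qed
qed

end

section \<open>The construction yields parallel torsion\<close>

lemma is_wedge_screenE:
  assumes "is_wedge_screen g p \<omega> \<tau>"
  obtains b where "alternating2 b" "\<And>v. b (p x) v = 0" "\<tau> x = wedge12 (g x (p x)) b"
  using assms unfolding is_wedge_screen_def screen_lift_def by metis

theorem construction_parallel_torsion:
  fixes M :: "('m::{t2_space,second_countable_topology}, 'e::euclidean_space) manifold"
  assumes data: "construction_data M g D p \<omega> \<tau> \<phi>"
  shows "twistor_free_torsion M g (constructed_conn g D p \<tau> \<phi>) (constructed_xi p \<phi>) (constructed_S \<tau> \<phi>) \<and>
    parallel_torsion M (constructed_conn g D p \<tau> \<phi>) \<and> isotropic g (constructed_xi p \<phi>)"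
proof -
  let ?N = "constructed_conn g D p \<tau> \<phi>"
  define \<xi> where "\<xi> = constructed_xi p \<phi>"
  define S where "S = constructed_S \<tau> \<phi>"
  have lm: "lorentzian_manifold M g" and lc: "levi_civita M g D" and p: "parallel_vf M D p" and iso: "isotropic g p"
    and wedge: "is_wedge_screen g p \<omega> \<tau>" and par: "parallel_form3 M D \<tau>" and \<phi>: "smooth_fun M UNIV \<phi>"
    and pd: "\<And>x v. g x (p x) v = dfun M (\<lambda>y. exp (\<phi> y)) x v"
    using data unfolding construction_data_def by blast+
  interpret lorentz_mfd M g
    by unfold_locales (use lm in \<open>simp_all add: lorentzian_manifold_def\<close>)
  interpret D: lorentz_conn M g D
    using lc by unfold_locales (simp_all add: levi_civita_def)
  have ps: "smooth_vf M UNIV p" and Dp: "\<And>x v. D x v p = 0" using p unfolding parallel_vf_def by blast+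
  have \<phi>': "smooth_fun M UNIV (\<lambda>x. - \<phi> x)" by (rule smooth_fun_minus[OF open_UNIV \<phi>])
  have e: "smooth_fun M UNIV (\<lambda>x. exp (- \<phi> x))" by (rule smooth_fun_exp[OF open_UNIV \<phi>'])
  have \<xi>s: "smooth_vf M UNIV \<xi>"
    unfolding \<xi>_def constructed_xi_def by (rule smooth_vf_scaleR[OF open_UNIV e ps])
  have \<tau>: "form3 M \<tau>" using par unfolding parallel_form3_def by simp
  have Ss: "form3 M S"
    unfolding S_def constructed_S_def by (rule smooth_fun_scale_form3[OF e \<tau>])
  have N: "?N = twistor_free_conn g D \<xi> S" by (simp add: constructed_conn_def \<xi>_def S_def)
  have Nc: "lorentz_conn M g ?N"
    unfolding N by (rule lorentz_conn_twistor_free_conn[OF D.lorentz_conn_axioms \<xi>s Ss])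
  interpret twistor_free M g D ?N \<xi> S
    by unfold_locales (use lc lorentz_conn.conn[OF Nc] lorentz_conn.metric_conn[OF Nc] \<xi>s Ss N in simp_all)
  \<comment> \<open>The form dual to \<open>p\<close> is the differential of
    \<open>exp \<phi>\<close>, that is, \<open>exp \<phi>\<close> times that of \<phi>; the
    rescaling to \<xi> removes the factor.\<close>
  have d\<phi>: "g x (\<xi> x) v = dfun M \<phi> x v" for x v
    using pd[of x v] dfun_exp[OF \<phi>, of x v]
    by (simp add: \<xi>_def constructed_xi_def g_simps exp_minus field_simps)
  have null: "g x (\<xi> x) (\<xi> x) = 0" and nonzero: "\<xi> x \<noteq> 0" for x
    using iso unfolding isotropic_def \<xi>_def constructed_xi_def by (simp_all add: g_simps)
  have de: "dfun M (\<lambda>y. exp (- \<phi> y)) x v = - exp (- \<phi> x) * g x (\<xi> x) v" for x v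
    using dfun_exp[OF \<phi>', of x v] dfun_minus[OF \<phi>, of x v] d\<phi> by simp
  have wedge_S: "\<exists>b. alternating2 b \<and> (\<forall>v. b (\<xi> x) v = 0) \<and> (\<forall>u v w. S x u v w = wedge12 (g x (\<xi> x)) b u v w)" for x
  proof -
    obtain b where b: "alternating2 b" "\<And>v. b (p x) v = 0" "\<tau> x = wedge12 (g x (p x)) b"
      using is_wedge_screenE[OF wedge] by metis
    have "b (\<xi> x) v = 0" for v
      using b(2) bilinear_lmul[OF alternating2_bilinear[OF b(1)]] by (simp add: \<xi>_def constructed_xi_def)
    moreover have "S x u v w = wedge12 (g x (\<xi> x)) b u v w" for u v w
      by (simp add: S_def constructed_S_def b(3) wedge12_def \<xi>_def constructed_xi_def g_simps algebra_simps)
    ultimately show ?thesis using b(1) by blast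
  qed
  \<comment> \<open>The change in the derivative of \<open>S\<close> on passing from
    \<open>D\<close> to the new connection. It compensates the derivative of the factor
    \<open>exp (- \<phi>)\<close> given by \<open>de\<close>.\<close>
  have action: "S x (?N x v X - D x v X) (Y x) (Z x) + S x (X x) (?N x v Y - D x v Y) (Z x)
      + S x (X x) (Y x) (?N x v Z - D x v Z) = - g x (\<xi> x) v * S x (X x) (Y x) (Z x)" for x v X Y Z
  proof -
    obtain b where b: "alternating2 b" "\<And>v. b (\<xi> x) v = 0" "\<And>u v w. S x u v w = wedge12 (g x (\<xi> x)) b u v w"
      using wedge_S by metis
    show ?thesis
      using lorentz_space.wedge_action[OF metric b(3) form3_alternating[OF Ss] b(1,2) null refl, of v "X x" "Y x" "Z x"]
      by (simp add: N twistor_free_conn_def)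
  qed
  have S\<xi>: "S x u (\<xi> x) w = 0" for x u w
  proof -
    obtain b where b: "alternating2 b" "\<And>v. b (\<xi> x) v = 0" "\<And>u v w. S x u v w = wedge12 (g x (\<xi> x)) b u v w"
      using wedge_S by metis
    show ?thesis using b(2)[of w] b(2)[of u] alternating2_skew[OF b(1), of u "\<xi> x"] by (simp add: b(3) wedge12_def null)
  qed
  have N\<xi>: "?N x v \<xi> = 0" for x v
  proof -
    \<comment> \<open>This derivative of the factor \<open>exp (- \<phi>)\<close> is cancelled by
      the term \<open>g x v (\<xi> x) *\<^sub>R \<xi> x\<close> of the bivector. The other bivector
      term vanishes because \<xi> is null, and \<open>S\<close> vanishes on \<xi>.\<close>
    have "D x v \<xi> = - g x (\<xi> x) v *\<^sub>R \<xi> x"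
      using D.D_scaleR[OF open_UNIV ps e UNIV_I, of x v] de[of x v]
      by (simp add: \<xi>_def constructed_xi_def Dp)
    moreover have "form3_op (g x) (S x) v (\<xi> x) = 0"
      by (rule g_eqI[where x=x]) (simp add: g_S S\<xi> g_simps)
    ultimately show ?thesis
      using g_sym[of x v "\<xi> x"] by (simp add: N twistor_free_conn_def bivector_def null)
  qed
  have "parallel_form3 M ?N S"
    unfolding parallel_form3_def
  proof (intro conjI allI impI ballI, rule Ss)
    fix U X Y Z x v assume XYZ: "open U \<and> smooth_vf M U X \<and> smooth_vf M U Y \<and> smooth_vf M U Z" and x: "x \<in> U"
    have "dfun M (\<lambda>y. S y (X y) (Y y) (Z y)) x v =
        exp (- \<phi> x) * dfun M (\<lambda>y. \<tau> y (X y) (Y y) (Z y)) x v + dfun M (\<lambda>y. exp (- \<phi> y)) x v * \<tau> x (X x) (Y x) (Z x)"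
      unfolding S_def constructed_S_def
      by (rule dfun_mult[OF smooth_fun_subset[OF e subset_UNIV] form3_smooth[OF \<tau>] x]) (use XYZ in simp_all)
    also have "dfun M (\<lambda>y. \<tau> y (X y) (Y y) (Z y)) x v = \<tau> x (D x v X) (Y x) (Z x) +
        \<tau> x (X x) (D x v Y) (Z x) + \<tau> x (X x) (Y x) (D x v Z)"
      using par XYZ x unfolding parallel_form3_def by simp
    finally have "dfun M (\<lambda>y. S y (X y) (Y y) (Z y)) x v = S x (D x v X) (Y x) (Z x) +
        S x (X x) (D x v Y) (Z x) + S x (X x) (Y x) (D x v Z) - g x (\<xi> x) v * S x (X x) (Y x) (Z x)"
      by (simp add: S_def constructed_S_def de algebra_simps)
    then show "dfun M (\<lambda>y. S y (X y) (Y y) (Z y)) x v =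
         S x (?N x v X) (Y x) (Z x) + S x (X x) (?N x v Y) (Z x) + S x (X x) (Y x) (?N x v Z)"
      using action[of x v X Y Z] by (simp add: S_simps)
  qed
  then have "parallel_torsion M ?N" by (rule parallel_torsionI[OF N\<xi>])
  moreover have "twistor_free_torsion M g ?N \<xi> S"
    unfolding twistor_free_torsion_def using conn_N metric_N \<xi>s Ss lc N by auto
  moreover have "isotropic g \<xi>" unfolding isotropic_def using null nonzero by blast
  ultimately show ?thesis unfolding \<xi>_def S_def by blast
qed

section \<open>The converse\<close>

context twistor_free
begin

lemma T_simps:
  "T x (u + u') v = T x u v + T x u' v" "T x (u - u') v = T x u v - T x u' v" "T x u v = - T x v u"
proof -
  show add: "T x (u + u') v = T x u v + T x u' v" for u u'
    by (rule g_eqI[where x=x]) (simp add: g_T g_simps S_simps algebra_simps)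
  show "T x (u - u') v = T x u v - T x u' v"
    by (rule g_eqI[where x=x]) (simp add: g_T g_simps S_simps algebra_simps)
  show "T x u v = - T x v u"
  proof (rule g_eqI[where x=x])
    fix w show "g x (T x u v) w = g x (- T x v u) w"
      using S_skew(1)[of x u v w] by (simp add: g_T g_simps)
  qed
qed

text \<open>\<open>parallel_torsion\<close> asserts that some torsion tensor is parallel. It has to
  be \<open>T\<close>, because every tangent vector is the value of a coordinate field.\<close>

lemma torsion_tensor_unique:
  assumes "torsion_tensor M N T'" shows "T' = T"
proof (intro ext)
  fix x u w
  let ?c = "chart_at M x"
  have "T' x (coord_vf ?c u x) (coord_vf ?c w x) = T x (coord_vf ?c u x) (coord_vf ?c w x)"
    using assms torsion_T smooth_coord_vf[OF chart_atlas] open_cdomain[OF chart_atlas] chart_dom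
    unfolding torsion_tensor_def by metis
  then show "T' x u w = T x u w" by (simp add: coord_vf_chart_at)
qed

lemma parallel_T:
  assumes "parallel_torsion M N" "open U" "smooth_vf M U X" "smooth_vf M U Y" "x \<in> U"
  shows "N x v (\<lambda>y. T y (X y) (Y y)) = T x (N x v X) (Y x) + T x (X x) (N x v Y)"
proof -
  obtain T' where T': "torsion_tensor M N T'" and
    par: "\<forall>U X Y. open U \<and> smooth_vf M U X \<and> smooth_vf M U Y \<longrightarrow>
        (\<forall>x\<in>U. \<forall>v. N x v (\<lambda>y. T' y (X y) (Y y)) = T' x (N x v X) (Y x) + T' x (X x) (N x v Y))"
    using assms(1) unfolding parallel_torsion_def by (elim exE conjE)
  show ?thesis
    using par[unfolded torsion_tensor_unique[OF T'], THEN spec, THEN spec, THEN spec, THEN mp,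
        OF conjI[OF assms(2) conjI[OF assms(3,4)]], THEN bspec, OF assms(5)] by (rule spec)
qed

lemma parallel_torsionD:
  assumes par: "parallel_torsion M N"
  shows "N x v \<xi> = 0" "parallel_form3 M N S"
proof -
  have key: "g x (N x v \<xi>) (X x) * g x (Y x) (W x) - g x (N x v \<xi>) (Y x) * g x (X x) (W x) + DS X Y W x v = 0"
    if "open U" "x \<in> U" "smooth_vf M U X" "smooth_vf M U Y" "smooth_vf M U W" for U X Y W x v
    using torsion_derivative[OF that, of v] parallel_T[OF par that(1,3,4,2), of v] by (simp add: g_simps)
  show N\<xi>: "N x v \<xi> = 0" for x v
  proof -
    let ?c = "chart_at M x"
    note c = open_cdomain[OF chart_atlas[of x]] chart_dom[of x] smooth_coord_vf[OF chart_atlas[of x]]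
    have "DS X Y Y x v = 0" for X Y
      using S_skew(2)[of x "X x" "Y x" "N x v Y"] by (simp add: DS_def S_simps dfun_const)
    then have eq: "g x (N x v \<xi>) u * g x w w = g x (N x v \<xi>) w * g x u w" for u w
      using key[OF c(1,2) c(3)[of u] c(3)[of w] c(3)[of w], of v] by (simp add: coord_vf_chart_at)
    obtain e where e: "lorentz_frame (g x) e"
      using lorentz_space.lorentz[OF metric[of x]] unfolding lorentz_form_def by blast
    show ?thesis
    proof (rule lorentz_space.frame_eqI[OF metric e])
      fix i assume i: "i < DIM('e)"
      \<comment> \<open>Any index other than \<open>i\<close>, available since the dimension is at
        least 2. For two orthogonal vectors, the second one not null, \<open>eq\<close> forces the
        product with the first to vanish.\<close>
      define j where "j = (if i = 0 then 1 else 0 :: nat)"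
      have j: "j < DIM('e)" "i \<noteq> j" using dim_ge_2 unfolding j_def by (auto split: if_splits)
      have "g x (e j) (e j) \<noteq> 0" "g x (e i) (e j) = 0"
        using e i j unfolding lorentz_frame_def by auto
      then show "g x (N x v \<xi>) (e i) = 0" using eq[of "e i" "e j"] by simp
    qed
  qed
  show "parallel_form3 M N S"
    unfolding parallel_form3_def
  proof (intro conjI allI impI ballI, rule form_S)
    fix U X Y Z x v assume XYZ: "open U \<and> smooth_vf M U X \<and> smooth_vf M U Y \<and> smooth_vf M U Z" and x: "x \<in> U"
    then have "DS X Y Z x v = 0" using key[of U x X Y Z v] by (simp add: N\<xi> g_simps)
    then show "dfun M (\<lambda>y. S y (X y) (Y y) (Z y)) x v =
         S x (N x v X) (Y x) (Z x) + S x (X x) (N x v Y) (Z x) + S x (X x) (Y x) (N x v Z)"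
      by (simp add: DS_def)
  qed
qed

end

section \<open>The curvature of a connection with parallel torsion\<close>

locale parallel_twistor_free = twistor_free M g D N \<xi> S
  for M :: "('m::{t2_space,second_countable_topology}, 'e::euclidean_space) manifold" and g
    and D N :: "('m, 'e) conn" and \<xi> S +
  assumes par: "parallel_torsion M N" and iso: "isotropic g \<xi>"
begin

lemma null: "g x (\<xi> x) (\<xi> x) = 0" and nonzero: "\<xi> x \<noteq> 0"
  using iso by (auto simp: isotropic_def)

lemma N_\<xi>: "N x v \<xi> = 0"
  by (rule parallel_torsionD(1)[OF par])

lemma N_S:
  assumes "open U" "smooth_vf M U X" "smooth_vf M U Y" "smooth_vf M U Z" "x \<in> U"
  shows "dfun M (\<lambda>y. S y (X y) (Y y) (Z y)) x v =
         S x (N x v X) (Y x) (Z x) + S x (X x) (N x v Y) (Z x) + S x (X x) (Y x) (N x v Z)"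
  using parallel_torsionD(2)[OF par] assms unfolding parallel_form3_def by simp

text \<open>The curvature at \<open>x\<close>, with \<open>u\<close> and \<open>v\<close> extended
  by coordinate fields of the preferred chart. These commute, so the bracket term of the usual
  formula is absent. \<open>Z\<close> stays a field; later a vector is inserted as its coordinate
  field.\<close>

definition curv :: "'m \<Rightarrow> 'e \<Rightarrow> 'e \<Rightarrow> ('m \<Rightarrow> 'e) \<Rightarrow> 'e" where
  "curv x u v Z = N x u (\<lambda>y. N y (coord_vf (chart_at M x) v y) Z)
     - N x v (\<lambda>y. N y (coord_vf (chart_at M x) u y) Z)"

text \<open>Second derivatives of \<open>g(Z,W)\<close> along coordinate fields are symmetric, and
  so are the mixed products of first covariant derivatives; the difference of the two orders leaves
  the curvature terms. The same computation with the parallel form \<open>S\<close> gives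
  \<open>curv_form\<close>.\<close>

lemma curv_metric:
  assumes Z: "smooth_vf M (cdomain (chart_at M x)) Z" and W: "smooth_vf M (cdomain (chart_at M x)) W"
  shows "g x (curv x u v Z) (W x) + g x (Z x) (curv x u v W) = 0"
proof -
  let ?c = "chart_at M x" let ?U = "cdomain ?c" let ?E = "coord_vf ?c"
  note U = open_cdomain[OF chart_atlas[of x]] and x = chart_dom[of x] and E = smooth_coord_vf[OF chart_atlas[of x]]
  have "dfun M (\<lambda>y. dfun M (\<lambda>y. g y (Z y) (W y)) y (?E v y)) x u =
     g x (N x u (\<lambda>y. N y (?E v y) Z)) (W x) + g x (N x v Z) (N x u W)
     + (g x (N x u Z) (N x v W) + g x (Z x) (N x u (\<lambda>y. N y (?E v y) W)))" for u v
  proof -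
    have "dfun M (\<lambda>y. dfun M (\<lambda>y. g y (Z y) (W y)) y (?E v y)) x u =
        dfun M (\<lambda>y. g y (N y (?E v y) Z) (W y) + g y (Z y) (N y (?E v y) W)) x u"
      by (rule fun_cong[OF dfun_cong[OF U x]]) (rule N.D_metric[OF U Z W])
    also have "\<dots> = dfun M (\<lambda>y. g y (N y (?E v y) Z) (W y)) x u + dfun M (\<lambda>y. g y (Z y) (N y (?E v y) W)) x u"
      by (rule dfun_add[OF smooth_fun_g smooth_fun_g x]) (intro U N.D_smooth Z W E)+
    finally show ?thesis
      unfolding N.D_metric[OF U N.D_smooth[OF U Z E] W x] N.D_metric[OF U Z N.D_smooth[OF U W E] x]
      by (simp add: coord_vf_chart_at)
  qed
  then show ?thesis
    using dfun_coord_commute[OF chart_atlas smooth_fun_g[OF U Z W] x, of v u]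
    by (simp add: coord_vf_chart_at curv_def g_simps)
qed

lemma curv_form:
  assumes X: "smooth_vf M (cdomain (chart_at M x)) X" and Y: "smooth_vf M (cdomain (chart_at M x)) Y"
    and Z: "smooth_vf M (cdomain (chart_at M x)) Z"
  shows "S x (curv x u v X) (Y x) (Z x) + S x (X x) (curv x u v Y) (Z x) + S x (X x) (Y x) (curv x u v Z) = 0"
proof -
  let ?c = "chart_at M x" let ?U = "cdomain ?c" let ?E = "coord_vf ?c"
  note U = open_cdomain[OF chart_atlas[of x]] and x = chart_dom[of x] and E = smooth_coord_vf[OF chart_atlas[of x]]
  note s = form3_smooth[OF form_S U] and n = N.D_smooth[OF U]
  have "dfun M (\<lambda>y. dfun M (\<lambda>y. S y (X y) (Y y) (Z y)) y (?E v y)) x u =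
     (S x (N x u (\<lambda>y. N y (?E v y) X)) (Y x) (Z x) + S x (N x v X) (N x u Y) (Z x) + S x (N x v X) (Y x) (N x u Z))
     + (S x (N x u X) (N x v Y) (Z x) + S x (X x) (N x u (\<lambda>y. N y (?E v y) Y)) (Z x) + S x (X x) (N x v Y) (N x u Z))
     + (S x (N x u X) (Y x) (N x v Z) + S x (X x) (N x u Y) (N x v Z) + S x (X x) (Y x) (N x u (\<lambda>y. N y (?E v y) Z)))"
    for u v
  proof -
    have "dfun M (\<lambda>y. dfun M (\<lambda>y. S y (X y) (Y y) (Z y)) y (?E v y)) x u =
        dfun M (\<lambda>y. (S y (N y (?E v y) X) (Y y) (Z y) + S y (X y) (N y (?E v y) Y) (Z y))
          + S y (X y) (Y y) (N y (?E v y) Z)) x u"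
      by (rule fun_cong[OF dfun_cong[OF U x]]) (rule N_S[OF U X Y Z])
    also have "\<dots> = dfun M (\<lambda>y. S y (N y (?E v y) X) (Y y) (Z y)) x u + dfun M (\<lambda>y. S y (X y) (N y (?E v y) Y) (Z y)) x u
          + dfun M (\<lambda>y. S y (X y) (Y y) (N y (?E v y) Z)) x u"
      unfolding dfun_add[OF smooth_fun_add[OF U s[OF n[OF X E] Y Z] s[OF X n[OF Y E] Z]] s[OF X Y n[OF Z E]] x]
        dfun_add[OF s[OF n[OF X E] Y Z] s[OF X n[OF Y E] Z] x] ..
    finally show ?thesis
      unfolding N_S[OF U n[OF X E] Y Z x] N_S[OF U X n[OF Y E] Z x] N_S[OF U X Y n[OF Z E] x]
      by (simp add: coord_vf_chart_at)
  qed
  then show ?thesis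
    using dfun_coord_commute[OF chart_atlas s[OF X Y Z] x, of v u]
    by (simp add: coord_vf_chart_at curv_def S_simps)
qed

text \<open>On coordinate fields the torsion is the skew part of the covariant derivative.
  Differentiating it once more, with \<open>T\<close> parallel, expresses the cyclic sum by terms in
  which \<open>T\<close> is applied to a covariant derivative; these pair up, again by the torsion,
  to the nested \<open>T\<close>.\<close>

lemma curv_bianchi:
  fixes x u v w
  defines "E \<equiv> coord_vf (chart_at M x)"
  shows "curv x u v (E w) + curv x v w (E u) + curv x w u (E v) = T x (T x u v) w + T x (T x v w) u + T x (T x w u) v"
proof -
  let ?c = "chart_at M x" let ?U = "cdomain ?c"
  note U = open_cdomain[OF chart_atlas[of x]] and x = chart_dom[of x]
  have E: "smooth_vf M ?U (E w)" for w unfolding E_def by (rule smooth_coord_vf[OF chart_atlas[of x]])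
  have Ex: "E w x = w" for w by (simp add: E_def coord_vf_chart_at)
  have tor: "N y (E u y) (E v) - N y (E v y) (E u) = T y (E u y) (E v y)" if "y \<in> ?U" for y u v
    using torsion_T[unfolded torsion_tensor_def, THEN spec, THEN spec, THEN spec, THEN mp,
        OF conjI[OF U conjI[OF E[of u] E[of v]]], THEN bspec, OF that]
      lie_bracket_coord[OF chart_atlas that, of u v] by (simp add: E_def)
  have NN: "N x u (\<lambda>y. N y (E v y) (E w)) - N x u (\<lambda>y. N y (E w y) (E v)) =
      T x (N x u (E v)) w + T x v (N x u (E w))" for u v w
  proof -
    have n1: "smooth_vf M ?U (\<lambda>y. N y (E v y) (E w))" by (rule N.D_smooth[OF U E E])
    have n2: "smooth_vf M ?U (\<lambda>y. - N y (E w y) (E v))"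
      using smooth_vf_scaleR[OF U smooth_fun_const[of _ "-1"] N.D_smooth[OF U E E]] by simp
    have "N x u (\<lambda>y. T y (E v y) (E w y)) = N x u (\<lambda>y. N y (E v y) (E w) + - N y (E w y) (E v))"
      by (rule N.D_cong[OF U smooth_vf_add[OF U n1 n2] _ x]) (simp add: tor[symmetric])
    also have "\<dots> = N x u (\<lambda>y. N y (E v y) (E w)) + N x u (\<lambda>y. - N y (E w y) (E v))"
      by (rule N.D_add[OF U n1 n2 x])
    also have "\<dots> = N x u (\<lambda>y. N y (E v y) (E w)) - N x u (\<lambda>y. N y (E w y) (E v))"
      using N.D_minus[OF U N.D_smooth[OF U E E] x] by simp
    finally show ?thesis using parallel_T[OF par U E E x] by (simp add: Ex)
  qed
  have tx: "T x (N x u (E v)) w - T x (N x v (E u)) w = T x (T x u v) w" for u v w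
    using tor[OF x, of u v] by (simp add: T_simps(2)[symmetric] Ex)
  have "curv x u v (E w) + curv x v w (E u) + curv x w u (E v) =
     (N x u (\<lambda>y. N y (E v y) (E w)) - N x u (\<lambda>y. N y (E w y) (E v)))
   + (N x v (\<lambda>y. N y (E w y) (E u)) - N x v (\<lambda>y. N y (E u y) (E w)))
   + (N x w (\<lambda>y. N y (E u y) (E v)) - N x w (\<lambda>y. N y (E v y) (E u)))"
    by (simp add: curv_def E_def)
  also have "\<dots> = T x (N x u (E v)) w + T x v (N x u (E w)) + (T x (N x v (E w)) u + T x w (N x v (E u)))
      + (T x (N x w (E u)) v + T x u (N x w (E v)))"
    by (simp only: NN)
  also have "\<dots> = (T x (N x u (E v)) w - T x (N x v (E u)) w) + (T x (N x v (E w)) u - T x (N x w (E v)) u)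
      + (T x (N x w (E u)) v - T x (N x u (E w)) v)"
    using T_simps(3)[of x v "N x u (E w)"] T_simps(3)[of x w "N x v (E u)"] T_simps(3)[of x u "N x w (E v)"] by simp
  finally show ?thesis by (simp only: tx)
qed

lemma torsion_algebra_curv:
  "torsion_algebra (g x) (\<xi> x) (S x) (T x) (\<lambda>u v w. curv x u v (coord_vf (chart_at M x) w))"
proof -
  note E = smooth_coord_vf[OF chart_atlas[of x]]
  interpret lorentz_space "g x" by (rule metric)
  show ?thesis
  proof (unfold_locales)
    show "g x (\<xi> x) (\<xi> x) = 0" "\<xi> x \<noteq> 0" by (rule null nonzero)+
    show "alternating3 (S x)" by (rule form3_alternating[OF form_S])
    show "T x u v = g x (\<xi> x) u *\<^sub>R v - g x (\<xi> x) v *\<^sub>R u + form3_op (g x) (S x) u v" for u v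
      by (rule T_def)
    fix u v w
    show "curv x u v (coord_vf (chart_at M x) w) = - curv x v u (coord_vf (chart_at M x) w)"
      by (simp add: curv_def)
    show "g x (curv x u v (coord_vf (chart_at M x) w)) t = - g x (curv x u v (coord_vf (chart_at M x) t)) w" for t
      using curv_metric[OF E[of w] E[of t], of u v] g_sym[of x w] by (simp add: coord_vf_chart_at)
    have "curv x u v \<xi> = 0"
      unfolding curv_def N_\<xi> using N.D_zero[OF open_UNIV UNIV_I] by simp
    then show "g x (curv x u v (coord_vf (chart_at M x) w)) (\<xi> x) = 0"
      using curv_metric[OF E[of w] smooth_\<xi>_on, of u v] by (simp add: g_simps)
    show "curv x u v (coord_vf (chart_at M x) w) + curv x v w (coord_vf (chart_at M x) u) + curv x w u (coord_vf (chart_at M x) v)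
        = T x (T x u v) w + T x (T x v w) u + T x (T x w u) v"
      by (rule curv_bianchi)
    show "S x (curv x u v (coord_vf (chart_at M x) w)) a b + S x w (curv x u v (coord_vf (chart_at M x) a)) b
        + S x w a (curv x u v (coord_vf (chart_at M x) b)) = 0" for a b
      using curv_form[OF E[of w] E[of a] E[of b], of u v] by (simp add: coord_vf_chart_at)
  qed
qed

lemma degenerate_S:
  assumes "degenerate g S"
  shows "S x (\<xi> x) v w = 0"
    "g x (\<xi> x) u = 0 \<Longrightarrow> g x (\<xi> x) v = 0 \<Longrightarrow> g x (\<xi> x) w = 0 \<Longrightarrow> S x u v w = 0"
proof -
  have "form3_norm_sq (g x) (S x) = 0" using assms by (simp add: degenerate_def)
  from torsion_algebra.s_p_zero[OF torsion_algebra_curv this] torsion_algebra.s_perp_zero[OF torsion_algebra_curv this]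
  show "S x (\<xi> x) v w = 0"
    "g x (\<xi> x) u = 0 \<Longrightarrow> g x (\<xi> x) v = 0 \<Longrightarrow> g x (\<xi> x) w = 0 \<Longrightarrow> S x u v w = 0" .
qed

end

section \<open>Wedge decomposition of a 3-form\<close>

lemma alternating2_interior: "alternating3 s \<Longrightarrow> alternating2 (s q)"
  unfolding alternating2_def bilinear_def
  by (intro conjI allI linearI) (simp_all add: alternating3_simps, rule alternating3_skew(2))

context lorentz_space
begin

text \<open>Subtracting multiples of \<open>q\<close> moves each argument into the complement of
  \<open>p\<close>, where \<open>s\<close> vanishes. In the expansion the terms with
  \<open>q\<close> in more than one slot are zero, and the three with a single \<open>q\<close> make
  up the wedge product.\<close>

lemma wedge_decomposition:
  assumes s: "alternating3 s" and sp: "\<And>v w. s p v w = 0"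
    and perp: "\<And>u v w. h p u = 0 \<Longrightarrow> h p v = 0 \<Longrightarrow> h p w = 0 \<Longrightarrow> s u v w = 0"
    and q: "h p q = 1"
  shows "s u v w = wedge12 (h p) (s q) u v w"
proof -
  have "s (u - h p u *\<^sub>R q) (v - h p v *\<^sub>R q) (w - h p w *\<^sub>R q) = 0"
    by (rule perp) (simp_all add: q)
  then show ?thesis
    using alternating3_skew(1)[OF s, of u q w] alternating3_skew(5)[OF s, of u v q] alternating3_skew(2)[OF s, of q w u]
    by (simp add: wedge12_def alternating3_simps[OF s] algebra_simps)
qed

end

section \<open>Neighbourhoods that are balls in a chart\<close>

context smooth_mfd
begin

lemma open_chart_preimage:
  assumes "c \<in> atlas M" "open S" shows "open (cdomain c \<inter> cmap c -` S)"
  using homeomorphism_cont1[OF chart_homeomorphism[OF assms(1)]] assms(2) open_cdomain[OF assms(1)]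
  by (metis continuous_on_open_vimage inf_commute)

lemma smooth_fun_nonzero_nhd:
  assumes f: "smooth_fun M U f" and U: "open U" "x \<in> U" and "f x \<noteq> 0"
  shows "\<exists>V. open V \<and> x \<in> V \<and> V \<subseteq> U \<and> (\<forall>y\<in>V. f y \<noteq> 0)"
proof -
  let ?c = "chart_at M x"
  note c = chart_atlas[of x] and x = chart_dom[of x]
  let ?S = "chart_image ?c U"
  have S: "open ?S" by (rule open_chart_image[OF c U(1)])
  have "continuous_on ?S (\<lambda>y. f (cinv ?c y))"
    using smooth_on_Ck[OF smooth_funD[OF f c], of 0] by simp
  then have o: "open ((\<lambda>y. f (cinv ?c y)) -` (- {0}) \<inter> ?S)"
    using continuous_on_open_vimage[OF S] open_Compl[OF closed_singleton] by blast
  let ?V = "cdomain ?c \<inter> cmap ?c -` ((\<lambda>y. f (cinv ?c y)) -` (- {0}) \<inter> ?S)"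
  have inU: "y \<in> U \<and> f y \<noteq> 0" if "y \<in> ?V" for y
  proof -
    have y: "y \<in> cdomain ?c" "cmap ?c y \<in> ?S" "f (cinv ?c (cmap ?c y)) \<noteq> 0" using that by auto
    then show ?thesis using cinv_chart_image(2)[OF c y(2)] cinv_cmap[OF c y(1)] by simp
  qed
  show ?thesis
  proof (intro exI conjI ballI)
    show "open ?V" by (rule open_chart_preimage[OF c o])
    show "x \<in> ?V" using x U(2) assms(4) cinv_cmap[OF c x] by auto
    show "?V \<subseteq> U" using inU by blast
    show "f y \<noteq> 0" if "y \<in> ?V" for y using inU[OF that] by blast
  qed
qed

text \<open>Such neighbourhoods carry the convexity of a ball over to the manifold: it gives
  path-connectedness, constancy of functions with zero derivative, and a domain for the Poincare
  lemma.\<close>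

lemma chart_ball:
  assumes "open U" "x \<in> U"
  obtains e where "e > 0" "ball (cmap (chart_at M x) x) e \<subseteq> chart_image (chart_at M x) U"
    "open (cdomain (chart_at M x) \<inter> cmap (chart_at M x) -` ball (cmap (chart_at M x) x) e)"
    "cdomain (chart_at M x) \<inter> cmap (chart_at M x) -` ball (cmap (chart_at M x) x) e =
      cinv (chart_at M x) ` ball (cmap (chart_at M x) x) e"
    "cdomain (chart_at M x) \<inter> cmap (chart_at M x) -` ball (cmap (chart_at M x) x) e \<subseteq> U"
proof -
  let ?c = "chart_at M x"
  note c = chart_atlas[of x] and x = chart_dom[of x]
  obtain e where e: "e > 0" "ball (cmap ?c x) e \<subseteq> chart_image ?c U"
    using open_chart_image[OF c assms(1)] x assms(2) openE by (metis chart_image_mem)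
  let ?B = "ball (cmap ?c x) e"
  have "cinv ?c y \<in> cdomain ?c \<inter> cmap ?c -` ?B" if "y \<in> ?B" for y
    using cinv_chart_image[OF c subsetD[OF e(2) that]] that by simp
  moreover have "y \<in> cinv ?c ` ?B" if "y \<in> cdomain ?c \<inter> cmap ?c -` ?B" for y
    using that cinv_cmap[OF c, of y] by (metis IntD1 IntD2 image_eqI vimageE)
  ultimately have im: "cdomain ?c \<inter> cmap ?c -` ?B = cinv ?c ` ?B" by blast
  moreover have "cinv ?c ` ?B \<subseteq> U" using cinv_chart_image(2)[OF c subsetD[OF e(2)]] by blast
  ultimately show ?thesis using that[OF e open_chart_preimage[OF c open_ball]] by simp
qed

lemma locally_path_connected:
  fixes x :: 'm
  assumes "open U" "x \<in> U"
  shows "\<exists>W. open W \<and> x \<in> W \<and> W \<subseteq> U \<and> path_connected W"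
proof -
  let ?c = "chart_at M x"
  obtain e where e: "e > 0" "ball (cmap ?c x) e \<subseteq> chart_image ?c U"
    "open (cdomain ?c \<inter> cmap ?c -` ball (cmap ?c x) e)"
    "cdomain ?c \<inter> cmap ?c -` ball (cmap ?c x) e = cinv ?c ` ball (cmap ?c x) e"
    "cdomain ?c \<inter> cmap ?c -` ball (cmap ?c x) e \<subseteq> U" using chart_ball[OF assms] .
  have "continuous_on (ball (cmap ?c x) e) (cinv ?c)"
    by (rule continuous_on_subset[OF homeomorphism_cont2[OF chart_homeomorphism[OF chart_atlas]]]) (use e(2) in blast)
  then have "path_connected (cinv ?c ` ball (cmap ?c x) e)"
    by (rule path_connected_continuous_image) (rule convex_imp_path_connected[OF convex_ball])
  moreover have "x \<in> cdomain ?c \<inter> cmap ?c -` ball (cmap ?c x) e" using chart_dom e(1) by simp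
  ultimately show ?thesis using e by metis
qed

lemma dfun_eq_locally_const:
  assumes f: "smooth_fun M U f" and k: "smooth_fun M U k" and U: "open U" "x \<in> U"
    and eq: "\<And>y v. y \<in> U \<Longrightarrow> dfun M f y v = dfun M k y v"
  shows "\<exists>W. open W \<and> x \<in> W \<and> W \<subseteq> U \<and> (\<forall>y\<in>W. f y - f x = k y - k x)"
proof -
  let ?c = "chart_at M x"
  note c = chart_atlas[of x] and x = chart_dom[of x]
  obtain e where e: "e > 0" "ball (cmap ?c x) e \<subseteq> chart_image ?c U"
    "open (cdomain ?c \<inter> cmap ?c -` ball (cmap ?c x) e)"
    "cdomain ?c \<inter> cmap ?c -` ball (cmap ?c x) e = cinv ?c ` ball (cmap ?c x) e"
    "cdomain ?c \<inter> cmap ?c -` ball (cmap ?c x) e \<subseteq> U" using chart_ball[OF U] .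
  let ?B = "ball (cmap ?c x) e"
  have d: "((\<lambda>y. f (cinv ?c y) - k (cinv ?c y)) has_derivative (\<lambda>v. 0)) (at y within ?B)" if y: "y \<in> ?B" for y
  proof -
    note y' = cinv_chart_image[OF c subsetD[OF e(2) y]]
    have "frechet_derivative (\<lambda>y. f (cinv ?c y)) (at y) v = frechet_derivative (\<lambda>y. k (cinv ?c y)) (at y) v" for v
      using dfun_coord_vf[OF f U(1) y'(2) c y'(1), of v] dfun_coord_vf[OF k U(1) y'(2) c y'(1), of v] eq[OF y'(2)] y'(3)
      by simp
    then have "((\<lambda>y. f (cinv ?c y) - k (cinv ?c y)) has_derivative (\<lambda>v. 0)) (at y)"
      using has_derivative_diff[OF smooth_fun_has_derivative[OF f c y'(1,2)] smooth_fun_has_derivative[OF k c y'(1,2)]] y'(3)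
      by simp
    then show ?thesis by (rule has_derivative_at_withinI)
  qed
  obtain a where a: "\<And>y. y \<in> ?B \<Longrightarrow> f (cinv ?c y) - k (cinv ?c y) = a"
    using has_derivative_zero_constant[OF convex_ball d] by blast
  have "f y - k y = a" if "y \<in> cinv ?c ` ?B" for y using a that by blast
  moreover have xW: "x \<in> cdomain ?c \<inter> cmap ?c -` ?B" using x e(1) by simp
  ultimately have "f y - f x = k y - k x" if "y \<in> cdomain ?c \<inter> cmap ?c -` ?B" for y
    using that unfolding e(4) by (smt (verit))
  then show ?thesis using e xW by blast
qed

end

section \<open>Potentials of closed 1-forms\<close>

context lorentz_mfd
begin

text \<open>Closedness is expressed in coordinate fields, as \<open>E\<^sub>u (\<theta>(E\<^sub>v)) = E\<^sub>v (\<theta>(E\<^sub>u))\<close>.\<close>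

lemma local_potential:
  assumes \<xi>: "smooth_vf M UNIV \<xi>"
    and closed: "\<And>c y u v. c \<in> atlas M \<Longrightarrow> y \<in> cdomain c \<Longrightarrow>
      dfun M (\<lambda>y. g y (\<xi> y) (coord_vf c v y)) y (coord_vf c u y) = dfun M (\<lambda>y. g y (\<xi> y) (coord_vf c u y)) y (coord_vf c v y)"
  shows "\<exists>V f. open V \<and> x \<in> V \<and> smooth_fun M V f \<and> (\<forall>y\<in>V. \<forall>v. dfun M f y v = g y (\<xi> y) v)"
proof -
  let ?c = "chart_at M x"
  note c = chart_atlas[of x] and x = chart_dom[of x]
  note U = open_cdomain[OF c]
  have E: "smooth_vf M (cdomain ?c) (coord_vf ?c w)" for w by (rule smooth_coord_vf[OF c])
  have gs: "smooth_fun M (cdomain ?c) (\<lambda>y. g y (\<xi> y) (coord_vf ?c w y))" for w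
    by (rule smooth_fun_g[OF U smooth_vf_subset[OF \<xi> subset_UNIV] E])
  obtain e where e: "e > 0" "ball (cmap ?c x) e \<subseteq> chart_image ?c (cdomain ?c)"
    "open (cdomain ?c \<inter> cmap ?c -` ball (cmap ?c x) e)"
    "cdomain ?c \<inter> cmap ?c -` ball (cmap ?c x) e = cinv ?c ` ball (cmap ?c x) e"
    "cdomain ?c \<inter> cmap ?c -` ball (cmap ?c x) e \<subseteq> cdomain ?c" using chart_ball[OF U x] .
  let ?B = "ball (cmap ?c x) e"
  define \<theta> where "\<theta> y w = g (cinv ?c y) (\<xi> (cinv ?c y)) (coord_vf ?c w (cinv ?c y))" for y w
  have \<theta>s: "smooth_on ?B (\<lambda>y. \<theta> y w)" for w
    unfolding \<theta>_def by (rule smooth_on_subset[OF smooth_funD[OF gs c] e(2)])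
  have dom: "cinv ?c y \<in> cdomain ?c" "cmap ?c (cinv ?c y) = y" if "y \<in> ?B" for y
    using cinv_chart_image[OF c subsetD[OF e(2) that]] by blast+
  have "\<exists>\<psi>. \<forall>y\<in>?B. (\<psi> has_derivative \<theta> y) (at y)"
  proof (rule closed_form_primitive[OF open_ball convex_ball])
    show "cmap ?c x \<in> ?B" using e(1) by simp
    show "linear (\<theta> y)" if "y \<in> ?B" for y
      unfolding \<theta>_def using linear_add[OF coord_vf_linear[OF c dom(1)[OF that]]] linear_scale[OF coord_vf_linear[OF c dom(1)[OF that]]]
      by (intro linearI) (simp_all add: g_simps)
    show "Ck_on 1 ?B (\<lambda>y. \<theta> y v)" for v by (rule smooth_on_Ck[OF \<theta>s])
    show "frechet_derivative (\<lambda>y. \<theta> y v) (at y) w = frechet_derivative (\<lambda>y. \<theta> y w) (at y) v" if "y \<in> ?B" for y v w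
      using closed[OF c dom(1)[OF that], of v w] dfun_coord_vf[OF gs U dom(1)[OF that] c dom(1)[OF that]] dom(2)[OF that]
      by (simp add: \<theta>_def)
  qed
  then obtain \<psi> where \<psi>: "\<And>y. y \<in> ?B \<Longrightarrow> (\<psi> has_derivative \<theta> y) (at y)" by blast
  have \<psi>s: "smooth_on ?B \<psi>" by (rule smooth_on_primitive[OF open_ball \<psi> \<theta>s])
  let ?V = "cdomain ?c \<inter> cmap ?c -` ?B"
  define f where "f y = \<psi> (cmap ?c y)" for y
  have im: "chart_image ?c ?V = ?B" using e(2) by auto
  have fB: "f (cinv ?c y) = \<psi> y" if "y \<in> ?B" for y using dom(2)[OF that] by (simp add: f_def)
  have fs: "smooth_fun M ?V f"
  proof (rule smooth_funI)
    fix y assume y: "y \<in> ?V"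
    have "smooth_on ?B (\<lambda>y. f (cinv ?c y))" using smooth_on_cong[OF open_ball, of _ _ "\<lambda>y. f (cinv ?c y)" \<psi>] fB \<psi>s by simp
    then have "smooth_on (chart_image ?c ?V) (\<lambda>y. f (cinv ?c y))" unfolding im .
    then show "\<exists>c V. c \<in> atlas M \<and> open V \<and> y \<in> V \<and> y \<in> cdomain c \<and> smooth_on (chart_image c V) (\<lambda>y. f (cinv c y))"
      using c e(3) y by blast
  qed
  have "dfun M f y v = g y (\<xi> y) v" if y: "y \<in> ?V" for y v
  proof -
    have yc: "y \<in> cdomain ?c" "cmap ?c y \<in> ?B" using y by auto
    have "((\<lambda>y. f (cinv ?c y)) has_derivative \<theta> (cmap ?c y)) (at (cmap ?c y))"
      by (rule has_derivative_transform_within_open[OF \<psi>[OF yc(2)] open_ball yc(2)]) (simp add: fB)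
    then have "frechet_derivative (\<lambda>y. f (cinv ?c y)) (at (cmap ?c y)) = \<theta> (cmap ?c y)"
      by (metis frechet_derivative_at)
    then show ?thesis
      using dfun_chart[OF fs e(3) y c yc(1), of v] coord_vf_chart_diff[OF c yc(1), of v] cinv_cmap[OF c yc(1)]
      by (simp add: \<theta>_def)
  qed
  moreover have "x \<in> ?V" using x e(1) by simp
  ultimately show ?thesis using e(3) fs by blast
qed

lemma global_potential:
  assumes sc: "simply_connected (UNIV :: 'm set)" and \<xi>: "smooth_vf M UNIV \<xi>"
    and closed: "\<And>c y u v. c \<in> atlas M \<Longrightarrow> y \<in> cdomain c \<Longrightarrow>
      dfun M (\<lambda>y. g y (\<xi> y) (coord_vf c v y)) y (coord_vf c u y) = dfun M (\<lambda>y. g y (\<xi> y) (coord_vf c u y)) y (coord_vf c v y)"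
  shows "\<exists>\<phi>. smooth_fun M UNIV \<phi> \<and> (\<forall>x v. dfun M \<phi> x v = g x (\<xi> x) v)"
proof -
  \<comment> \<open>All local potentials at once: two of them have the same differential, so they
    differ by a locally constant function, as \<open>local_primitives\<close> demands.\<close>
  define P where "P = {(V, f). open V \<and> smooth_fun M V f \<and> (\<forall>y\<in>V. \<forall>v. dfun M f y v = g y (\<xi> y) v)}"
  interpret P: local_primitives P
  proof
    show "open U" if "(U, f) \<in> P" for U f using that by (simp add: P_def)
    show "\<exists>U f. (U, f) \<in> P \<and> x \<in> U" for x
      using local_potential[OF \<xi> closed, of x] unfolding P_def by fastforce
    fix U f V k x assume P: "(U, f) \<in> P" "(V, k) \<in> P" and x: "x \<in> U" "x \<in> V"
    show "\<exists>W. open W \<and> x \<in> W \<and> W \<subseteq> U \<inter> V \<and> (\<forall>y\<in>W. f y - f x = k y - k x)"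
      by (rule dfun_eq_locally_const) (use P x in \<open>auto simp: P_def intro: smooth_fun_subset\<close>)
  qed
  obtain \<phi> where \<phi>: "\<And>U f x. (U, f) \<in> P \<Longrightarrow> x \<in> U \<Longrightarrow>
    \<exists>W. open W \<and> x \<in> W \<and> W \<subseteq> U \<and> (\<forall>y\<in>W. \<phi> y - \<phi> x = f y - f x)"
    using P.global_primitive[OF sc locally_path_connected] by metis
  have loc: "\<exists>W f k. open W \<and> x \<in> W \<and> smooth_fun M W f \<and> (\<forall>y\<in>W. \<phi> y = f y + k) \<and> (\<forall>v. dfun M f x v = g x (\<xi> x) v)" for x
  proof -
    obtain U f where U: "(U, f) \<in> P" "x \<in> U" using P.covers by blast
    obtain W where W: "open W" "x \<in> W" "W \<subseteq> U" "\<And>y. y \<in> W \<Longrightarrow> \<phi> y - \<phi> x = f y - f x" using \<phi>[OF U] by blast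
    have "\<forall>y\<in>W. \<phi> y = f y + (\<phi> x - f x)" using W(4) by fastforce
    moreover have "smooth_fun M W f" using U(1) W(3) smooth_fun_subset unfolding P_def by blast
    ultimately show ?thesis using W(1,2) U unfolding P_def by blast
  qed
  have "smooth_fun M UNIV \<phi>"
  proof (rule smooth_fun_local)
    fix x
    obtain W f k where W: "open W" "x \<in> W" "smooth_fun M W f" "\<forall>y\<in>W. \<phi> y = f y + k" using loc[of x] by blast
    have "smooth_fun M W \<phi>"
      by (rule smooth_fun_cong[OF W(1) _ smooth_fun_add[OF W(1,3) smooth_fun_const]]) (use W(4) in simp)
    then show "\<exists>V. open V \<and> x \<in> V \<and> smooth_fun M V \<phi>" using W by blast
  qed
  moreover have "dfun M \<phi> x v = g x (\<xi> x) v" for x v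
  proof -
    obtain W f k where W: "open W" "x \<in> W" "smooth_fun M W f" "\<forall>y\<in>W. \<phi> y = f y + k" "\<forall>v. dfun M f x v = g x (\<xi> x) v"
      using loc[of x] by blast
    have "dfun M \<phi> x v = dfun M (\<lambda>y. f y + k) x v"
      by (rule fun_cong[OF dfun_cong[OF W(1,2)]]) (use W(4) in simp)
    then show ?thesis using dfun_add[OF W(3) smooth_fun_const W(2), of k v] W(5) by (simp add: dfun_const)
  qed
  ultimately show ?thesis by blast
qed

end

section \<open>Recovering the data of the construction\<close>

context parallel_twistor_free
begin

lemma form3_op_\<xi>: "degenerate g S \<Longrightarrow> form3_op (g x) (S x) v (\<xi> x) = 0"
  using degenerate_S(1)[of x v] S_skew(1)[of x v "\<xi> x"] by (intro g_eqI[where x=x]) (simp add: g_S g_simps)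

lemma D_\<xi>: "degenerate g S \<Longrightarrow> D x v \<xi> = - g x (\<xi> x) v *\<^sub>R \<xi> x"
  using N_\<xi>[of x v] N_eq[OF open_UNIV smooth_\<xi> UNIV_I, of x v] form3_op_\<xi>[of x v] g_sym[of x v]
  by (simp add: twistor_free_conn_def bivector_def null add_eq_0_iff)

lemma D_symmetric_coord:
  assumes c: "c \<in> atlas M" and y: "y \<in> cdomain c"
  shows "D y (coord_vf c u y) (coord_vf c v) = D y (coord_vf c v y) (coord_vf c u)"
proof -
  have "torsion_tensor M D (\<lambda>_ _ _. 0)" using levi_civita by (simp add: levi_civita_def)
  from this[unfolded torsion_tensor_def, THEN spec, THEN spec, THEN spec, THEN mp,
      OF conjI[OF open_cdomain[OF c] conjI[OF smooth_coord_vf[OF c, of u] smooth_coord_vf[OF c, of v]]], THEN bspec, OF y]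
  show ?thesis using lie_bracket_coord[OF c y, of u v] by simp
qed

text \<open>The derivative of the product of \<xi> with a coordinate field has two terms. The one
  with the derivative of \<xi> is symmetric in \<open>u\<close> and \<open>v\<close> by
  \<open>D_\<xi>\<close>, the one with the derivative of the coordinate field because
  \<open>D\<close> is torsion-free.\<close>

lemma ex_potential:
  assumes deg: "degenerate g S" and sc: "simply_connected (UNIV :: 'm set)"
  shows "\<exists>\<phi>. smooth_fun M UNIV \<phi> \<and> (\<forall>x v. dfun M \<phi> x v = g x (\<xi> x) v)"
proof (rule global_potential[OF sc smooth_\<xi>])
  fix c y u v assume c: "c \<in> atlas M" and y: "y \<in> cdomain c"
  note D = D.D_metric[OF open_cdomain[OF c] smooth_\<xi>_on smooth_coord_vf[OF c] y]
  show "dfun M (\<lambda>y. g y (\<xi> y) (coord_vf c v y)) y (coord_vf c u y) = dfun M (\<lambda>y. g y (\<xi> y) (coord_vf c u y)) y (coord_vf c v y)"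
    unfolding D D_\<xi>[OF deg] D_symmetric_coord[OF c y, of u v] by (simp add: g_simps)
qed

lemma wedge_S:
  assumes deg: "degenerate g S"
  shows "\<exists>b. alternating2 b \<and> (\<forall>v. b (\<xi> x) v = 0) \<and> (\<forall>u v w. S x u v w = wedge12 (g x (\<xi> x)) b u v w)"
proof -
  obtain q where q: "g x (\<xi> x) q = 1" using lorentz_space.ex_dual_vector[OF metric nonzero] by blast
  have "S x q (\<xi> x) v = 0" for v
    using degenerate_S(1)[OF deg, of x q v] S_skew(1)[of x q "\<xi> x" v] by simp
  then show ?thesis
    using lorentz_space.wedge_decomposition[OF metric form3_alternating[OF form_S] degenerate_S[OF deg] q]
      alternating2_interior[OF form3_alternating[OF form_S], of x q] by blast
qed

lemma D_S_action:
  assumes deg: "degenerate g S" and U: "open U" and X: "smooth_vf M U X" and Y: "smooth_vf M U Y" and Z: "smooth_vf M U Z" and x: "x \<in> U"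
  shows "dfun M (\<lambda>y. S y (X y) (Y y) (Z y)) x v = S x (D x v X) (Y x) (Z x) + S x (X x) (D x v Y) (Z x)
    + S x (X x) (Y x) (D x v Z) - g x (\<xi> x) v * S x (X x) (Y x) (Z x)"
proof -
  obtain b where b: "alternating2 b" "\<And>v. b (\<xi> x) v = 0" "\<And>u v w. S x u v w = wedge12 (g x (\<xi> x)) b u v w"
    using wedge_S[OF deg] by metis
  show ?thesis
    using N_S[OF U X Y Z x, of v] N_eq[OF U X x, of v] N_eq[OF U Y x, of v] N_eq[OF U Z x, of v]
      lorentz_space.wedge_action[OF metric b(3) form3_alternating[OF form_S] b(1,2) null refl, of v "X x" "Y x" "Z x"]
    by (simp add: twistor_free_conn_def S_simps)
qed

lemma ex_construction_data:
  assumes deg: "degenerate g S" and sc: "simply_connected (UNIV :: 'm set)"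
  shows "\<exists>p \<omega> \<tau> \<phi>. construction_data M g D p \<omega> \<tau> \<phi> \<and> constructed_xi p \<phi> = \<xi> \<and> constructed_S \<tau> \<phi> = S"
proof -
  obtain \<phi> where \<phi>: "smooth_fun M UNIV \<phi>" and d\<phi>: "\<And>x v. dfun M \<phi> x v = g x (\<xi> x) v"
    using ex_potential[OF deg sc] by blast
  have e: "smooth_fun M UNIV (\<lambda>x. exp (\<phi> x))" by (rule smooth_fun_exp[OF open_UNIV \<phi>])
  have de: "dfun M (\<lambda>y. exp (\<phi> y)) x v = exp (\<phi> x) * g x (\<xi> x) v" for x v
    using dfun_exp[OF \<phi>, of x v] d\<phi> by simp
  define p where "p x = exp (\<phi> x) *\<^sub>R \<xi> x" for x
  define \<tau> where "\<tau> x u v w = exp (\<phi> x) * S x u v w" for x u v w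
  have pg: "g x (p x) v = exp (\<phi> x) * g x (\<xi> x) v" for x v by (simp add: p_def g_simps)
  have p0: "g x (p x) (p x) = 0" for x by (simp add: p_def g_simps null)
  have pn: "p x \<noteq> 0" for x by (simp add: p_def nonzero)
  have ps: "smooth_vf M UNIV p" unfolding p_def by (rule smooth_vf_scaleR[OF open_UNIV e smooth_\<xi>])
  have pU: "smooth_vf M U p" for U by (rule smooth_vf_subset[OF ps subset_UNIV])
  have Dp: "D x v p = 0" for x v
    using D.D_scaleR[OF open_UNIV smooth_\<xi> e UNIV_I, of x v] by (simp add: p_def[abs_def] de D_\<xi>[OF deg])
  have \<tau>f: "form3 M \<tau>" unfolding \<tau>_def by (rule smooth_fun_scale_form3[OF e form_S])
  note \<tau>_simps = alternating3_simps[OF form3_alternating[OF \<tau>f]] and \<tau>_skew = alternating3_skew[OF form3_alternating[OF \<tau>f]]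
  have \<tau>par: "parallel_form3 M D \<tau>"
    unfolding parallel_form3_def
  proof (intro conjI allI impI ballI, rule \<tau>f)
    fix U X Y Z x v assume XYZ: "open U \<and> smooth_vf M U X \<and> smooth_vf M U Y \<and> smooth_vf M U Z" and x: "x \<in> U"
    have "dfun M (\<lambda>y. \<tau> y (X y) (Y y) (Z y)) x v =
        exp (\<phi> x) * dfun M (\<lambda>y. S y (X y) (Y y) (Z y)) x v + dfun M (\<lambda>y. exp (\<phi> y)) x v * S x (X x) (Y x) (Z x)"
      unfolding \<tau>_def
      by (rule dfun_mult[OF smooth_fun_subset[OF e subset_UNIV] form3_smooth[OF form_S] x]) (use XYZ in simp_all)
    then show "dfun M (\<lambda>y. \<tau> y (X y) (Y y) (Z y)) x v = \<tau> x (D x v X) (Y x) (Z x) +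
        \<tau> x (X x) (D x v Y) (Z x) + \<tau> x (X x) (Y x) (D x v Z)"
      using D_S_action[OF deg, of U X Y Z x v] XYZ x by (simp add: \<tau>_def de algebra_simps)
  qed
  have \<tau>p: "\<tau> x (p x) u w = 0" "\<tau> x u (p x) w = 0" "\<tau> x u w (p x) = 0" for x u w
  proof -
    show 1: "\<tau> x (p x) u w = 0" for u w using degenerate_S(1)[OF deg] by (simp add: \<tau>_def p_def S_simps)
    show "\<tau> x u (p x) w = 0" "\<tau> x u w (p x) = 0"
      using 1[of u w] 1[of u w] \<tau>_skew(1)[of x u "p x" w] \<tau>_skew(5)[of x u w "p x"] by simp_all
  qed
  have \<tau>perp: "\<tau> x u v w = 0" if "g x (p x) u = 0" "g x (p x) v = 0" "g x (p x) w = 0" for x u v w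
    using that degenerate_S(2)[OF deg, of x u v w] by (simp add: \<tau>_def pg)
  have "\<forall>x. \<exists>q. g x (p x) q = 1" using lorentz_space.ex_dual_vector[OF metric pn] by blast
  then obtain q where q: "\<And>x. g x (p x) (q x) = 1" by metis
  \<comment> \<open>\<open>q\<close> is chosen at each point separately, so no continuity can be
    read off from this definition. The representatives picked by \<open>SOME\<close> are immaterial
    because \<open>p\<close> annihilates \<tau>.\<close>
  define \<omega> where "\<omega> x A B = \<tau> x (SOME a. a \<in> A) (SOME b. b \<in> B) (q x)" for x A B
  have some: "\<exists>t. (SOME a. a \<in> screen_class (p x) u) = u + t *\<^sub>R p x" for x u
  proof -
    have "u \<in> screen_class (p x) u" unfolding screen_class_def by (auto intro!: exI[of _ 0])
    then have "(SOME a. a \<in> screen_class (p x) u) \<in> screen_class (p x) u" by (rule someI)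
    then show ?thesis unfolding screen_class_def by blast
  qed
  have \<omega>: "\<omega> x (screen_class (p x) u) (screen_class (p x) v) = \<tau> x u v (q x)" for x u v
  proof -
    obtain s t where "(SOME a. a \<in> screen_class (p x) u) = u + s *\<^sub>R p x" "(SOME a. a \<in> screen_class (p x) v) = v + t *\<^sub>R p x"
      using some by metis
    then show ?thesis by (simp add: \<omega>_def \<tau>_simps \<tau>p)
  qed
  \<comment> \<open>This replaces \<open>q\<close> by an arbitrary vector \<open>w\<close>. With a
    smooth field for \<open>w\<close> it makes \<omega> accessible to differentiation.\<close>
  have \<tau>\<omega>: "\<tau> x u v w = \<omega> x (screen_class (p x) u) (screen_class (p x) v) * g x (p x) w"
    if "g x (p x) u = 0" "g x (p x) v = 0" for x u v w
  proof -
    have "\<tau> x u v (w - g x (p x) w *\<^sub>R q x) = 0"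
      by (rule \<tau>perp) (use that in \<open>simp_all add: g_simps q\<close>)
    then show ?thesis by (simp add: \<omega> \<tau>_simps)
  qed
  \<comment> \<open>The coordinate field extending \<open>q x\<close> has product 1 with
    \<open>p\<close> at \<open>x\<close>, hence a non-zero product nearby.\<close>
  have loc: "\<exists>V w. open V \<and> x \<in> V \<and> V \<subseteq> U \<inter> cdomain (chart_at M x) \<and>
      (\<forall>y\<in>V. g y (p y) (coord_vf (chart_at M x) w y) \<noteq> 0)" if "open U" "x \<in> U" for U x
  proof -
    let ?c = "chart_at M x"
    note c = chart_atlas[of x]
    let ?U = "U \<inter> cdomain ?c"
    have U: "open ?U" "x \<in> ?U" using that open_cdomain[OF c] chart_dom by auto
    have "smooth_fun M ?U (\<lambda>y. g y (p y) (coord_vf ?c (q x) y))"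
      by (rule smooth_fun_g[OF U(1) pU smooth_vf_subset[OF smooth_coord_vf[OF c]]]) blast
    then have "\<exists>V. open V \<and> x \<in> V \<and> V \<subseteq> ?U \<and> (\<forall>y\<in>V. g y (p y) (coord_vf ?c (q x) y) \<noteq> 0)"
      by (rule smooth_fun_nonzero_nhd[OF _ U]) (simp add: coord_vf_chart_at q)
    then show ?thesis by blast
  qed
  have \<omega>smooth: "smooth_fun M U (\<lambda>x. \<omega> x (screen_class (p x) (Y x)) (screen_class (p x) (Z x)))"
    if U: "open U" and Y: "perp_vf M g p U Y" and Z: "perp_vf M g p U Z" for U Y Z
  proof (rule smooth_fun_local)
    fix x assume x: "x \<in> U"
    let ?c = "chart_at M x"
    obtain V w where V: "open V" "x \<in> V" "V \<subseteq> U \<inter> cdomain ?c"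
      and nz: "\<And>y. y \<in> V \<Longrightarrow> g y (p y) (coord_vf ?c w y) \<noteq> 0" using loc[OF U x] by blast
    have E: "smooth_vf M V (coord_vf ?c w)" by (rule smooth_vf_subset[OF smooth_coord_vf[OF chart_atlas]]) (use V in blast)
    have YV: "smooth_vf M V Y" and ZV: "smooth_vf M V Z"
      using Y Z V(3) smooth_vf_subset unfolding perp_vf_def by blast+
    have perp: "g y (p y) (Y y) = 0" "g y (p y) (Z y) = 0" if "y \<in> V" for y
      using Y Z V(3) that unfolding perp_vf_def perp_def by auto
    have "smooth_fun M V (\<lambda>y. \<tau> y (Y y) (Z y) (coord_vf ?c w y) / g y (p y) (coord_vf ?c w y))"
      by (intro smooth_fun_divide V(1) form3_smooth[OF \<tau>f] smooth_fun_g YV ZV E pU nz)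
    then have "smooth_fun M V (\<lambda>x. \<omega> x (screen_class (p x) (Y x)) (screen_class (p x) (Z x)))"
      by (rule smooth_fun_cong[OF V(1), rotated]) (simp add: \<tau>\<omega>[OF perp] nz)
    then show "\<exists>V. open V \<and> x \<in> V \<and> smooth_fun M V (\<lambda>x. \<omega> x (screen_class (p x) (Y x)) (screen_class (p x) (Z x)))"
      using V by blast
  qed
  have sf: "screen_form2 M g p \<omega>"
    unfolding screen_form2_def screen_alternating2_def
  proof (intro conjI allI impI ballI)
    fix x u v w a b
    show "\<omega> x (screen_class (p x) (a *\<^sub>R u + b *\<^sub>R v)) (screen_class (p x) w) =
        a * \<omega> x (screen_class (p x) u) (screen_class (p x) w) + b * \<omega> x (screen_class (p x) v) (screen_class (p x) w)"
      by (simp add: \<omega> \<tau>_simps)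
    show "\<omega> x (screen_class (p x) u) (screen_class (p x) v) = - \<omega> x (screen_class (p x) v) (screen_class (p x) u)"
      unfolding \<omega> by (rule \<tau>_skew(1))
  next
    fix U Y Z assume "open U \<and> perp_vf M g p U Y \<and> perp_vf M g p U Z"
    then show "smooth_fun M U (\<lambda>x. \<omega> x (screen_class (p x) (Y x)) (screen_class (p x) (Z x)))"
      using \<omega>smooth by simp
  qed
  have spar: "parallel_screen_form2 M g D p \<omega>"
    unfolding parallel_screen_form2_def
  proof (intro conjI allI impI ballI, rule sf)
    fix U Y Z x v assume YZ: "open U \<and> perp_vf M g p U Y \<and> perp_vf M g p U Z" and x: "x \<in> U"
    let ?c = "chart_at M x"
    let ?V = "U \<inter> cdomain ?c" and ?E = "coord_vf ?c (q x)"
    let ?w = "\<lambda>x. \<omega> x (screen_class (p x) (Y x)) (screen_class (p x) (Z x))"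
    have V: "open ?V" "x \<in> ?V" using YZ x chart_dom open_cdomain[OF chart_atlas] by auto
    have Ys: "smooth_vf M ?V Y" and Zs: "smooth_vf M ?V Z"
      using YZ smooth_vf_subset[OF _ Int_lower1] unfolding perp_vf_def by blast+
    have E: "smooth_vf M ?V ?E" by (rule smooth_vf_subset[OF smooth_coord_vf[OF chart_atlas]]) blast
    have perp: "g y (p y) (Y y) = 0" "g y (p y) (Z y) = 0" if "y \<in> U" for y
      using YZ that unfolding perp_vf_def perp_def by auto
    have Dperp: "g x (p x) (D x v Y) = 0" "g x (p x) (D x v Z) = 0"
    proof -
      have "dfun M (\<lambda>y. g y (p y) (Y y)) x v = dfun M (\<lambda>y. 0) x v"
        by (rule fun_cong[OF dfun_cong[OF V]]) (simp add: perp)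
      then show "g x (p x) (D x v Y) = 0"
        using D.D_metric[OF V(1) pU Ys V(2), of v] by (simp add: Dp g_simps dfun_const)
      have "dfun M (\<lambda>y. g y (p y) (Z y)) x v = dfun M (\<lambda>y. 0) x v"
        by (rule fun_cong[OF dfun_cong[OF V]]) (simp add: perp)
      then show "g x (p x) (D x v Z) = 0"
        using D.D_metric[OF V(1) pU Zs V(2), of v] by (simp add: Dp g_simps dfun_const)
    qed
    have ws: "smooth_fun M ?V ?w"
      by (rule smooth_fun_subset[OF \<omega>smooth Int_lower1]) (use YZ in simp_all)
    \<comment> \<open>The relation \<open>\<tau>\<omega>\<close> is differentiated along the field
      \<open>?E\<close>. The terms with the derivative of \<open>?E\<close> agree on both sides by
      \<open>\<tau>\<omega>\<close> itself, and at \<open>x\<close> the derivative of \<omega> is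
      multiplied by \<open>g x (p x) (q x) = 1\<close>.\<close>
    have "dfun M (\<lambda>y. \<tau> y (Y y) (Z y) (?E y)) x v = dfun M (\<lambda>y. ?w y * g y (p y) (?E y)) x v"
      by (rule fun_cong[OF dfun_cong[OF V]]) (rule \<tau>\<omega>[OF perp], simp_all)
    also have "\<dots> = ?w x * dfun M (\<lambda>y. g y (p y) (?E y)) x v + dfun M ?w x v * g x (p x) (?E x)"
      by (rule dfun_mult[OF ws smooth_fun_g[OF V(1) pU E] V(2)])
    also have "dfun M (\<lambda>y. g y (p y) (?E y)) x v = g x (p x) (D x v ?E)"
      using D.D_metric[OF V(1) pU E V(2), of v] by (simp add: Dp g_simps)
    finally have "\<tau> x (D x v Y) (Z x) (q x) + \<tau> x (Y x) (D x v Z) (q x) + \<tau> x (Y x) (Z x) (D x v ?E) =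
        ?w x * g x (p x) (D x v ?E) + dfun M ?w x v"
      using \<tau>par V Ys Zs E unfolding parallel_form3_def by (simp add: coord_vf_chart_at q)
    moreover have "\<tau> x (Y x) (Z x) (D x v ?E) = ?w x * g x (p x) (D x v ?E)"
      by (rule \<tau>\<omega>[OF perp]) (rule x)+
    ultimately show "dfun M ?w x v = \<omega> x (screen_class (p x) (D x v Y)) (screen_class (p x) (Z x)) +
         \<omega> x (screen_class (p x) (Y x)) (screen_class (p x) (D x v Z))"
      unfolding \<omega>[of x "D x v Y"] \<omega>[of x "Y x" "D x v Z"] by simp
  qed
  have wedge: "is_wedge_screen g p \<omega> \<tau>"
    unfolding is_wedge_screen_def screen_lift_def
  \<comment> \<open>The lift is \<tau> with \<open>q\<close> in the first slot. It induces \<omega>,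
    which has \<open>q\<close> in the last slot, because the two differ by a cyclic
    permutation.\<close>
  proof (intro allI exI[of _ "\<tau> x (q x)" for x] conjI ballI)
    fix x
    show "alternating2 (\<tau> x (q x))"
      by (rule alternating2_interior[OF form3_alternating[OF \<tau>f]])
    show "\<tau> x (q x) (p x) v = 0" for v by (rule \<tau>p(2))
    show "\<tau> x (q x) u v = \<omega> x (screen_class (p x) u) (screen_class (p x) v)" for u v
      unfolding \<omega> by (rule \<tau>_skew(4))
    show "\<tau> x = wedge12 (g x (p x)) (\<tau> x (q x))"
      by (intro ext lorentz_space.wedge_decomposition[OF metric form3_alternating[OF \<tau>f] \<tau>p(1) \<tau>perp q])
  qed
  have "construction_data M g D p \<omega> \<tau> \<phi>"
    unfolding construction_data_def parallel_vf_def isotropic_def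
    using lorentzian levi_civita ps Dp p0 pn spar wedge \<tau>par \<phi> de pg by simp
  moreover have "constructed_xi p \<phi> = \<xi>"
    unfolding constructed_xi_def p_def by (simp add: exp_minus)
  moreover have "constructed_S \<tau> \<phi> = S"
    unfolding constructed_S_def \<tau>_def by (simp add: exp_minus mult.assoc[symmetric])
  ultimately show ?thesis by blast
qed

end

section \<open>The identity as an equivalence\<close>

context smooth_mfd
begin

lemma dmap_id: "dmap M M id x v = v"
  using J_same[OF chart_atlas chart_dom, of x v] by (simp add: dmap_def J_def o_def)

lemma push_vf_id: "push_vf M M id X = X"
  by (simp add: push_vf_def dmap_id)

lemma diffeomorphism_id: "diffeomorphism M M id"
  unfolding diffeomorphism_def smooth_map_def using transition_smooth by (simp add: o_def continuous_on_id)

end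

theorem theorem6:
  shows
    "(\<forall>(M\<^sub>0 :: ('m::{t2_space,second_countable_topology}, 'e::euclidean_space) manifold) g\<^sub>0 D\<^sub>0 p\<^sub>0 \<omega> \<tau>\<^sub>0 \<phi>.
       construction_data M\<^sub>0 g\<^sub>0 D\<^sub>0 p\<^sub>0 \<omega> \<tau>\<^sub>0 \<phi> \<longrightarrow>
         twistor_free_torsion M\<^sub>0 g\<^sub>0 (constructed_conn g\<^sub>0 D\<^sub>0 p\<^sub>0 \<tau>\<^sub>0 \<phi>)
           (constructed_xi p\<^sub>0 \<phi>) (constructed_S \<tau>\<^sub>0 \<phi>) \<and>
         parallel_torsion M\<^sub>0 (constructed_conn g\<^sub>0 D\<^sub>0 p\<^sub>0 \<tau>\<^sub>0 \<phi>) \<and>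
         isotropic g\<^sub>0 (constructed_xi p\<^sub>0 \<phi>)) \<and>
     (\<forall>(M :: ('m, 'e) manifold) g N \<xi> S.
       lorentzian_manifold M g \<and> simply_connected (UNIV :: 'm set) \<and>
       twistor_free_torsion M g N \<xi> S \<and> parallel_torsion M N \<and>
       isotropic g \<xi> \<and> degenerate g S \<longrightarrow>
         (\<exists>(M\<^sub>0 :: ('m, 'e) manifold) g\<^sub>0 D\<^sub>0 p\<^sub>0 \<omega> \<tau>\<^sub>0 \<phi> F.
            construction_data M\<^sub>0 g\<^sub>0 D\<^sub>0 p\<^sub>0 \<omega> \<tau>\<^sub>0 \<phi> \<and>
            isometry M g M\<^sub>0 g\<^sub>0 F \<and>
            identifies_conns M N M\<^sub>0 (constructed_conn g\<^sub>0 D\<^sub>0 p\<^sub>0 \<tau>\<^sub>0 \<phi>) F))"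
proof (intro conjI allI impI)
  fix M\<^sub>0 :: "('m, 'e) manifold" and g\<^sub>0 D\<^sub>0 p\<^sub>0 \<omega> \<tau>\<^sub>0 \<phi>
  assume "construction_data M\<^sub>0 g\<^sub>0 D\<^sub>0 p\<^sub>0 \<omega> \<tau>\<^sub>0 \<phi>"
  note forward = construction_parallel_torsion[OF this]
  show "twistor_free_torsion M\<^sub>0 g\<^sub>0 (constructed_conn g\<^sub>0 D\<^sub>0 p\<^sub>0 \<tau>\<^sub>0 \<phi>)
      (constructed_xi p\<^sub>0 \<phi>) (constructed_S \<tau>\<^sub>0 \<phi>)"
    "parallel_torsion M\<^sub>0 (constructed_conn g\<^sub>0 D\<^sub>0 p\<^sub>0 \<tau>\<^sub>0 \<phi>)"
    "isotropic g\<^sub>0 (constructed_xi p\<^sub>0 \<phi>)"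
    using forward by blast+
next
  fix M :: "('m, 'e) manifold" and g N \<xi> S
  assume asm: "lorentzian_manifold M g \<and> simply_connected (UNIV :: 'm set) \<and>
       twistor_free_torsion M g N \<xi> S \<and> parallel_torsion M N \<and>
       isotropic g \<xi> \<and> degenerate g S"
  then have N: "connection M N" "metric_conn M g N" "smooth_vf M UNIV \<xi>" "form3 M S"
    unfolding twistor_free_torsion_def by blast+
  obtain D where D: "levi_civita M g D" and N_D: "\<forall>U Y. open U \<and> smooth_vf M U Y \<longrightarrow>
      (\<forall>x\<in>U. \<forall>v. N x v Y = twistor_free_conn g D \<xi> S x v Y)"
    using asm unfolding twistor_free_torsion_def by (elim conjE exE)
  interpret parallel_twistor_free M g D N \<xi> S
    by unfold_locales (use asm D N N_D in \<open>simp_all add: lorentzian_manifold_def\<close>)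
  obtain p \<omega> \<tau> \<phi> where data: "construction_data M g D p \<omega> \<tau> \<phi>"
    and eq: "constructed_xi p \<phi> = \<xi>" "constructed_S \<tau> \<phi> = S"
    using ex_construction_data asm by blast
  \<comment> \<open>By \<open>eq\<close> the connection constructed on \<open>M\<close> from the
    recovered data agrees with \<open>N\<close> on smooth fields, so \<open>M\<close> itself serves
    as \<open>M\<^sub>0\<close>.\<close>
  have "isometry M g M g id"
    unfolding isometry_def by (simp add: diffeomorphism_id dmap_id)
  moreover have "identifies_conns M N M (constructed_conn g D p \<tau> \<phi>) id"
    unfolding identifies_conns_def constructed_conn_def eq
    using N_D by (simp add: dmap_id push_vf_id)
  ultimately show "\<exists>(M\<^sub>0 :: ('m, 'e) manifold) g\<^sub>0 D\<^sub>0 p\<^sub>0 \<omega> \<tau>\<^sub>0 \<phi> F.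
            construction_data M\<^sub>0 g\<^sub>0 D\<^sub>0 p\<^sub>0 \<omega> \<tau>\<^sub>0 \<phi> \<and>
            isometry M g M\<^sub>0 g\<^sub>0 F \<and>
            identifies_conns M N M\<^sub>0 (constructed_conn g\<^sub>0 D\<^sub>0 p\<^sub>0 \<tau>\<^sub>0 \<phi>) F"
    using data by blast
qed

end
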